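(* Let $n\ge1$, let $F(x,y_0,y_1,\dots,y_n)$ be a function holomorphic near $0\in\mathbb{C}^{n+2}$, and let the generalized power series $\varphi=\sum_{k=1}^{\infty}c_kx^{\lambda_k}$ (with $\mathrm{Re}\,\lambda_1>0$) formally satisfy the Mahler equation $F(x,y,\mu y,\dots,\mu^n y)=0$. Suppose that $$F'_{y_0}(x,\varphi,\mu\varphi,\ldots,\mu^n\varphi)=A_0x^{\nu}+o(x^\nu)\in\mathcal{G},\qquad A_0\ne0,$$ for some $\nu\in\mathbb{C}$. Then the series $\varphi$ uniformly converges in each sector $S$ of sufficiently small radius with the vertex at the origin and of opening less than $2\pi$, defining there a holomorphic function.
   Context: A generalized power series is a formal series $\varphi=\sum_{k=1}^{\infty}c_kx^{\lambda_k}$ with $c_k\in\mathbb{C}$ and pairwise distinct $\lambda_k\in\mathbb{C}$ such that $0<\mathrm{Re}\,\lambda_1\le\mathrm{Re}\,\lambda_2\le\dots$ and $\mathrm{Re}\,\lambda_k\to+\infty$ (coefficients may vanish, so finite sums are included). $\mathcal{G}$ denotes the ring of all such series, with a constant term also allowed. $F'_{y_0}$ is the partial derivative $\partial F/\partial y_0$. $o(x^\nu)\in\mathcal{G}$ denotes a generalized power series starting with a power exponent whose real part is strictly greater than $\mathrm{Re}\,\nu$. The Mahler operator $\mu:y(x)\mapsto y(x^\ell)$, with a fixed integer $\ell\ge2$, acts on $\mathcal{G}$ termwise, $\mu x^\lambda=x^{\ell\lambda}$. Substituting series of positive-real-part exponents into the Taylor series of a function holomorphic near $0$ gives an element of $\mathcal{G}$;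 $\varphi$ formally satisfies the equation if $F(x,\varphi,\mu\varphi,\dots,\mu^n\varphi)=0$ in $\mathcal{G}$. In a sector with vertex at the origin, $x^{\lambda}$ means $e^{\lambda\ln x}$ for a branch of the logarithm on the sector. *)

theory Defs
  imports "HOL-Analysis.Analysis"
begin

section \<open>The ring of generalized power series\<close>

text \<open>
  A series is represented by its coefficient function, mapping the exponent \<open>t\<close> to the coefficient
  of \<open>x\<^sup>t\<close>. Sequences of distinct exponents whose real parts are positive, nondecreasing and tend to
  infinity correspond to supports in \<open>Re t > 0\<close> that have finitely many points in every half plane
  \<open>Re t \<le> R\<close>; in addition a constant term is allowed.
\<close>

typedef gps = "{f :: complex \<Rightarrow> complex.
    (\<forall>t. f t \<noteq> 0 \<longrightarrow> t = 0 \<or> Re t > 0) \<and> (\<forall>R. finite {t. f t \<noteq> 0 \<and> Re t \<le> R})}"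
  morphisms gcoeff Abs_gps
  by (rule exI[of _ "\<lambda>_. 0"]) auto

setup_lifting type_definition_gps

lemma gps_eqI: "(\<And>t. gcoeff f t = gcoeff g t) \<Longrightarrow> f = g"
  by (simp add: gcoeff_inject[symmetric] fun_eq_iff)

lemma gcoeff_nonzeroD: "gcoeff f t \<noteq> 0 \<Longrightarrow> t = 0 \<or> Re t > 0"
  using gcoeff[of f] by auto

lemma gcoeff_nonzero_Re_nonneg: "gcoeff f t \<noteq> 0 \<Longrightarrow> Re t \<ge> 0"
  using gcoeff_nonzeroD[of f t] by auto

lemma finite_gcoeff: "finite {t. gcoeff f t \<noteq> 0 \<and> Re t \<le> R}"
  using gcoeff[of f] by auto

lemma gcoeff_Abs_gps:
  assumes "\<And>t. f t \<noteq> 0 \<Longrightarrow> t = 0 \<or> Re t > 0" "\<And>R. finite {t. f t \<noteq> 0 \<and> Re t \<le> R}"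
  shows "gcoeff (Abs_gps f) = f"
  using assms by (intro Abs_gps_inverse) auto

definition gconv :: "(complex \<Rightarrow> complex) \<Rightarrow> (complex \<Rightarrow> complex) \<Rightarrow> complex \<Rightarrow> complex" where
  "gconv f g t = (\<Sum>p | f p \<noteq> 0 \<and> g (t - p) \<noteq> 0. f p * g (t - p))"

lemma gconv_nonzeroD:
  assumes "gconv f g t \<noteq> 0"
  obtains p q where "f p \<noteq> 0" "g q \<noteq> 0" "t = p + q"
proof -
  have "{p. f p \<noteq> 0 \<and> g (t - p) \<noteq> 0} \<noteq> {}"
    using assms unfolding gconv_def by (metis sum.empty)
  then obtain p where "f p \<noteq> 0" "g (t - p) \<noteq> 0" by auto
  then show ?thesis using that[of p "t - p"] by simp
qed

lemma gconv_comm: "gconv f g = gconv g f"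
  unfolding gconv_def fun_eq_iff
  by (intro allI sum.reindex_bij_witness[where i = "\<lambda>p. t - p" and j = "\<lambda>p. t - p" for t]) auto

instantiation gps :: comm_ring_1
begin

lift_definition zero_gps :: gps is "\<lambda>_. 0" by simp

lift_definition one_gps :: gps is "\<lambda>t. if t = 0 then 1 else 0"
proof -
  have "finite {t :: complex. (if t = 0 then 1 else 0 :: complex) \<noteq> 0 \<and> Re t \<le> R}" for R
    by (rule finite_subset[of _ "{0}"]) auto
  then show "?thesis" by simp
qed

lift_definition plus_gps :: "gps \<Rightarrow> gps \<Rightarrow> gps" is "\<lambda>f g t. f t + g t"
proof -
  fix f g :: "complex \<Rightarrow> complex"
  assume *: "(\<forall>t. f t \<noteq> 0 \<longrightarrow> t = 0 \<or> Re t > 0) \<and> (\<forall>R. finite {t. f t \<noteq> 0 \<and> Re t \<le> R})"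
    "(\<forall>t. g t \<noteq> 0 \<longrightarrow> t = 0 \<or> Re t > 0) \<and> (\<forall>R. finite {t. g t \<noteq> 0 \<and> Re t \<le> R})"
  have "finite {t. f t + g t \<noteq> 0 \<and> Re t \<le> R}" for R
    by (rule finite_subset[of _ "{t. f t \<noteq> 0 \<and> Re t \<le> R} \<union> {t. g t \<noteq> 0 \<and> Re t \<le> R}"])
      (use * in auto)
  moreover have "t = 0 \<or> Re t > 0" if "f t + g t \<noteq> 0" for t
    using that * by (cases "f t = 0") auto
  ultimately show "(\<forall>t. f t + g t \<noteq> 0 \<longrightarrow> t = 0 \<or> Re t > 0) \<and>
      (\<forall>R. finite {t. f t + g t \<noteq> 0 \<and> Re t \<le> R})" by blast
qed

lift_definition uminus_gps :: "gps \<Rightarrow> gps" is "\<lambda>f t. - f t" by simp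

definition minus_gps :: "gps \<Rightarrow> gps \<Rightarrow> gps" where "minus_gps f g = f + - g"

lift_definition times_gps :: "gps \<Rightarrow> gps \<Rightarrow> gps" is gconv
proof -
  fix f g :: "complex \<Rightarrow> complex"
  assume f: "(\<forall>t. f t \<noteq> 0 \<longrightarrow> t = 0 \<or> Re t > 0) \<and> (\<forall>R. finite {t. f t \<noteq> 0 \<and> Re t \<le> R})"
  assume g: "(\<forall>t. g t \<noteq> 0 \<longrightarrow> t = 0 \<or> Re t > 0) \<and> (\<forall>R. finite {t. g t \<noteq> 0 \<and> Re t \<le> R})"
  have nn: "Re t \<ge> 0" if "f t \<noteq> 0 \<or> g t \<noteq> 0" for t
  proof -
    have "t = 0 \<or> Re t > 0" using that f g by blast
    then show ?thesis by auto
  qed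
  have "t = 0 \<or> Re t > 0" if "gconv f g t \<noteq> 0" for t
  proof -
    obtain p q where pq: "f p \<noteq> 0" "g q \<noteq> 0" "t = p + q"
      using \<open>gconv f g t \<noteq> 0\<close> by (rule gconv_nonzeroD)
    then have "p = 0 \<or> Re p > 0" "q = 0 \<or> Re q > 0" using f g by blast+
    then show ?thesis using pq by auto
  qed
  moreover have "finite {t. gconv f g t \<noteq> 0 \<and> Re t \<le> R}" for R
  proof (rule finite_subset)
    let ?A = "{t. f t \<noteq> 0 \<and> Re t \<le> R}" and ?B = "{t. g t \<noteq> 0 \<and> Re t \<le> R}"
    show "finite ((\<lambda>(p, q). p + q) ` (?A \<times> ?B))" using f g by blast
    show "{t. gconv f g t \<noteq> 0 \<and> Re t \<le> R} \<subseteq> (\<lambda>(p, q). p + q) ` (?A \<times> ?B)"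
    proof
      fix t assume t: "t \<in> {t. gconv f g t \<noteq> 0 \<and> Re t \<le> R}"
      then have "gconv f g t \<noteq> 0" by simp
      then obtain p q where pq: "f p \<noteq> 0" "g q \<noteq> 0" "t = p + q" by (rule gconv_nonzeroD)
      then have "Re p \<le> R" "Re q \<le> R" using t nn[of p] nn[of q] by auto
      then show "t \<in> (\<lambda>(p, q). p + q) ` (?A \<times> ?B)"
        using pq by (intro image_eqI[of _ _ "(p, q)"]) auto
    qed
  qed
  ultimately show "(\<forall>t. gconv f g t \<noteq> 0 \<longrightarrow> t = 0 \<or> Re t > 0) \<and>
      (\<forall>R. finite {t. gconv f g t \<noteq> 0 \<and> Re t \<le> R})" by blast
qed

lemma gcoeff_times_superset:
  assumes "finite A" "\<And>p. gcoeff f p \<noteq> 0 \<Longrightarrow> Re p \<le> Re t \<Longrightarrow> p \<in> A"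
  shows "gcoeff (f * g) t = (\<Sum>p\<in>A. gcoeff f p * gcoeff g (t - p))"
  unfolding times_gps.rep_eq gconv_def
proof (rule sum.mono_neutral_left)
  show "{p. gcoeff f p \<noteq> 0 \<and> gcoeff g (t - p) \<noteq> 0} \<subseteq> A"
  proof
    fix p assume p: "p \<in> {p. gcoeff f p \<noteq> 0 \<and> gcoeff g (t - p) \<noteq> 0}"
    then have "Re (t - p) \<ge> 0" using gcoeff_nonzero_Re_nonneg by blast
    then show "p \<in> A" using p assms(2) by simp
  qed
qed (use assms in auto)

instance
proof
  fix f g h :: gps
  show "f + g + h = f + (g + h)" by transfer (simp add: add.assoc)
  show "f + g = g + f" by transfer (simp add: add.commute)
  show "0 + f = f" by transfer simp
  show "- f + f = 0" by transfer simp
  show "f - g = f + - g" by (simp add: minus_gps_def)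
  show "f * g = g * f" by transfer (rule gconv_comm)
  show "(0 :: gps) \<noteq> 1" by transfer (auto simp: fun_eq_iff)
  show "1 * f = f"
  proof (rule gps_eqI)
    fix t
    show "gcoeff (1 * f) t = gcoeff f t"
      by (subst gcoeff_times_superset[where A = "{0}"]) (auto simp: one_gps.rep_eq split: if_splits)
  qed
  show "(f + g) * h = f * h + g * h"
  proof (rule gps_eqI)
    fix t
    let ?A = "{p. gcoeff f p \<noteq> 0 \<and> Re p \<le> Re t} \<union> {p. gcoeff g p \<noteq> 0 \<and> Re p \<le> Re t}"
    have A: "finite ?A" by (simp add: finite_gcoeff)
    have "gcoeff ((f + g) * h) t = (\<Sum>p\<in>?A. gcoeff (f + g) p * gcoeff h (t - p))"
      by (rule gcoeff_times_superset[OF A]) (auto simp: plus_gps.rep_eq)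
    moreover have "gcoeff (f * h) t = (\<Sum>p\<in>?A. gcoeff f p * gcoeff h (t - p))"
      by (rule gcoeff_times_superset[OF A]) auto
    moreover have "gcoeff (g * h) t = (\<Sum>p\<in>?A. gcoeff g p * gcoeff h (t - p))"
      by (rule gcoeff_times_superset[OF A]) auto
    ultimately show "gcoeff ((f + g) * h) t = gcoeff (f * h + g * h) t"
      by (simp add: plus_gps.rep_eq distrib_right sum.distrib)
  qed
  show "f * g * h = f * (g * h)"
  proof (rule gps_eqI)
    fix t
    let ?F = "{p. gcoeff f p \<noteq> 0 \<and> Re p \<le> Re t}" and ?G = "{p. gcoeff g p \<noteq> 0 \<and> Re p \<le> Re t}"
    define A where "A = (\<lambda>(q, s). q + s) ` (?F \<times> ?G)"
    have fin: "finite ?F" "finite ?G" "finite A" by (auto simp: A_def finite_gcoeff)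
    have "gcoeff (f * g * h) t = (\<Sum>p\<in>A. gcoeff (f * g) p * gcoeff h (t - p))"
    proof (rule gcoeff_times_superset[OF fin(3)])
      fix p assume p: "gcoeff (f * g) p \<noteq> 0" "Re p \<le> Re t"
      from p(1) obtain q s where qs: "gcoeff f q \<noteq> 0" "gcoeff g s \<noteq> 0" "p = q + s"
        unfolding times_gps.rep_eq by (rule gconv_nonzeroD)
      then have "Re q \<ge> 0" "Re s \<ge> 0" by (auto intro: gcoeff_nonzero_Re_nonneg)
      then show "p \<in> A" unfolding A_def using qs p by (intro image_eqI[of _ _ "(q, s)"]) auto
    qed
    also have "\<dots> = (\<Sum>p\<in>A. (\<Sum>q\<in>?F. gcoeff f q * gcoeff g (p - q)) * gcoeff h (t - p))"
    proof (rule sum.cong[OF refl])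
      fix p assume "p \<in> A"
      show "gcoeff (f * g) p * gcoeff h (t - p) =
        (\<Sum>q\<in>?F. gcoeff f q * gcoeff g (p - q)) * gcoeff h (t - p)"
      proof (cases "gcoeff h (t - p) = 0")
        case False
        then have "Re p \<le> Re t" using gcoeff_nonzero_Re_nonneg[OF False] by simp
        then show ?thesis by (subst gcoeff_times_superset[OF fin(1)]) auto
      qed simp
    qed
    also have "\<dots> = (\<Sum>q\<in>?F. gcoeff f q * (\<Sum>p\<in>A. gcoeff g (p - q) * gcoeff h (t - p)))"
      by (simp add: sum_distrib_left sum_distrib_right mult.assoc) (rule sum.swap)
    also have "\<dots> = (\<Sum>q\<in>?F. gcoeff f q * gcoeff (g * h) (t - q))"
    proof (rule sum.cong[OF refl])
      fix q assume q: "q \<in> ?F"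
      have "gcoeff (g * h) (t - q) =
          (\<Sum>s\<in>(\<lambda>p. p - q) ` A. gcoeff g s * gcoeff h (t - q - s))"
      proof (rule gcoeff_times_superset)
        fix s assume s: "gcoeff g s \<noteq> 0" "Re s \<le> Re (t - q)"
        moreover have "Re q \<ge> 0" using q by (auto intro: gcoeff_nonzero_Re_nonneg)
        ultimately have "q + s \<in> A" unfolding A_def using q
          by (intro image_eqI[of _ _ "(q, s)"]) auto
        then show "s \<in> (\<lambda>p. p - q) ` A" by (intro image_eqI[of _ _ "q + s"]) auto
      qed (use fin in auto)
      also have "\<dots> = (\<Sum>p\<in>A. gcoeff g (p - q) * gcoeff h (t - p))"
        by (subst sum.reindex) (auto simp: inj_on_def)
      finally show "gcoeff f q * (\<Sum>p\<in>A. gcoeff g (p - q) * gcoeff h (t - p)) =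
          gcoeff f q * gcoeff (g * h) (t - q)" by simp
    qed
    also have "\<dots> = gcoeff (f * (g * h)) t"
      by (rule gcoeff_times_superset[OF fin(1), symmetric]) auto
    finally show "gcoeff (f * g * h) t = gcoeff (f * (g * h)) t" .
  qed
qed

end

lift_definition gps_X :: gps is "\<lambda>t. if t = 1 then 1 else 0"
proof -
  have "finite {t :: complex. (if t = 1 then 1 else 0 :: complex) \<noteq> 0 \<and> Re t \<le> R}" for R
    by (rule finite_subset[of _ "{1}"]) auto
  then show "?thesis" by simp
qed

text \<open>The series \<open>\<Sum>k. c k x\<^bsup>e k\<^esup>\<close>; for injective \<open>e\<close> the sum below has at most one term.\<close>

definition gps_of_seq :: "(nat \<Rightarrow> complex) \<Rightarrow> (nat \<Rightarrow> complex) \<Rightarrow> gps" where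
  "gps_of_seq c e = Abs_gps (\<lambda>t. \<Sum>k | e k = t. c k)"

lemma gcoeff_gps_of_seq:
  assumes "inj e" "\<And>k. Re (e k) > 0" "filterlim (\<lambda>k. Re (e k)) at_top sequentially"
  shows "gcoeff (gps_of_seq c e) t = (\<Sum>k | e k = t. c k)"
proof -
  have ne: "\<exists>k. e k = t" if "(\<Sum>k | e k = t. c k) \<noteq> 0" for t
    using that by (metis (mono_tags, lifting) empty_Collect_eq sum.empty)
  have "finite {t. (\<Sum>k | e k = t. c k) \<noteq> 0 \<and> Re t \<le> R}" for R
  proof -
    have "\<forall>\<^sub>F k in sequentially. Re (e k) > R" using assms(3) by (auto simp: filterlim_at_top_dense)
    then obtain N where N: "\<And>k. k \<ge> N \<Longrightarrow> Re (e k) > R"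
      unfolding eventually_sequentially by blast
    have "{t. (\<Sum>k | e k = t. c k) \<noteq> 0 \<and> Re t \<le> R} \<subseteq> e ` {..<N}"
    proof
      fix t assume t: "t \<in> {t. (\<Sum>k | e k = t. c k) \<noteq> 0 \<and> Re t \<le> R}"
      then obtain k where k: "e k = t" using ne by blast
      then have "k < N" using N[of k] t by (cases "k < N") auto
      then show "t \<in> e ` {..<N}" using k by blast
    qed
    then show ?thesis by (rule finite_subset) simp
  qed
  then show ?thesis unfolding gps_of_seq_def
    using ne assms(2) by (subst gcoeff_Abs_gps) blast+
qed

lemma gcoeff_gps_of_seq_exponent:
  assumes "inj e" "\<And>k. Re (e k) > 0" "filterlim (\<lambda>k. Re (e k)) at_top sequentially"
  shows "gcoeff (gps_of_seq c e) (e k) = c k"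
proof -
  have "{j. e j = e k} = {k}" using assms(1) by (auto dest: injD)
  then show ?thesis by (simp add: gcoeff_gps_of_seq[OF assms])
qed

definition mahler :: "nat \<Rightarrow> gps \<Rightarrow> gps" where
  "mahler l f = Abs_gps (\<lambda>t. gcoeff f (t / of_nat l))"

lemma gcoeff_mahler:
  assumes "l \<ge> 1"
  shows "gcoeff (mahler l f) t = gcoeff f (t / of_nat l)"
proof -
  have "finite {t. gcoeff f (t / of_nat l) \<noteq> 0 \<and> Re t \<le> R}" for R
  proof (rule finite_subset)
    show "finite ((\<lambda>t. of_nat l * t) ` {t. gcoeff f t \<noteq> 0 \<and> Re t \<le> R / real l})"
      by (simp add: finite_gcoeff)
    show "{t. gcoeff f (t / of_nat l) \<noteq> 0 \<and> Re t \<le> R}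
        \<subseteq> (\<lambda>t. of_nat l * t) ` {t. gcoeff f t \<noteq> 0 \<and> Re t \<le> R / real l}"
    proof
      fix t assume t: "t \<in> {t. gcoeff f (t / of_nat l) \<noteq> 0 \<and> Re t \<le> R}"
      then show "t \<in> (\<lambda>t. of_nat l * t) ` {t. gcoeff f t \<noteq> 0 \<and> Re t \<le> R / real l}"
        using assms by (intro image_eqI[of _ _ "t / of_nat l"]) (auto simp: divide_right_mono)
    qed
  qed
  moreover have "t = 0 \<or> Re t > 0" if "gcoeff f (t / of_nat l) \<noteq> 0" for t
    using gcoeff_nonzeroD[OF that] assms by (auto simp: zero_less_divide_iff)
  ultimately show ?thesis unfolding mahler_def by (subst gcoeff_Abs_gps) blast+
qed

definition gps_small_o :: "complex \<Rightarrow> gps \<Rightarrow> bool" where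
  "gps_small_o \<nu> h \<longleftrightarrow> (\<forall>t. gcoeff h t \<noteq> 0 \<longrightarrow> Re \<nu> < Re t)"


section \<open>Holomorphic functions of several variables and their Taylor series\<close>

text \<open>
  \<open>\<complex>\<^sup>m\<close> is the space of functions \<open>nat \<Rightarrow> complex\<close> vanishing at all arguments \<open>\<ge> m\<close>; the
  topology of \<open>nat \<Rightarrow> complex\<close> is that of pointwise convergence and restricts to the usual topology.
\<close>

definition coord_space :: "nat \<Rightarrow> (nat \<Rightarrow> complex) set" where
  "coord_space m = {z. \<forall>k\<ge>m. z k = 0}"

definition complex_differentiable :: "nat \<Rightarrow> ((nat \<Rightarrow> complex) \<Rightarrow> complex) \<Rightarrow> (nat \<Rightarrow> complex) \<Rightarrow> bool" where
  "complex_differentiable m F z \<longleftrightarrow> (\<exists>D :: nat \<Rightarrow> complex.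
     ((\<lambda>w. (F w - F z - (\<Sum>k<m. D k * (w k - z k))) / of_real (\<Sum>k<m. norm (w k - z k))) \<longlongrightarrow> 0)
       (at z within coord_space m))"

definition holomorphic_near_0 :: "nat \<Rightarrow> ((nat \<Rightarrow> complex) \<Rightarrow> complex) \<Rightarrow> bool" where
  "holomorphic_near_0 m F \<longleftrightarrow> (\<exists>r>0. \<forall>z\<in>coord_space m. (\<forall>k<m. norm (z k) < r) \<longrightarrow>
     complex_differentiable m F z)"

definition partial_deriv :: "nat \<Rightarrow> ((nat \<Rightarrow> complex) \<Rightarrow> complex) \<Rightarrow> (nat \<Rightarrow> complex) \<Rightarrow> complex" where
  "partial_deriv k F z = deriv (\<lambda>t. F (z(k := t))) (z k)"

primrec mixed_deriv ::
    "nat \<Rightarrow> (nat \<Rightarrow> nat) \<Rightarrow> ((nat \<Rightarrow> complex) \<Rightarrow> complex) \<Rightarrow> (nat \<Rightarrow> complex) \<Rightarrow> complex" where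
  "mixed_deriv 0 \<alpha> F = F"
| "mixed_deriv (Suc m) \<alpha> F = (partial_deriv m ^^ \<alpha> m) (mixed_deriv m \<alpha> F)"

definition taylor_coeff :: "nat \<Rightarrow> ((nat \<Rightarrow> complex) \<Rightarrow> complex) \<Rightarrow> (nat \<Rightarrow> nat) \<Rightarrow> complex" where
  "taylor_coeff m F \<alpha> = mixed_deriv m \<alpha> F (\<lambda>_. 0) / (\<Prod>k<m. fact (\<alpha> k))"

text \<open>
  \<open>gps_subst m F g\<close> is \<open>F(g\<^sub>0, \<dots>, g\<^sub>m\<^sub>-\<^sub>1)\<close>, where \<open>F\<close> stands for its Taylor series at \<open>0\<close>. If the
  series \<open>g\<^sub>k\<close> have no constant term, only finitely many multi-indices contribute to the
  coefficient of a given \<open>x\<^sup>t\<close>, and the result is a generalized power series; see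
  \<open>finite_contributing\<close> and \<open>gcoeff_gps_subst\<close> below.
\<close>

definition contributing :: "nat \<Rightarrow> (nat \<Rightarrow> gps) \<Rightarrow> complex \<Rightarrow> (nat \<Rightarrow> nat) set" where
  "contributing m g t = {\<alpha>. (\<forall>k\<ge>m. \<alpha> k = 0) \<and> gcoeff (\<Prod>k<m. g k ^ \<alpha> k) t \<noteq> 0}"

definition gps_subst :: "nat \<Rightarrow> ((nat \<Rightarrow> complex) \<Rightarrow> complex) \<Rightarrow> (nat \<Rightarrow> gps) \<Rightarrow> gps" where
  "gps_subst m F g = Abs_gps (\<lambda>t.
     \<Sum>\<alpha>\<in>contributing m g t. taylor_coeff m F \<alpha> * gcoeff (\<Prod>k<m. g k ^ \<alpha> k) t)"

lemma gps_prod_order: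
  fixes m :: nat and g :: "nat \<Rightarrow> gps"
  assumes "\<And>k t. k < m \<Longrightarrow> gcoeff (g k) t \<noteq> 0 \<Longrightarrow> d \<le> Re t"
  assumes "gcoeff (\<Prod>k<m. g k ^ \<alpha> k) t \<noteq> 0"
  shows "d * real (\<Sum>k<m. \<alpha> k) \<le> Re t"
proof -
  have mult: "a + b \<le> Re t"
    if f: "\<And>t. gcoeff f t \<noteq> 0 \<Longrightarrow> a \<le> Re t" and h: "\<And>t. gcoeff h t \<noteq> 0 \<Longrightarrow> b \<le> Re t"
      and fh: "gcoeff (f * h) t \<noteq> 0" for a b :: real and f h t
  proof -
    from fh obtain p q where "gcoeff f p \<noteq> 0" "gcoeff h q \<noteq> 0" "t = p + q"
      unfolding times_gps.rep_eq by (rule gconv_nonzeroD)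
    then show ?thesis using f[of p] h[of q] by simp
  qed
  have pow: "d * real n \<le> Re t" if "gcoeff (g k ^ n) t \<noteq> 0" "k < m" for k n and t :: complex
    using that
  proof (induction n arbitrary: t)
    case 0
    then show ?case by (auto simp: one_gps.rep_eq split: if_splits)
  next
    case (Suc n)
    have "d + d * real n \<le> Re t"
      by (rule mult[of "g k" _ "g k ^ n"]) (use Suc assms(1) in auto)
    then show ?case by (simp add: algebra_simps)
  qed
  have prod: "d * real (\<Sum>k<j. \<alpha> k) \<le> Re t"
    if "gcoeff (\<Prod>k<j. g k ^ \<alpha> k) t \<noteq> 0" "j \<le> m" for j and t :: complex
    using that
  proof (induction j arbitrary: t)
    case 0
    then show ?case by (auto simp: one_gps.rep_eq split: if_splits)
  next
    case (Suc j)
    have "d * real (\<Sum>k<j. \<alpha> k) + d * real (\<alpha> j) \<le> Re t"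
      by (rule mult[of "\<Prod>k<j. g k ^ \<alpha> k" _ "g j ^ \<alpha> j"]) (use Suc pow in auto)
    then show ?case by (simp add: algebra_simps)
  qed
  show ?thesis by (rule prod[OF assms(2) order.refl])
qed

lemma gps_common_order:
  fixes m :: nat and g :: "nat \<Rightarrow> gps"
  assumes "\<And>k. k < m \<Longrightarrow> gcoeff (g k) 0 = 0"
  shows "\<exists>d>0. \<forall>k<m. \<forall>t. gcoeff (g k) t \<noteq> 0 \<longrightarrow> d \<le> Re t"
proof -
  define S where "S = insert 1 (\<Union>k<m. Re ` {t. gcoeff (g k) t \<noteq> 0 \<and> Re t \<le> 1})"
  have S: "finite S" "S \<noteq> {}" by (auto simp: S_def intro!: finite_UN_I finite_imageI finite_gcoeff)
  have pos: "Re t > 0" if "k < m" "gcoeff (g k) t \<noteq> 0" for k t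
    using gcoeff_nonzeroD[OF that(2)] assms[OF that(1)] that(2) by auto
  show ?thesis
  proof (intro exI[of _ "Min S"] conjI allI impI)
    show "Min S > 0" using S pos by (subst Min_gr_iff) (auto simp: S_def)
    fix k t assume kt: "k < m" "gcoeff (g k) t \<noteq> 0"
    show "Min S \<le> Re t"
    proof (cases "Re t \<le> 1")
      case True
      then have "Re t \<in> S" using kt by (auto simp: S_def)
      then show ?thesis using S by simp
    next
      case False
      have "Min S \<le> 1" using S(1) by (simp add: S_def)
      then show ?thesis using False by simp
    qed
  qed
qed

lemma finite_contributing_halfplane:
  assumes "\<And>k. k < m \<Longrightarrow> gcoeff (g k) 0 = 0"
  shows "finite (\<Union>t\<in>{t. Re t \<le> R}. contributing m g t)"
proof -
  obtain d where d: "d > 0" "\<And>k t. k < m \<Longrightarrow> gcoeff (g k) t \<noteq> 0 \<Longrightarrow> d \<le> Re t"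
    using gps_common_order[of m g] assms by auto
  define N where "N = nat \<lceil>R / d\<rceil>"
  let ?B = "{\<alpha>. \<forall>k. (k \<in> {..<m} \<longrightarrow> \<alpha> k \<in> {..N}) \<and> (k \<notin> {..<m} \<longrightarrow> \<alpha> k = (0::nat))}"
  have "finite ?B" by (rule finite_set_of_finite_funs) auto
  moreover have "(\<Union>t\<in>{t. Re t \<le> R}. contributing m g t) \<subseteq> ?B"
  proof
    fix \<alpha> assume "\<alpha> \<in> (\<Union>t\<in>{t. Re t \<le> R}. contributing m g t)"
    then obtain t where t: "Re t \<le> R" "\<forall>k\<ge>m. \<alpha> k = 0" "gcoeff (\<Prod>k<m. g k ^ \<alpha> k) t \<noteq> 0"
      by (auto simp: contributing_def)
    have "d * real (\<Sum>k<m. \<alpha> k) \<le> Re t" by (rule gps_prod_order[OF d(2) t(3)])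
    then have "real (\<Sum>k<m. \<alpha> k) \<le> R / d" using t(1) d(1) by (simp add: field_simps)
    then have "(\<Sum>k<m. \<alpha> k) \<le> N" unfolding N_def by linarith
    then have "\<alpha> k \<le> N" if "k < m" for k
      using member_le_sum[of k "{..<m}" \<alpha>] that by force
    then show "\<alpha> \<in> ?B" using t(2) by auto
  qed
  ultimately show ?thesis by (rule finite_subset[rotated])
qed

lemma finite_contributing:
  assumes "\<And>k. k < m \<Longrightarrow> gcoeff (g k) 0 = 0"
  shows "finite (contributing m g t)"
proof (rule finite_subset)
  show "finite (\<Union>s\<in>{s. Re s \<le> Re t}. contributing m g s)"
    by (rule finite_contributing_halfplane[OF assms])
qed auto

lemma gcoeff_gps_subst:
  assumes "\<And>k. k < m \<Longrightarrow> gcoeff (g k) 0 = 0"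
  shows "gcoeff (gps_subst m F g) t =
    (\<Sum>\<alpha>\<in>contributing m g t. taylor_coeff m F \<alpha> * gcoeff (\<Prod>k<m. g k ^ \<alpha> k) t)"
proof -
  define f where "f t = (\<Sum>\<alpha>\<in>contributing m g t. taylor_coeff m F \<alpha> * gcoeff (\<Prod>k<m. g k ^ \<alpha> k) t)" for t
  have nz: "\<exists>\<alpha>. \<alpha> \<in> contributing m g t" if "f t \<noteq> 0" for t
    using that unfolding f_def by (metis equals0I sum.empty)
  have "t = 0 \<or> Re t > 0" if "f t \<noteq> 0" for t
    using nz[OF that] gcoeff_nonzeroD by (auto simp: contributing_def)
  moreover have "finite {t. f t \<noteq> 0 \<and> Re t \<le> R}" for R
  proof (rule finite_subset)
    let ?C = "\<Union>t\<in>{t. Re t \<le> R}. contributing m g t"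
    show "finite (\<Union>\<alpha>\<in>?C. {t. gcoeff (\<Prod>k<m. g k ^ \<alpha> k) t \<noteq> 0 \<and> Re t \<le> R})"
      using finite_contributing_halfplane[of m g R] assms finite_gcoeff by blast
    show "{t. f t \<noteq> 0 \<and> Re t \<le> R} \<subseteq> (\<Union>\<alpha>\<in>?C. {t. gcoeff (\<Prod>k<m. g k ^ \<alpha> k) t \<noteq> 0 \<and> Re t \<le> R})"
    proof
      fix t assume t: "t \<in> {t. f t \<noteq> 0 \<and> Re t \<le> R}"
      then obtain \<alpha> where "\<alpha> \<in> contributing m g t" using nz by blast
      moreover from this have "gcoeff (\<Prod>k<m. g k ^ \<alpha> k) t \<noteq> 0" by (simp add: contributing_def)
      ultimately show "t \<in> (\<Union>\<alpha>\<in>?C. {t. gcoeff (\<Prod>k<m. g k ^ \<alpha> k) t \<noteq> 0 \<and> Re t \<le> R})"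
        using t by blast
    qed
  qed
  ultimately have "gcoeff (Abs_gps f) t = f t" by (subst gcoeff_Abs_gps) blast+
  then show ?thesis by (simp add: gps_subst_def f_def[abs_def])
qed


section \<open>Mahler equations and sectors\<close>

text \<open>Coordinate \<open>0\<close> of \<open>F\<close> is \<open>x\<close> and coordinate \<open>Suc i\<close> is \<open>y\<^sub>i\<close>.\<close>

definition mahler_tuple :: "nat \<Rightarrow> gps \<Rightarrow> nat \<Rightarrow> gps" where
  "mahler_tuple l y k = (case k of 0 \<Rightarrow> gps_X | Suc i \<Rightarrow> (mahler l ^^ i) y)"

definition formally_satisfies_mahler ::
    "nat \<Rightarrow> nat \<Rightarrow> ((nat \<Rightarrow> complex) \<Rightarrow> complex) \<Rightarrow> gps \<Rightarrow> bool" where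
  "formally_satisfies_mahler l n F y \<longleftrightarrow> gps_subst (n + 2) F (mahler_tuple l y) = 0"

lemma mahler_tuple_const_term:
  assumes "l \<ge> 1" "gcoeff y 0 = 0"
  shows "gcoeff (mahler_tuple l y k) 0 = 0"
proof -
  have "gcoeff ((mahler l ^^ i) y) 0 = 0" for i
    using assms by (induction i) (auto simp: gcoeff_mahler)
  then show ?thesis by (auto simp: mahler_tuple_def gps_X.rep_eq split: nat.split)
qed

definition sector :: "real \<Rightarrow> real \<Rightarrow> complex set" where
  "sector a b = {rcis \<rho> \<theta> | \<rho> \<theta>. 0 < \<rho> \<and> a < \<theta> \<and> \<theta> < b}"

definition log_branch :: "complex set \<Rightarrow> (complex \<Rightarrow> complex) \<Rightarrow> bool" where
  "log_branch S L \<longleftrightarrow> continuous_on S L \<and> (\<forall>x\<in>S. exp (L x) = x)"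

end

theory Submission
  imports
    Defs
    "HOL-Complex_Analysis.Complex_Analysis"
    "HOL-Computational_Algebra.Polynomial"
    "HOL-Real_Asymp.Real_Asymp"
begin

text \<open>
  The sum \<open>\<Sum>k. \<bar>c k\<bar> exp (- R * Re (e k) + K * \<bar>Im (e k)\<bar>)\<close> majorizes the series on the part of a
  sector with \<open>\<bar>x\<bar> < exp (- R)\<close>, if \<open>K\<close> bounds the imaginary part of the branch of the logarithm there.
  So it suffices to show that for every \<open>K\<close> this sum is finite for some \<open>R\<close>.

  Let \<open>d = Re \<nu>\<close> and \<open>\<sigma> = 2 * d + 2\<close>, and write \<open>\<phi> = P + \<psi>\<close>, where \<open>P\<close> consists of the finitely many
  terms with exponents of real part at most \<open>\<sigma>\<close>. Expanding \<open>F\<close> about \<open>(x, P, \<mu>P, \<dots>, \<mu>\<^sup>nP)\<close> turns the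
  equation into
  \<open>A\<^sub>0 x\<^bsup>\<nu>\<^esup> \<psi> = - (F(x, P, \<dots>) + H \<psi> + Q)\<close>.
  Here \<open>A\<^sub>0 x\<^bsup>\<nu>\<^esup> + H\<close> is the partial derivative with respect to \<open>y\<^sub>0\<close> at \<open>P\<close>, so \<open>H\<close> has order greater
  than \<open>d\<close>, and each term of \<open>Q\<close> contains two factors \<open>\<psi>\<close> or a factor \<open>\<mu>\<^sup>i\<psi>\<close> with \<open>i \<ge> 1\<close>.

  First, the exponents \<open>t\<close> of \<open>\<psi>\<close> satisfy \<open>\<bar>Im t\<bar> \<le> C * (Re t - d - 1)\<close> for some \<open>C\<close> (\<open>cone\<close>): at a
  counterexample of minimal real part one of the terms on the right has a nonzero coefficient, but all
  exponents of \<open>\<psi>\<close> that enter there already satisfy the inequality. The shift by \<open>d + 1\<close> is what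
  compensates the division by \<open>x\<^bsup>\<nu>\<^esup>\<close>. Owing to the cone condition \<open>\<mu>\<^sup>i\<psi>\<close> is small compared with \<open>\<psi>\<close>
  in the weighted norms when \<open>R\<close> is large.

  Next, let \<open>b(R)\<close> be \<open>exp (R * \<sigma>)\<close> times the weighted norm of \<open>\<psi>\<close> truncated at real part \<open>T\<close>. If
  \<open>b(R) \<le> 1\<close>, then \<open>\<psi>\<close> has norm at most \<open>exp (- R * \<sigma>)\<close>, the quadratic part \<open>Q\<close> has norm
  \<open>O(exp (- 2 * R * \<sigma>))\<close>, and the equation shows that \<open>b(R) \<le> 1 / 2\<close> as soon as \<open>R \<ge> R\<^sub>1\<close>, where \<open>R\<^sub>1\<close>
  does not depend on \<open>T\<close> (\<open>bootstrap\<close>). Since \<open>b\<close> is continuous and tends to \<open>0\<close> as \<open>R\<close> tends to infinity, it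
  cannot cross the value \<open>1\<close> on \<open>[R\<^sub>1, \<infinity>)\<close>; hence \<open>b(R\<^sub>1) \<le> 1\<close> for every \<open>T\<close> (\<open>gnorm_bound\<close>).

  Of the holomorphy of \<open>F\<close> only Cauchy's estimates for its Taylor coefficients and the relation between
  the Taylor coefficients of \<open>F\<close> and of its partial derivative are needed. Everything else takes place
  in the ring of generalized power series, with finite sums.
\<close>

section \<open>Holomorphic functions of several variables\<close>

lemma partial_deriv_power:
  "(partial_deriv k ^^ a) G z = (deriv ^^ a) (\<lambda>t. G (z(k := t))) (z k)"
proof (induction a arbitrary: z)
  case (Suc a)
  have "(\<lambda>t. (partial_deriv k ^^ a) G (z(k := t))) = (deriv ^^ a) (\<lambda>t. G (z(k := t)))"
    by (simp add: Suc fun_upd_same del: fun_upd_apply)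
  then show ?case
    by (simp add: partial_deriv_def[of k "(partial_deriv k ^^ a) G"] del: fun_upd_apply)
qed simp

text \<open>
  The open polydisc of polyradius \<open>(r, \<dots>, r)\<close> about \<open>0\<close> in \<open>\<complex>\<^sup>m\<close>, where \<open>\<complex>\<^sup>m\<close> is the space
  \<open>coord_space m\<close>.
\<close>

definition polydisc :: "nat \<Rightarrow> real \<Rightarrow> (nat \<Rightarrow> complex) set" where
  "polydisc m r = {z \<in> coord_space m. \<forall>k<m. norm (z k) < r}"

lemma polydisc_upd: "z \<in> polydisc m r \<Longrightarrow> k < m \<Longrightarrow> norm t < r \<Longrightarrow> z(k := t) \<in> polydisc m r"
  by (auto simp: polydisc_def coord_space_def)

lemma polydisc_mono: "r \<le> s \<Longrightarrow> polydisc m r \<subseteq> polydisc m s"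
  by (force simp: polydisc_def)

lemma polydisc_norm: "z \<in> polydisc m r \<Longrightarrow> k < m \<Longrightarrow> norm (z k) < r"
  by (auto simp: polydisc_def)

lemma polydisc_shrink:
  assumes "z \<in> polydisc m r" "r > 0"
  obtains s where "0 < s" "s < r" "z \<in> polydisc m s"
proof -
  have "\<exists>s\<in>{0<..<r}. \<forall>k<j. norm (z k) < s" if "j \<le> m" for j
    using that
  proof (induction j)
    case 0
    show ?case using assms(2) by (intro bexI[of _ "r/2"]) auto
  next
    case (Suc j)
    then obtain s where s: "s \<in> {0<..<r}" "\<forall>k<j. norm (z k) < s" by auto
    have "norm (z j) < r" using Suc.prems assms by (intro polydisc_norm) auto
    then obtain s' where "norm (z j) < s'" "s' < r" using dense by blast
    then show ?case using s by (intro bexI[of _ "max s s'"]) (auto simp: less_Suc_eq less_max_iff_disj)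
  qed
  from this[of m] show ?thesis using that assms(1) by (auto simp: polydisc_def)
qed

text \<open>
  A substitute for holomorphy on the polydisc that is easily seen to be inherited by partial
  derivatives: separate holomorphy together with boundedness on smaller polydiscs. Boundedness is
  what makes difference quotients in one variable converge uniformly in all the others.
\<close>

definition sep_hol :: "nat \<Rightarrow> real \<Rightarrow> ((nat \<Rightarrow> complex) \<Rightarrow> complex) \<Rightarrow> bool" where
  "sep_hol m r G \<longleftrightarrow>
     (\<forall>z\<in>polydisc m r. \<forall>k<m. (\<lambda>t. G (z(k := t))) holomorphic_on ball 0 r) \<and>
     (\<forall>s<r. \<exists>B. \<forall>z\<in>polydisc m s. norm (G z) \<le> B)"

lemma sep_holD: "sep_hol m r G \<Longrightarrow> z \<in> polydisc m r \<Longrightarrow> k < m \<Longrightarrow> (\<lambda>t. G (z(k := t))) holomorphic_on ball 0 r"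
  by (auto simp: sep_hol_def)

text \<open>
  Taylor's formula of first order, with Cauchy's estimate for the second derivative on circles of
  radius \<open>(s - s') / 4\<close>.
\<close>

lemma difference_quotient_bound:
  fixes f :: "complex \<Rightarrow> complex"
  assumes hol: "f holomorphic_on ball 0 r" and s: "s' < s" "s < r"
    and B: "\<And>t. norm t < s \<Longrightarrow> norm (f t) \<le> B"
    and w: "norm w < s'" and h: "norm h < (s - s') / 2"
  shows "norm (f (w + h) - f w - h * deriv f w) \<le> 2 * B / ((s - s') / 4) ^ 2 * norm h ^ 2"
proof -
  define e where "e = (s - s') / 2"
  have e: "e > 0" using s by (simp add: e_def)
  have sub: "ball w e \<subseteq> ball 0 r"
  proof
    fix x assume "x \<in> ball w e"
    then have "norm (x - w) < (s - s') / 2" by (simp add: e_def dist_norm norm_minus_commute)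
    then have "norm x < s' + (s - s') / 2" using w norm_triangle_sub[of x w] by linarith
    then show "x \<in> ball 0 r" using s by (simp add: field_simps)
  qed
  have holf: "(deriv ^^ i) f holomorphic_on ball 0 r" for i
    using hol by (intro holomorphic_higher_deriv) auto
  have bd: "norm ((deriv ^^ 2) f x) \<le> 2 * B / ((s - s') / 4) ^ 2" if x: "x \<in> ball w e" for x
  proof -
    have "norm (x - w) < (s - s') / 2" using x by (simp add: e_def dist_norm norm_minus_commute)
    then have x': "norm x < s' + (s - s') / 2" using w norm_triangle_sub[of x w] by linarith
    have cb: "norm y < s" if "norm (x - y) \<le> (s - s') / 4" for y
      using norm_triangle_sub[of y x] that x' s(1) by (simp add: norm_minus_commute field_simps)
    have c: "cball x ((s - s') / 4) \<subseteq> ball 0 r"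
    proof
      fix y assume "y \<in> cball x ((s - s') / 4)"
      then show "y \<in> ball 0 r" using cb[of y] s(2) by (auto simp: dist_norm)
    qed
    have "norm ((deriv ^^ 2) f x) \<le> fact 2 * B / ((s - s') / 4) ^ 2"
    proof (rule Cauchy_inequality)
      show "f holomorphic_on ball x ((s - s') / 4)"
        by (rule holomorphic_on_subset[OF hol]) (use c ball_subset_cball in blast)
      show "continuous_on (cball x ((s - s') / 4)) f"
        using c holomorphic_on_imp_continuous_on[OF hol] continuous_on_subset by blast
    qed (use s cb B in auto)
    then show ?thesis by simp
  qed
  have "norm ((deriv ^^ 0) f (w + h) - (\<Sum>i\<le>1. (deriv ^^ i) f w * (w + h - w) ^ i / fact i))
      \<le> 2 * B / ((s - s') / 4) ^ 2 * norm (w + h - w) ^ Suc 1 / fact 1"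
  proof (rule complex_Taylor)
    fix i x assume "x \<in> ball w e"
    then have "x \<in> ball 0 r" using sub by blast
    then have "((deriv ^^ i) f has_field_derivative deriv ((deriv ^^ i) f) x) (at x)"
      using holf[of i] holomorphic_derivI by blast
    then show "((deriv ^^ i) f has_field_derivative (deriv ^^ Suc i) f x) (at x within ball w e)"
      using has_field_derivative_at_within by simp
  qed (use bd e h in \<open>auto simp: e_def dist_norm numeral_2_eq_2\<close>)
  then show ?thesis by (simp add: power2_eq_square algebra_simps)
qed

text \<open>
  The limit defining \<open>\<partial>\<^sub>k G\<close> is uniform on smaller polydiscs. Both the holomorphy of \<open>\<partial>\<^sub>k G\<close> in the
  remaining variables and the symmetry of second derivatives follow from this, since
  derivatives of holomorphic functions pass to locally uniform limits.
\<close>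

lemma uniform_limit_difference_quotient:
  assumes G: "sep_hol m r G" and k: "k < m" and s: "s < r"
  shows "uniform_limit (polydisc m s)
    (\<lambda>h z. (G (z(k := z k + h)) - G z) / h) (partial_deriv k G) (at 0)"
proof -
  obtain s' where s': "s < s'" "s' < r" using s dense by blast
  obtain B where B: "\<And>z. z \<in> polydisc m s' \<Longrightarrow> norm (G z) \<le> B"
    using G s'(2) unfolding sep_hol_def by blast
  define C where "C = 2 * B / ((s' - s) / 4) ^ 2"
  have bound: "norm ((G (z(k := z k + h)) - G z) / h - partial_deriv k G z) \<le> C * norm h"
    if h: "norm h < (s' - s) / 2" "h \<noteq> 0" and z: "z \<in> polydisc m s" for h z
  proof -
    define f where "f t = G (z(k := t))" for t
    have z': "z \<in> polydisc m s'" "z \<in> polydisc m r"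
      using z polydisc_mono[of s s' m] polydisc_mono[of s r m] s' s by auto
    have "norm (f (z k + h) - f (z k) - h * deriv f (z k)) \<le> C * norm h ^ 2"
      unfolding C_def
    proof (rule difference_quotient_bound[of f r])
      show "f holomorphic_on ball 0 r" unfolding f_def by (rule sep_holD[OF G z'(2) k])
      show "norm (f t) \<le> B" if "norm t < s'" for t
        unfolding f_def by (intro B polydisc_upd z' k that)
    qed (use s' h polydisc_norm[OF z k] in auto)
    then have "norm (f (z k + h) - f (z k) - h * deriv f (z k)) / norm h \<le> C * norm h ^ 2 / norm h"
      by (intro divide_right_mono) auto
    moreover have "(G (z(k := z k + h)) - G z) / h - partial_deriv k G z =
      (f (z k + h) - f (z k) - h * deriv f (z k)) / h"
      using h(2) by (simp add: f_def[abs_def] partial_deriv_def field_simps)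
    ultimately show ?thesis using h(2) by (simp add: norm_divide power2_eq_square)
  qed
  have ev: "\<forall>\<^sub>F h in at 0. norm (h :: complex) < (s' - s) / 2 \<and> h \<noteq> 0"
    unfolding eventually_at using s' by (intro exI[of _ "(s' - s) / 2"]) (auto simp: dist_norm)
  have lim: "((\<lambda>h. C * norm (h :: complex)) \<longlongrightarrow> 0) (at 0)"
    by (auto intro!: tendsto_eq_intros)
  show ?thesis
  proof (rule uniform_limitI)
    fix e :: real assume "e > 0"
    then have "\<forall>\<^sub>F h in at 0. C * norm (h :: complex) < e" using order_tendstoD(2)[OF lim] by blast
    with ev show "\<forall>\<^sub>F h in at 0. \<forall>z\<in>polydisc m s.
        dist ((G (z(k := z k + h)) - G z) / h) (partial_deriv k G z) < e"
      by eventually_elim (use bound in \<open>fastforce simp: dist_norm\<close>)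
  qed
qed

lemma difference_quotient_holomorphic:
  assumes G: "sep_hol m r G" and kj: "k < m" "j < m" "j \<noteq> k" and z: "z \<in> polydisc m s" and s: "s < r"
    and h: "norm h < r - s"
  shows "(\<lambda>t. (G ((z(j := t))(k := (z(j := t)) k + h)) - G (z(j := t))) / h) holomorphic_on ball 0 s"
proof -
  have zr: "z \<in> polydisc m r" using z polydisc_mono[of s r m] s by auto
  have "norm (z k + h) < r"
    using norm_triangle_ineq[of "z k" h] polydisc_norm[OF z kj(1)] h by simp
  then have z2: "z(k := z k + h) \<in> polydisc m r" by (intro polydisc_upd zr kj)
  have sub: "ball 0 s \<subseteq> ball (0 :: complex) r" using s by auto
  have eq: "(z(j := t))(k := (z(j := t)) k + h) = (z(k := z k + h))(j := t)" for t
    using kj by (auto simp: fun_eq_iff)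
  show ?thesis unfolding eq
  proof (cases "h = 0")
    case False
    then show "(\<lambda>t. (G ((z(k := z k + h))(j := t)) - G (z(j := t))) / h) holomorphic_on ball 0 s"
      by (intro holomorphic_intros holomorphic_on_subset[OF sep_holD[OF G z2 kj(2)] sub]
         holomorphic_on_subset[OF sep_holD[OF G zr kj(2)] sub])
  qed auto
qed

lemma uniform_limit_difference_quotient_slice:
  assumes G: "sep_hol m r G" and kj: "k < m" "j < m" and z: "z \<in> polydisc m s" and s: "s < r"
  shows "uniform_limit (ball 0 s) (\<lambda>h t. (G ((z(j := t))(k := (z(j := t)) k + h)) - G (z(j := t))) / h)
    (\<lambda>t. partial_deriv k G (z(j := t))) (at 0)"
  unfolding uniform_limit_iff
proof (intro allI impI)
  fix e :: real assume "e > 0"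
  then have "\<forall>\<^sub>F h in at 0. \<forall>z\<in>polydisc m s.
        dist ((G (z(k := z k + h)) - G z) / h) (partial_deriv k G z) < e"
    using uniform_limit_difference_quotient[OF G kj(1) s] unfolding uniform_limit_iff by blast
  then show "\<forall>\<^sub>F h in at 0. \<forall>t\<in>ball 0 s. dist ((G ((z(j := t))(k := (z(j := t)) k + h)) - G (z(j := t))) / h)
       (partial_deriv k G (z(j := t))) < e"
  proof eventually_elim
    case (elim h)
    have "z(j := t) \<in> polydisc m s" if "t \<in> ball 0 s" for t
      using that by (intro polydisc_upd z kj) auto
    then show ?case using elim by blast
  qed
qed

lemma partial_deriv_slice_holomorphic:
  assumes G: "sep_hol m r G" and kj: "k < m" "j < m" "j \<noteq> k" and z: "z \<in> polydisc m s" and s: "0 < s" "s < r"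
  shows "(\<lambda>t. partial_deriv k G (z(j := t))) holomorphic_on ball 0 s"
    and "sep_hol m r (partial_deriv j G) \<Longrightarrow>
      deriv (\<lambda>t. partial_deriv k G (z(j := t))) (z j) = partial_deriv k (partial_deriv j G) z"
proof -
  define H where "H h t = (G ((z(j := t))(k := (z(j := t)) k + h)) - G (z(j := t))) / h" for h t
  have lim: "uniform_limit (ball 0 s) H (\<lambda>t. partial_deriv k G (z(j := t))) (at 0)"
    unfolding H_def by (rule uniform_limit_difference_quotient_slice[OF G kj(1,2) z s(2)])
  have "\<forall>\<^sub>F h in at 0. norm (h :: complex) < r - s"
    unfolding eventually_at using s by (intro exI[of _ "r - s"]) (auto simp: dist_norm)
  then have hol: "\<forall>\<^sub>F h in at 0. H h holomorphic_on ball 0 s"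
    by eventually_elim (unfold H_def, rule difference_quotient_holomorphic[OF G kj z s(2)])
  show "(\<lambda>t. partial_deriv k G (z(j := t))) holomorphic_on ball 0 s"
  proof (subst holomorphic_on_open, simp, intro ballI)
    fix w assume w: "w \<in> ball (0 :: complex) s"
    then obtain s2 where s2: "norm w < s2" "s2 < s" using dense by auto
    have sub: "cball 0 s2 \<subseteq> ball (0 :: complex) s" using s2 by auto
    have "(\<lambda>t. partial_deriv k G (z(j := t))) holomorphic_on ball 0 s2"
    proof (rule holomorphic_uniform_limit)
      show "\<forall>\<^sub>F h in at 0. continuous_on (cball 0 s2) (H h) \<and> H h holomorphic_on ball 0 s2"
        using hol
      proof eventually_elim
        case (elim h)
        then show ?case using sub ball_subset_cball[of 0 s2]
          by (meson holomorphic_on_imp_continuous_on holomorphic_on_subset subset_trans)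
      qed
      show "uniform_limit (cball 0 s2) H (\<lambda>t. partial_deriv k G (z(j := t))) (at 0)"
        by (rule uniform_limit_on_subset[OF lim sub])
    qed auto
    then show "\<exists>f'. ((\<lambda>t. partial_deriv k G (z(j := t))) has_field_derivative f') (at w)"
      using s2 by (subst (asm) holomorphic_on_open) auto
  qed
  assume j: "sep_hol m r (partial_deriv j G)"
  have zr: "z \<in> polydisc m r" using z polydisc_mono[of s r m] s by auto
  have lim1: "((\<lambda>h. deriv (H h) (z j)) \<longlongrightarrow> deriv (\<lambda>t. partial_deriv k G (z(j := t))) (z j)) (at 0)"
    by (rule deriv_complex_uniform_limit[OF lim hol]) (use polydisc_norm[OF z kj(2)] in auto)
  have "\<forall>\<^sub>F h in at 0. norm (h :: complex) < r - s \<and> h \<noteq> 0"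
    unfolding eventually_at using s by (intro exI[of _ "r - s"]) (auto simp: dist_norm)
  then have "\<forall>\<^sub>F h in at 0. (partial_deriv j G (z(k := z k + h)) - partial_deriv j G z) / h = deriv (H h) (z j)"
  proof eventually_elim
    case (elim h)
    have "norm (z k + h) < r"
      using norm_triangle_ineq[of "z k" h] polydisc_norm[OF z kj(1)] elim by simp
    then have z2: "z(k := z k + h) \<in> polydisc m r" by (intro polydisc_upd zr kj)
    have zj: "z j \<in> ball 0 r" using polydisc_norm[OF zr kj(2)] by simp
    have eq: "H h = (\<lambda>t. (G ((z(k := z k + h))(j := t)) - G (z(j := t))) / h)"
      using kj by (auto simp: H_def fun_eq_iff fun_upd_twist)
    have d: "(\<lambda>t. G ((z(k := z k + h))(j := t))) field_differentiable at (z j)"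
      "(\<lambda>t. G (z(j := t))) field_differentiable at (z j)"
      using sep_holD[OF G z2 kj(2)] sep_holD[OF G zr kj(2)] zj
      by (auto intro: holomorphic_on_imp_differentiable_at)
    have "deriv (H h) (z j) = (deriv (\<lambda>t. G ((z(k := z k + h))(j := t))) (z j) - deriv (\<lambda>t. G (z(j := t))) (z j)) / h"
      unfolding eq using d by (simp add: deriv_cdivide_right field_differentiable_diff)
    then show ?case using kj by (simp add: partial_deriv_def)
  qed
  then have "((\<lambda>h. deriv (H h) (z j)) \<longlongrightarrow> partial_deriv k (partial_deriv j G) z) (at 0)"
    by (rule Lim_transform_eventually[rotated])
      (rule tendsto_uniform_limitI[OF uniform_limit_difference_quotient[OF j kj(1) s(2)] z])
  with lim1 show "deriv (\<lambda>t. partial_deriv k G (z(j := t))) (z j) = partial_deriv k (partial_deriv j G) z"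
    by (rule tendsto_unique[OF at_neq_bot])
qed

lemma sep_hol_partial_deriv:
  assumes G: "sep_hol m r G" and k: "k < m"
  shows "sep_hol m r (partial_deriv k G)"
  unfolding sep_hol_def
proof (intro conjI ballI allI impI)
  fix s assume s: "s < r"
  obtain s' where s': "s < s'" "s' < r" using s dense by blast
  obtain B where B: "\<And>z. z \<in> polydisc m s' \<Longrightarrow> norm (G z) \<le> B"
    using G s'(2) unfolding sep_hol_def by blast
  have "norm (partial_deriv k G z) \<le> B / ((s' - s) / 2)" if z: "z \<in> polydisc m s" for z
  proof -
    have z': "z \<in> polydisc m s'" "z \<in> polydisc m r"
      using z polydisc_mono[of s s' m] polydisc_mono[of s r m] s' s by auto
    let ?f = "\<lambda>t. G (z(k := t))"
    have cb: "norm y < s'" if "norm (z k - y) \<le> (s' - s) / 2" for y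
      using norm_triangle_sub[of y "z k"] that s' polydisc_norm[OF z k]
      by (simp add: norm_minus_commute field_simps)
    have c: "cball (z k) ((s' - s) / 2) \<subseteq> ball 0 r"
    proof
      fix y assume "y \<in> cball (z k) ((s' - s) / 2)"
      then show "y \<in> ball 0 r" using cb[of y] s'(2) by (auto simp: dist_norm)
    qed
    note hol = sep_holD[OF G z'(2) k]
    have "norm ((deriv ^^ 1) ?f (z k)) \<le> fact 1 * B / ((s' - s) / 2) ^ 1"
    proof (rule Cauchy_inequality)
      show "?f holomorphic_on ball (z k) ((s' - s) / 2)"
        by (rule holomorphic_on_subset[OF hol]) (use c ball_subset_cball in blast)
      show "continuous_on (cball (z k) ((s' - s) / 2)) ?f"
        using c holomorphic_on_imp_continuous_on[OF hol] continuous_on_subset by blast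
      show "norm (?f y) \<le> B" if "norm (z k - y) = (s' - s) / 2" for y
        by (intro B polydisc_upd z' k cb) (use that in auto)
    qed (use s' in auto)
    then show ?thesis by (simp add: partial_deriv_def)
  qed
  then show "\<exists>B. \<forall>z\<in>polydisc m s. norm (partial_deriv k G z) \<le> B" by blast
next
  fix z j assume z: "z \<in> polydisc m r" and j: "j < m"
  show "(\<lambda>t. partial_deriv k G (z(j := t))) holomorphic_on ball 0 r"
  proof (cases "j = k")
    case True
    \<comment> \<open>Here the slice of the partial derivative is the derivative of a single slice.\<close>
    then have "(\<lambda>t. partial_deriv k G (z(j := t))) = deriv (\<lambda>t. G (z(k := t)))"
      by (auto simp: partial_deriv_def)
    then show ?thesis using holomorphic_deriv[OF sep_holD[OF G z k]] by simp
  next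
    case False
    show ?thesis
    proof (subst holomorphic_on_open, simp, intro ballI)
      fix w assume w: "w \<in> ball (0 :: complex) r"
      then have r: "r > 0" using norm_ge_zero[of w] unfolding mem_ball_0 by linarith
      obtain s1 where s1: "0 < s1" "s1 < r" "z \<in> polydisc m s1" using polydisc_shrink[OF z r] .
      obtain s2 where s2: "norm w < s2" "s2 < r" using w dense by auto
      define s where "s = max s1 s2"
      have s: "0 < s" "s < r" "z \<in> polydisc m s" "w \<in> ball 0 s"
        using s1 s2 polydisc_mono[of s1 s m] by (auto simp: s_def less_max_iff_disj)
      have "(\<lambda>t. partial_deriv k G (z(j := t))) holomorphic_on ball 0 s"
        by (rule partial_deriv_slice_holomorphic(1)[OF G k j False s(3,1,2)])
      then show "\<exists>f'. ((\<lambda>t. partial_deriv k G (z(j := t))) has_field_derivative f') (at w)"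
        using s(4) by (subst (asm) holomorphic_on_open) auto
    qed
  qed
qed

lemma partial_deriv_commute:
  assumes G: "sep_hol m r G" and kj: "k < m" "j < m" and z: "z \<in> polydisc m r" and r: "r > 0"
  shows "partial_deriv j (partial_deriv k G) z = partial_deriv k (partial_deriv j G) z"
proof (cases "j = k")
  case False
  obtain s where s: "0 < s" "s < r" "z \<in> polydisc m s" using polydisc_shrink[OF z r] .
  show ?thesis
    using partial_deriv_slice_holomorphic(2)[OF G kj False s(3,1,2) sep_hol_partial_deriv[OF G kj(2)]]
    by (simp add: partial_deriv_def)
qed auto

lemma sep_hol_partial_deriv_power:
  "sep_hol m r G \<Longrightarrow> k < m \<Longrightarrow> sep_hol m r ((partial_deriv k ^^ a) G)"
  by (induction a) (auto intro: sep_hol_partial_deriv)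

lemma sep_hol_mixed_deriv:
  "sep_hol m r G \<Longrightarrow> j \<le> m \<Longrightarrow> sep_hol m r (mixed_deriv j \<alpha> G)"
  by (induction j) (auto intro: sep_hol_partial_deriv_power)

lemma partial_deriv_cong:
  assumes "\<And>z. z \<in> polydisc m r \<Longrightarrow> G z = H z" "k < m" "z \<in> polydisc m r"
  shows "partial_deriv k G z = partial_deriv k H z"
  unfolding partial_deriv_def
proof (rule deriv_cong_ev)
  have "\<forall>\<^sub>F t in nhds (z k). t \<in> ball 0 r"
    using polydisc_norm[OF assms(3,2)] by (intro eventually_nhds_in_open) auto
  then show "\<forall>\<^sub>F t in nhds (z k). G (z(k := t)) = H (z(k := t))"
    by eventually_elim (use assms in \<open>auto intro!: polydisc_upd\<close>)
qed simp

lemma partial_deriv_power_cong: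
  assumes "\<And>z. z \<in> polydisc m r \<Longrightarrow> G z = H z" "k < m" "z \<in> polydisc m r"
  shows "(partial_deriv k ^^ a) G z = (partial_deriv k ^^ a) H z"
  using assms(3) by (induction a arbitrary: z) (use assms in \<open>auto intro: partial_deriv_cong\<close>)

lemma partial_deriv_power_commute:
  assumes G: "sep_hol m r G" and kj: "k < m" "j < m" and z: "z \<in> polydisc m r" and r: "r > 0"
  shows "(partial_deriv j ^^ a) (partial_deriv k G) z = partial_deriv k ((partial_deriv j ^^ a) G) z"
  using z
proof (induction a arbitrary: z)
  case (Suc a)
  have "(partial_deriv j ^^ Suc a) (partial_deriv k G) z =
      partial_deriv j (partial_deriv k ((partial_deriv j ^^ a) G)) z"
    using Suc kj by (auto intro: partial_deriv_cong)
  also have "\<dots> = partial_deriv k (partial_deriv j ((partial_deriv j ^^ a) G)) z"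
    by (rule partial_deriv_commute[OF sep_hol_partial_deriv_power[OF G kj(2)] kj Suc.prems r])
  finally show ?case by simp
qed simp

text \<open>
  Differentiation with respect to the \<open>k\<close>-th variable commutes with \<open>mixed_deriv j \<alpha>\<close>; once \<open>k < j\<close>
  it merely raises the \<open>k\<close>-th order of differentiation by one.
\<close>

lemma mixed_deriv_partial_deriv:
  assumes G: "sep_hol m r G" and j: "j \<le> m" and k: "k < m" and z: "z \<in> polydisc m r" and r: "r > 0"
  shows "mixed_deriv j \<alpha> (partial_deriv k G) z =
    (if k < j then mixed_deriv j (\<alpha>(k := Suc (\<alpha> k))) G z else partial_deriv k (mixed_deriv j \<alpha> G) z)"
  using j z
proof (induction j arbitrary: z)
  case (Suc j)
  have cg: "mixed_deriv i (\<alpha>(q := b)) G = mixed_deriv i \<alpha> G" if "i \<le> q" for b i q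
    using that by (induction i) auto
  have hol: "sep_hol m r (mixed_deriv j \<alpha> G)" using Suc.prems G by (intro sep_hol_mixed_deriv) auto
  have IH: "mixed_deriv j \<alpha> (partial_deriv k G) z =
      (if k < j then mixed_deriv j (\<alpha>(k := Suc (\<alpha> k))) G z else partial_deriv k (mixed_deriv j \<alpha> G) z)"
    if "z \<in> polydisc m r" for z using Suc that by auto
  have "mixed_deriv (Suc j) \<alpha> (partial_deriv k G) z = (partial_deriv j ^^ \<alpha> j)
      (\<lambda>z. if k < j then mixed_deriv j (\<alpha>(k := Suc (\<alpha> k))) G z else partial_deriv k (mixed_deriv j \<alpha> G) z) z"
    using Suc.prems IH by (auto intro!: partial_deriv_power_cong[of m r])
  moreover have "(partial_deriv j ^^ \<alpha> j) (partial_deriv k (mixed_deriv j \<alpha> G)) z =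
      partial_deriv k ((partial_deriv j ^^ \<alpha> j) (mixed_deriv j \<alpha> G)) z"
    using Suc.prems by (intro partial_deriv_power_commute[OF hol k _ _ r]) auto
  ultimately show ?case by (cases k j rule: linorder_cases) (auto simp: cg simp flip: funpow_Suc_right)
qed auto

lemma taylor_coeff_partial_deriv:
  assumes G: "sep_hol m r G" and k: "k < m" and r: "r > 0"
  shows "taylor_coeff m (partial_deriv k G) \<alpha> = of_nat (Suc (\<alpha> k)) * taylor_coeff m G (\<alpha>(k := Suc (\<alpha> k)))"
proof -
  have "(\<Prod>i<m. fact ((\<alpha>(k := Suc (\<alpha> k))) i)) = fact (Suc (\<alpha> k)) * (\<Prod>i\<in>{..<m} - {k}. fact (\<alpha> i) :: complex)"
    using k by (subst prod.remove[of _ k]) auto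
  also have "\<dots> = of_nat (Suc (\<alpha> k)) * (\<Prod>i<m. fact (\<alpha> i))"
    using k by (subst (2) prod.remove[of _ k]) (auto simp: algebra_simps)
  finally have "(\<Prod>i<m. fact ((\<alpha>(k := Suc (\<alpha> k))) i)) = of_nat (Suc (\<alpha> k)) * (\<Prod>i<m. fact (\<alpha> i) :: complex)" .
  moreover have "(\<lambda>_. 0) \<in> polydisc m r" using r by (auto simp: polydisc_def coord_space_def)
  ultimately show ?thesis
    using mixed_deriv_partial_deriv[OF G order.refl k _ r, of "\<lambda>_. 0" \<alpha>] k
    by (simp add: taylor_coeff_def del: of_nat_Suc)
qed

text \<open>
  Cauchy's estimates, obtained by applying the estimate in one variable successively to each
  coordinate.
\<close>

lemma taylor_coeff_bound:
  assumes G: "sep_hol m r G" and r: "r > 0"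
  shows "\<exists>M\<ge>0. \<exists>\<rho>>0. \<forall>\<alpha>. norm (taylor_coeff m G \<alpha>) \<le> M / (\<Prod>k<m. \<rho> ^ \<alpha> k)"
proof -
  define \<rho> where "\<rho> = r / 4"
  obtain B where B: "\<And>z. z \<in> polydisc m (r / 2) \<Longrightarrow> norm (G z) \<le> B"
    using G r unfolding sep_hol_def by (metis field_sum_of_halves less_add_same_cancel1 half_gt_zero)
  have *: "norm (mixed_deriv j \<alpha> G z) \<le> B * (\<Prod>k<j. fact (\<alpha> k) / \<rho> ^ \<alpha> k)"
    if "j \<le> m" "z \<in> polydisc m (r / 2)" "\<And>k. k < j \<Longrightarrow> z k = 0" for j \<alpha> z
    using that
  proof (induction j arbitrary: z)
    case (Suc j)
    let ?f = "\<lambda>t. mixed_deriv j \<alpha> G (z(j := t))"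
    have zr: "z \<in> polydisc m r" using Suc.prems(2) polydisc_mono[of "r/2" r m] r by auto
    have hol: "?f holomorphic_on ball 0 r"
      by (rule sep_holD[OF sep_hol_mixed_deriv[OF G] zr]) (use Suc.prems in auto)
    have c: "cball 0 \<rho> \<subseteq> ball (0 :: complex) r" using r by (auto simp: \<rho>_def)
    have "norm ((deriv ^^ \<alpha> j) ?f 0) \<le> fact (\<alpha> j) * (B * (\<Prod>k<j. fact (\<alpha> k) / \<rho> ^ \<alpha> k)) / \<rho> ^ \<alpha> j"
    proof (rule Cauchy_inequality)
      show "?f holomorphic_on ball 0 \<rho>"
        by (rule holomorphic_on_subset[OF hol]) (use c ball_subset_cball in blast)
      show "continuous_on (cball 0 \<rho>) ?f"
        using c holomorphic_on_imp_continuous_on[OF hol] continuous_on_subset by blast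
      fix t :: complex assume "norm (0 - t) = \<rho>"
      then have "z(j := t) \<in> polydisc m (r / 2)"
        using Suc.prems r by (intro polydisc_upd) (auto simp: \<rho>_def)
      then show "norm (?f t) \<le> B * (\<Prod>k<j. fact (\<alpha> k) / \<rho> ^ \<alpha> k)"
        using Suc.prems by (intro Suc.IH) (auto simp del: fun_upd_apply, simp)
    qed (use r in \<open>auto simp: \<rho>_def\<close>)
    then show ?case using Suc.prems(3)[of j] by (simp add: partial_deriv_power field_simps)
  qed (use B in auto)
  have z: "(\<lambda>_. 0) \<in> polydisc m (r / 2)" using r by (auto simp: polydisc_def coord_space_def)
  have "norm (taylor_coeff m G \<alpha>) \<le> B / (\<Prod>k<m. \<rho> ^ \<alpha> k)" for \<alpha>
  proof -
    have "norm (taylor_coeff m G \<alpha>) = norm (mixed_deriv m \<alpha> G (\<lambda>_. 0)) / (\<Prod>k<m. fact (\<alpha> k))"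
      by (simp add: taylor_coeff_def norm_divide flip: prod_norm)
    also have "\<dots> \<le> B * (\<Prod>k<m. fact (\<alpha> k) / \<rho> ^ \<alpha> k) / (\<Prod>k<m. fact (\<alpha> k))"
      by (intro divide_right_mono * z prod_nonneg) auto
    also have "\<dots> = B / (\<Prod>k<m. \<rho> ^ \<alpha> k)"
      by (simp add: prod_dividef)
    finally show ?thesis .
  qed
  moreover have "B \<ge> 0" using B[OF z] norm_ge_zero order_trans by blast
  ultimately show ?thesis using r by (intro exI[of _ B] conjI exI[of _ \<rho>]) (auto simp: \<rho>_def)
qed

lemma complex_differentiable_slice:
  assumes "complex_differentiable m F z" "z \<in> coord_space m" "k < m"
  shows "(\<lambda>t. F (z(k := t))) field_differentiable at (z k)"
proof -
  obtain D where D: "((\<lambda>w. (F w - F z - (\<Sum>k<m. D k * (w k - z k))) / of_real (\<Sum>k<m. norm (w k - z k))) \<longlongrightarrow> 0)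
       (at z within coord_space m)" using assms(1) unfolding complex_differentiable_def by blast
  have "continuous_on UNIV (\<lambda>t. z(k := t))"
  proof (rule continuous_on_coordinatewise_then_product)
    show "continuous_on UNIV (\<lambda>t. (z(k := t)) i)" for i by (cases "i = k") auto
  qed
  then have "((\<lambda>t. z(k := t)) \<longlongrightarrow> z(k := z k)) (at (z k))"
    using continuous_on_def by blast
  then have "filterlim (\<lambda>t. z(k := t)) (at z within coord_space m) (at (z k))"
    unfolding filterlim_at using assms(2,3)
    by (auto simp: coord_space_def eventually_at_filter fun_eq_iff)
  from filterlim_compose[OF D this]
  have "((\<lambda>t. (F (z(k := t)) - F z - (\<Sum>i<m. D i * ((z(k := t)) i - z i))) /
      of_real (\<Sum>i<m. norm ((z(k := t)) i - z i))) \<longlongrightarrow> 0) (at (z k))" .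
  moreover have "(\<Sum>i<m. D i * ((z(k := t)) i - z i)) = D k * (t - z k)" for t
    using assms(3) by (subst sum.remove[of _ k]) (auto intro!: sum.neutral)
  moreover have "(\<Sum>i<m. norm ((z(k := t)) i - z i)) = norm (t - z k)" for t
    using assms(3) by (subst sum.remove[of _ k]) (auto intro!: sum.neutral)
  ultimately have "((\<lambda>t. (F (z(k := t)) - F z - D k * (t - z k)) / of_real (norm (t - z k))) \<longlongrightarrow> 0) (at (z k))"
    by (simp only: fun_upd_same)
  then have "((\<lambda>t. F (z(k := t))) has_derivative (*) (D k)) (at (z k))"
    unfolding has_derivative_within
    by (simp add: bounded_linear_mult_right scaleR_conv_of_real divide_inverse mult.commute diff_diff_eq)
  then show ?thesis unfolding field_differentiable_def has_field_derivative_def by blast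
qed

text \<open>
  Boundedness near \<open>0\<close> comes from the total derivative at \<open>0\<close>. A neighbourhood of \<open>0\<close> in the product
  topology of \<open>nat \<Rightarrow> complex\<close> contains a polydisc of \<open>coord_space m\<close>, because the coordinates beyond
  \<open>m\<close> vanish there.
\<close>

lemma holomorphic_near_0_imp_sep_hol:
  assumes "holomorphic_near_0 m F"
  shows "\<exists>r>0. sep_hol m r F"
proof -
  obtain r where r: "r > 0" "\<And>z. z \<in> coord_space m \<Longrightarrow> (\<forall>k<m. norm (z k) < r) \<Longrightarrow> complex_differentiable m F z"
    using assms unfolding holomorphic_near_0_def by blast
  have z0: "(\<lambda>_. 0) \<in> coord_space m" by (auto simp: coord_space_def)
  obtain D where D: "((\<lambda>w. (F w - F (\<lambda>_. 0) - (\<Sum>k<m. D k * (w k - 0))) / of_real (\<Sum>k<m. norm (w k - 0))) \<longlongrightarrow> 0)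
       (at (\<lambda>_. 0) within coord_space m)"
    using r(2)[OF z0] r(1) unfolding complex_differentiable_def by auto
  have "\<forall>\<^sub>F w in at (\<lambda>_. 0) within coord_space m.
      norm ((F w - F (\<lambda>_. 0) - (\<Sum>k<m. D k * (w k - 0))) / of_real (\<Sum>k<m. norm (w k - 0))) < 1"
    using tendstoD[OF D, of 1] by (simp add: dist_norm)
  then obtain S where S: "open S" "(\<lambda>_. 0) \<in> S" "\<And>w. w \<in> S \<Longrightarrow> w \<noteq> (\<lambda>_. 0) \<Longrightarrow> w \<in> coord_space m \<Longrightarrow>
      norm ((F w - F (\<lambda>_. 0) - (\<Sum>k<m. D k * (w k - 0))) / of_real (\<Sum>k<m. norm (w k - 0))) < 1"
    unfolding eventually_at_topological by blast
  obtain X where X: "(\<lambda>_. 0) \<in> Pi\<^sub>E UNIV X" "\<And>i. open (X i)" "Pi\<^sub>E UNIV X \<subseteq> S"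
    using product_topology_open_contains_basis[OF S(1)[unfolded open_fun_def] S(2)] by auto
  have "\<forall>i\<in>{..<m}. \<forall>\<^sub>F e in at_right 0. ball 0 e \<subseteq> X i"
  proof
    fix i
    have "0 \<in> X i" using X(1) by (auto simp: PiE_def Pi_def)
    then obtain e where "e > 0" "ball 0 e \<subseteq> X i" using X(2) openE by blast
    then show "\<forall>\<^sub>F e in at_right 0. ball 0 e \<subseteq> X i"
      unfolding eventually_at_right_field by (intro exI[of _ e]) force
  qed
  then have "\<forall>\<^sub>F e in at_right 0. \<forall>i\<in>{..<m}. ball 0 e \<subseteq> X i" by (intro eventually_ball_finite) auto
  moreover have "\<forall>\<^sub>F e in at_right 0. (0 :: real) < e" by (simp add: eventually_at_right_less)
  moreover have "\<forall>\<^sub>F e in at_right 0. e < min r 1" using r(1)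
    unfolding eventually_at_right_field by (intro exI[of _ "min r 1"]) auto
  ultimately have "\<forall>\<^sub>F e in at_right 0. (0 :: real) < e \<and> e < min r 1 \<and> (\<forall>i\<in>{..<m}. ball 0 e \<subseteq> X i)"
    by eventually_elim auto
  then have "\<exists>e. (0 :: real) < e \<and> e < min r 1 \<and> (\<forall>i\<in>{..<m}. ball 0 e \<subseteq> X i)"
    by (rule eventually_happens'[OF trivial_limit_at_right_real])
  then obtain e where e: "(0 :: real) < e" "e < min r 1" "\<And>i. i < m \<Longrightarrow> ball 0 e \<subseteq> X i"
    by blast
  define B where "B = norm (F (\<lambda>_. 0)) + (\<Sum>k<m. norm (D k)) + of_nat m"
  have B: "norm (F w) \<le> B" if w: "w \<in> polydisc m e" for w
  proof (cases "w = (\<lambda>_. 0)")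
    case True
    then show ?thesis by (simp add: B_def sum_nonneg)
  next
    case False
    have wc: "w \<in> coord_space m" using w by (auto simp: polydisc_def)
    have "w i \<in> X i" for i
    proof (cases "i < m")
      case True
      then show ?thesis using e(3)[OF True] polydisc_norm[OF w True] by auto
    next
      case False
      then have "w i = 0" using wc by (auto simp: coord_space_def)
      then show ?thesis using X(1) by (auto simp: PiE_def Pi_def)
    qed
    then have "w \<in> S" using X(3) by (auto simp: PiE_def Pi_def)
    define s where "s = (\<Sum>k<m. norm (w k))"
    define q where "q = F w - F (\<lambda>_. 0) - (\<Sum>k<m. D k * w k)"
    have w1: "norm (w k) \<le> 1" if "k < m" for k using polydisc_norm[OF w that] e(2) by auto
    have s: "s \<ge> 0" "s \<le> of_nat m"
      using sum_mono[of "{..<m}" "\<lambda>k. norm (w k)" "\<lambda>_. 1"] w1 by (auto simp: s_def sum_nonneg)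
    obtain i where i: "w i \<noteq> 0" using False by auto
    then have "i < m" using wc by (auto simp: coord_space_def not_le[symmetric])
    then have "s > 0" using i unfolding s_def by (intro sum_pos2[of _ i]) auto
    moreover have "norm (q / of_real s) < 1"
      using S(3)[OF \<open>w \<in> S\<close> False wc] by (simp add: q_def s_def)
    ultimately have "norm q \<le> s" by (simp add: norm_divide)
    have "norm (\<Sum>k<m. D k * w k) \<le> (\<Sum>k<m. norm (D k))"
      using w1 by (intro sum_norm_le) (auto simp: norm_mult mult_left_le)
    moreover have "F w = q + F (\<lambda>_. 0) + (\<Sum>k<m. D k * w k)" by (simp add: q_def)
    then have "norm (F w) \<le> norm q + norm (F (\<lambda>_. 0)) + norm (\<Sum>k<m. D k * w k)"
      by (metis norm_triangle_le norm_triangle_ineq add_right_mono)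
    ultimately show ?thesis using \<open>norm q \<le> s\<close> s by (simp add: B_def)
  qed
  have "sep_hol m e F"
    unfolding sep_hol_def
  proof (intro conjI ballI allI impI)
    fix z k assume z: "z \<in> polydisc m e" and k: "k < m"
    have "(\<lambda>t. F (z(k := t))) field_differentiable at t" if t: "t \<in> ball 0 e" for t
    proof -
      let ?w = "z(k := t)"
      have w: "?w \<in> polydisc m r"
        using polydisc_upd[OF z k, of t] t polydisc_mono[of e r m] e by auto
      then have "?w \<in> coord_space m" "complex_differentiable m F ?w"
        using r(2)[of ?w] unfolding polydisc_def by blast+
      from complex_differentiable_slice[OF this(2,1) k] show ?thesis by simp
    qed
    then show "(\<lambda>t. F (z(k := t))) holomorphic_on ball 0 e"
      by (auto simp: holomorphic_on_def intro: field_differentiable_at_within)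
  next
    fix s assume "s < e"
    then show "\<exists>B. \<forall>z\<in>polydisc m s. norm (F z) \<le> B" using B polydisc_mono[of s e m] by fastforce
  qed
  then show ?thesis using e(1) by blast
qed

section \<open>Logarithms and convergence in sectors\<close>

text \<open>
  After rotation by the bisecting direction a sector of opening less than \<open>2\<pi>\<close> avoids the branch
  cut of \<open>Arg\<close>.
\<close>

lemma sector_eq:
  assumes "a < b" "b - a < 2 * pi"
  shows "sector a b = {z. z * cis (- ((a + b) / 2)) \<in> - \<real>\<^sub>\<le>\<^sub>0 \<and>
    \<bar>Arg (z * cis (- ((a + b) / 2)))\<bar> < (b - a) / 2}"
proof (intro set_eqI iffI)
  fix z assume "z \<in> sector a b"
  then obtain \<rho> \<theta> where z: "z = rcis \<rho> \<theta>" "\<rho> > 0" "a < \<theta>" "\<theta> < b" by (auto simp: sector_def)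
  define t where "t = \<theta> - (a + b) / 2"
  have t: "\<bar>t\<bar> < (b - a) / 2" using z by (auto simp: t_def abs_less_iff field_simps)
  have eq: "z * cis (- ((a + b) / 2)) = rcis \<rho> t"
    by (simp add: z rcis_def t_def cis_mult mult.assoc)
  have "Arg (rcis \<rho> t) = t" using t assms z(2) by (intro Arg_unique') auto
  moreover from this have "rcis \<rho> t \<notin> \<real>\<^sub>\<le>\<^sub>0"
  proof (intro notI)
    assume "rcis \<rho> t \<in> \<real>\<^sub>\<le>\<^sub>0"
    moreover have "rcis \<rho> t \<noteq> 0" using z(2) by simp
    ultimately have "Im (rcis \<rho> t) = 0 \<and> Re (rcis \<rho> t) < 0"
      unfolding complex_nonpos_Reals_iff by (metis complex_eqI order_le_less zero_complex.sel)
    then have "Arg (rcis \<rho> t) = pi" by (simp add: Arg_eq_pi)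
    then show False using \<open>Arg (rcis \<rho> t) = t\<close> t assms by simp
  qed
  ultimately show "z \<in> {z. z * cis (- ((a + b) / 2)) \<in> - \<real>\<^sub>\<le>\<^sub>0 \<and> \<bar>Arg (z * cis (- ((a + b) / 2)))\<bar> < (b - a) / 2}"
    using t by (simp add: eq)
next
  fix z assume z: "z \<in> {z. z * cis (- ((a + b) / 2)) \<in> - \<real>\<^sub>\<le>\<^sub>0 \<and> \<bar>Arg (z * cis (- ((a + b) / 2)))\<bar> < (b - a) / 2}"
  define w where "w = z * cis (- ((a + b) / 2))"
  have w: "w \<notin> \<real>\<^sub>\<le>\<^sub>0" "\<bar>Arg w\<bar> < (b - a) / 2" using z by (auto simp: w_def)
  have "z = w * cis ((a + b) / 2)" by (simp add: w_def mult.assoc cis_mult)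
  also have "w = rcis (norm w) (Arg w)" by (simp add: rcis_cmod_Arg)
  also have "\<dots> * cis ((a + b) / 2) = rcis (norm w) (Arg w + (a + b) / 2)"
    by (simp add: rcis_def cis_mult mult.assoc)
  finally have "z = rcis (norm w) (Arg w + (a + b) / 2)" .
  moreover have "norm w > 0" using w(1) by auto
  moreover have "a < Arg w + (a + b) / 2" "Arg w + (a + b) / 2 < b"
    using w(2) by (auto simp: abs_less_iff field_simps)
  ultimately show "z \<in> sector a b" unfolding sector_def by blast
qed

lemma open_sector:
  assumes "a < b" "b - a < 2 * pi"
  shows "open (sector a b)"
proof -
  let ?f = "\<lambda>z. z * cis (- ((a + b) / 2))"
  have 1: "open (?f -` (- \<real>\<^sub>\<le>\<^sub>0))"
    by (intro continuous_open_vimage continuous_intros) (auto simp: open_Compl)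
  have "continuous_on (?f -` (- \<real>\<^sub>\<le>\<^sub>0)) (\<lambda>z. \<bar>Arg (?f z)\<bar>)"
    by (intro continuous_intros continuous_on_compose2[OF continuous_on_Arg]) auto
  then have "open ((\<lambda>z. \<bar>Arg (?f z)\<bar>) -` {..<(b - a) / 2} \<inter> ?f -` (- \<real>\<^sub>\<le>\<^sub>0))"
    using 1 continuous_on_open_vimage open_lessThan by blast
  moreover have "(\<lambda>z. \<bar>Arg (?f z)\<bar>) -` {..<(b - a) / 2} \<inter> ?f -` (- \<real>\<^sub>\<le>\<^sub>0) = sector a b"
    unfolding sector_eq[OF assms] by auto
  ultimately show ?thesis by simp
qed

lemma log_branch_holomorphic:
  assumes "log_branch S L" "open S"
  shows "L holomorphic_on S"
proof -
  have "(L has_field_derivative inverse (exp (L x))) (at x)" if "x \<in> S" for x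
  proof (rule has_field_derivative_inverse_basic)
    show "(exp has_field_derivative exp (L x)) (at (L x))" by (rule DERIV_exp)
    show "continuous (at x) L"
      using assms that continuous_on_eq_continuous_at by (auto simp: log_branch_def)
  qed (use assms that in \<open>auto simp: log_branch_def\<close>)
  then show ?thesis
    by (meson assms(2) holomorphic_on_open)
qed

lemma Re_log_branch:
  assumes "log_branch S L" "x \<in> S"
  shows "x \<noteq> 0" "Re (L x) = ln (norm x)"
proof -
  have x: "exp (L x) = x" using assms by (auto simp: log_branch_def)
  then show "x \<noteq> 0" by (metis exp_not_eq_zero)
  have "norm x = exp (Re (L x))" using x norm_exp_eq_Re by metis
  then show "Re (L x) = ln (norm x)" by simp
qed

text \<open>
  In polar coordinates \<open>Im L - \<theta>\<close> is a continuous function on a convex set with values in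
  \<open>2\<pi>\<int>\<close>, hence constant.
\<close>

lemma Im_log_branch_bounded:
  assumes L: "log_branch (sector a b) L" and ab: "a < b"
  shows "\<exists>K\<ge>0. \<forall>x\<in>sector a b. \<bar>Im (L x)\<bar> \<le> K"
proof -
  define D where "D = {0 :: real<..} \<times> {a<..<b}"
  define g where "g z = Im (L (rcis (fst z) (snd z))) - snd z" for z :: "real \<times> real"
  have D: "rcis (fst z) (snd z) \<in> sector a b" if "z \<in> D" for z
    using that unfolding D_def sector_def by force
  have "continuous_on D (\<lambda>z :: real \<times> real. rcis (fst z) (snd z))"
    unfolding rcis_def cis_conv_exp by (intro continuous_intros)
  then have "continuous_on D (\<lambda>z. L (rcis (fst z) (snd z)))"
    by (rule continuous_on_compose2[of "sector a b" L, rotated]) (use L D in \<open>auto simp: log_branch_def\<close>)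
  then have "continuous_on D g"
    unfolding g_def by (intro continuous_intros)
  moreover have int: "\<exists>n :: int. g z = 2 * pi * n" if "z \<in> D" for z
  proof -
    have "exp (L (rcis (fst z) (snd z))) = rcis (fst z) (snd z)" using L D[OF that] by (auto simp: log_branch_def)
    also have "\<dots> = exp (complex_of_real (ln (fst z)) + \<i> * of_real (snd z))"
    proof -
      have "fst z > 0" using that by (auto simp: D_def)
      then have "complex_of_real (fst z) = exp (complex_of_real (ln (fst z)))" by (simp add: exp_of_real)
      then show ?thesis by (simp add: rcis_def cis_conv_exp exp_add)
    qed
    finally obtain n :: int where "L (rcis (fst z) (snd z)) = complex_of_real (ln (fst z)) + \<i> * of_real (snd z) + (of_int (2 * n) * pi) * \<i>"
      unfolding exp_eq by blast
    then have "Im (L (rcis (fst z) (snd z))) = snd z + 2 * n * pi" by simp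
    then show ?thesis by (intro exI[of _ n]) (simp add: g_def)
  qed
  ultimately have "g constant_on D"
  proof (intro continuous_discrete_range_constant)
    show "connected D" unfolding D_def by (intro convex_connected convex_Times) auto
    fix x assume x: "x \<in> D"
    show "\<exists>e>0. \<forall>y. y \<in> D \<and> g y \<noteq> g x \<longrightarrow> e \<le> norm (g y - g x)"
    proof (intro exI[of _ "2 * pi"] conjI allI impI)
      fix y assume y: "y \<in> D \<and> g y \<noteq> g x"
      obtain n m :: int where nm: "g x = 2 * pi * n" "g y = 2 * pi * m" using int x y by metis
      then have "\<bar>m - n\<bar> \<ge> 1" using y by auto
      then have "\<bar>real_of_int m - real_of_int n\<bar> \<ge> 1" by linarith
      then have "2 * pi * 1 \<le> 2 * pi * \<bar>real_of_int m - real_of_int n\<bar>" by (intro mult_left_mono) auto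
      also have "\<dots> = \<bar>2 * pi * (real_of_int m - real_of_int n)\<bar>" by (simp add: abs_mult)
      finally show "2 * pi \<le> norm (g y - g x)" unfolding nm by (simp add: algebra_simps)
    qed simp
  qed
  then obtain c where c: "\<And>z. z \<in> D \<Longrightarrow> g z = c" unfolding constant_on_def by blast
  show ?thesis
  proof (intro exI conjI ballI)
    show "0 \<le> \<bar>c\<bar> + (\<bar>a\<bar> + \<bar>b\<bar>)" by simp
    fix x assume "x \<in> sector a b"
    then obtain \<rho> \<theta> where x: "x = rcis \<rho> \<theta>" "0 < \<rho>" "a < \<theta>" "\<theta> < b" by (auto simp: sector_def)
    then have "g (\<rho>, \<theta>) = c" by (intro c) (auto simp: D_def)
    then have "Im (L x) = c + \<theta>" by (simp add: g_def x)
    then show "\<bar>Im (L x)\<bar> \<le> \<bar>c\<bar> + (\<bar>a\<bar> + \<bar>b\<bar>)" using x by linarith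
  qed
qed

text \<open>
  If \<open>\<bar>Im (L x)\<bar> \<le> K\<close>, then \<open>\<bar>x\<^bsup>t\<^esup>\<bar> \<le> exp (- R * Re t + K * \<bar>Im t\<bar>)\<close> whenever \<open>\<bar>x\<bar> < exp (- R)\<close> and
  \<open>Re t \<ge> 0\<close>. Summability of the coefficients against these weights is thus a uniform majorant.
\<close>

lemma generalized_series_converges_in_sector:
  fixes c e :: "nat \<Rightarrow> complex"
  assumes L: "log_branch (sector a b) L" and ab: "a < b" "b - a < 2 * pi"
    and e: "\<And>k. Re (e k) \<ge> 0"
    and K: "\<And>x. x \<in> sector a b \<Longrightarrow> \<bar>Im (L x)\<bar> \<le> K"
    and B: "\<And>N. (\<Sum>k<N. norm (c k) * exp (- R * Re (e k) + K * \<bar>Im (e k)\<bar>)) \<le> B"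
  shows "\<exists>r>0. \<exists>f. f holomorphic_on (sector a b \<inter> ball 0 r) \<and>
      uniform_limit (sector a b \<inter> ball 0 r) (\<lambda>N x. \<Sum>k<N. c k * exp (e k * L x)) f sequentially"
proof (intro exI conjI)
  define r where "r = exp (- R)"
  define S where "S = sector a b \<inter> ball 0 r"
  define M where "M k = norm (c k) * exp (- R * Re (e k) + K * \<bar>Im (e k)\<bar>)" for k
  define f where "f x = (\<Sum>k. c k * exp (e k * L x))" for x
  show "r > 0" by (simp add: r_def)
  have "summable M"
  proof (rule bounded_imp_summable)
    show "M k \<ge> 0" for k by (simp add: M_def)
    show "(\<Sum>k\<le>N. M k) \<le> B" for N
      unfolding M_def lessThan_Suc_atMost[symmetric] by (rule B)
  qed
  moreover have "norm (c k * exp (e k * L x)) \<le> M k" if x: "x \<in> S" for k x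
  proof -
    have xs: "x \<in> sector a b" "norm x < exp (- R)" using x by (auto simp: S_def r_def)
    have "ln (norm x) < - R"
      using xs(2) Re_log_branch(1)[OF L xs(1)] by (metis ln_exp ln_less_cancel_iff exp_gt_zero zero_less_norm_iff)
    then have "Re (e k) * Re (L x) \<le> Re (e k) * - R"
      using e[of k] Re_log_branch(2)[OF L xs(1)] by (intro mult_left_mono) auto
    moreover have "- (Im (e k) * Im (L x)) \<le> \<bar>Im (e k)\<bar> * K"
    proof -
      have "- (Im (e k) * Im (L x)) \<le> \<bar>Im (e k)\<bar> * \<bar>Im (L x)\<bar>" by (simp flip: abs_mult)
      also have "\<dots> \<le> \<bar>Im (e k)\<bar> * K" using K[OF xs(1)] by (intro mult_left_mono) auto
      finally show ?thesis .
    qed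
    ultimately have "Re (e k * L x) \<le> - R * Re (e k) + K * \<bar>Im (e k)\<bar>" by (simp add: algebra_simps)
    then show ?thesis by (auto simp: M_def norm_mult norm_exp_eq_Re intro!: mult_left_mono)
  qed
  ultimately have lim: "uniform_limit S (\<lambda>N x. \<Sum>k<N. c k * exp (e k * L x)) f sequentially"
    unfolding f_def by (intro Weierstrass_m_test) auto
  then show "uniform_limit (sector a b \<inter> ball 0 r) (\<lambda>N x. \<Sum>k<N. c k * exp (e k * L x)) f sequentially"
    by (simp add: S_def)
  have "open S" unfolding S_def by (intro open_Int open_sector ab) auto
  have holL: "L holomorphic_on S"
    using log_branch_holomorphic[OF L open_sector[OF ab]] by (rule holomorphic_on_subset) (auto simp: S_def)
  have "f holomorphic_on S"
  proof (rule holomorphic_uniform_sequence[OF \<open>open S\<close>])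
    show "(\<lambda>x. \<Sum>k<N. c k * exp (e k * L x)) holomorphic_on S" for N
      by (intro holomorphic_intros holL)
    fix x assume "x \<in> S"
    then obtain d where "d > 0" "cball x d \<subseteq> S" using \<open>open S\<close> open_contains_cball by blast
    then show "\<exists>d>0. cball x d \<subseteq> S \<and> uniform_limit (cball x d) (\<lambda>N x. \<Sum>k<N. c k * exp (e k * L x)) f sequentially"
      using uniform_limit_on_subset[OF lim] by blast
  qed
  then show "f holomorphic_on (sector a b \<inter> ball 0 r)" by (simp add: S_def)
qed

section \<open>Weighted norms of generalized power series\<close>

lemma gcoeff_0 [simp]: "gcoeff 0 t = 0"
  by (simp add: zero_gps.rep_eq)

lemma gcoeff_1: "gcoeff 1 t = (if t = 0 then 1 else 0)"
  by (simp add: one_gps.rep_eq)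

lemma gcoeff_add [simp]: "gcoeff (f + g) t = gcoeff f t + gcoeff g t"
  by (simp add: plus_gps.rep_eq)

lemma gcoeff_uminus [simp]: "gcoeff (- f) t = - gcoeff f t"
  by (simp add: uminus_gps.rep_eq)

lemma gcoeff_diff [simp]: "gcoeff (f - g) t = gcoeff f t - gcoeff g t"
  by (simp only: minus_gps_def gcoeff_add gcoeff_uminus) simp

lemma gcoeff_sum: "gcoeff (\<Sum>i\<in>I. f i) t = (\<Sum>i\<in>I. gcoeff (f i) t)"
  by (induction I rule: infinite_finite_induct) auto

lemma gcoeff_mult_nonzeroD:
  assumes "gcoeff (f * h) t \<noteq> 0"
  obtains p q where "gcoeff f p \<noteq> 0" "gcoeff h q \<noteq> 0" "t = p + q"
  using assms unfolding times_gps.rep_eq by (rule gconv_nonzeroD)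

text \<open>
  Multiplication of a series by a scalar.
\<close>

lift_definition gscale :: "complex \<Rightarrow> gps \<Rightarrow> gps" is "\<lambda>c f t. c * f t"
proof -
  fix c :: complex and f :: "complex \<Rightarrow> complex"
  assume f: "(\<forall>t. f t \<noteq> 0 \<longrightarrow> t = 0 \<or> Re t > 0) \<and> (\<forall>R. finite {t. f t \<noteq> 0 \<and> Re t \<le> R})"
  have "finite {t. c * f t \<noteq> 0 \<and> Re t \<le> R}" for R
    by (rule finite_subset[of _ "{t. f t \<noteq> 0 \<and> Re t \<le> R}"]) (use f in auto)
  then show "(\<forall>t. c * f t \<noteq> 0 \<longrightarrow> t = 0 \<or> Re t > 0) \<and> (\<forall>R. finite {t. c * f t \<noteq> 0 \<and> Re t \<le> R})"
    using f by auto
qed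

lemma gcoeff_gscale [simp]: "gcoeff (gscale c f) t = c * gcoeff f t"
  by (simp add: gscale.rep_eq)

lemma gscale_mult: "gscale c f * h = gscale c (f * h)"
proof (rule gps_eqI)
  fix t
  let ?A = "{p. gcoeff f p \<noteq> 0 \<and> Re p \<le> Re t}"
  have "gcoeff (gscale c f * h) t = (\<Sum>p\<in>?A. gcoeff (gscale c f) p * gcoeff h (t - p))"
    by (rule gcoeff_times_superset) (auto simp: finite_gcoeff)
  moreover have "gcoeff (f * h) t = (\<Sum>p\<in>?A. gcoeff f p * gcoeff h (t - p))"
    by (rule gcoeff_times_superset) (auto simp: finite_gcoeff)
  ultimately show "gcoeff (gscale c f * h) t = gcoeff (gscale c (f * h)) t"
    by (simp add: sum_distrib_left mult.assoc)
qed

lemma gscale_add: "gscale c (f + h) = gscale c f + gscale c h"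
  by (rule gps_eqI) (simp add: algebra_simps)

lemma of_nat_mult_gps: "of_nat k * f = gscale (of_nat k) f"
proof (rule gps_eqI)
  fix t show "gcoeff (of_nat k * f) t = gcoeff (gscale (of_nat k) f) t"
    by (induction k) (auto simp: algebra_simps)
qed

lemma gscale_gscale: "gscale a (gscale b f) = gscale (a * b) f"
  by (rule gps_eqI) simp

text \<open>
  The monomial \<open>x\<^bsup>\<nu>\<^esup>\<close>; it is a series only if \<open>\<nu> = 0\<close> or \<open>Re \<nu> > 0\<close>.
\<close>

definition gmonom :: "complex \<Rightarrow> gps" where
  "gmonom \<nu> = Abs_gps (\<lambda>t. if t = \<nu> then 1 else 0)"

lemma gcoeff_gmonom:
  assumes "\<nu> = 0 \<or> Re \<nu> > 0"
  shows "gcoeff (gmonom \<nu>) t = (if t = \<nu> then 1 else 0)"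
proof -
  have "finite {t :: complex. (if t = \<nu> then 1 else 0 :: complex) \<noteq> 0 \<and> Re t \<le> R}" for R
    by (rule finite_subset[of _ "{\<nu>}"]) auto
  then show ?thesis
    unfolding gmonom_def by (subst gcoeff_Abs_gps) (use assms in \<open>auto split: if_splits\<close>)
qed

lemma gcoeff_gmonom_mult:
  assumes "\<nu> = 0 \<or> Re \<nu> > 0"
  shows "gcoeff (gmonom \<nu> * f) (t + \<nu>) = gcoeff f t"
  by (subst gcoeff_times_superset[where A = "{\<nu>}"]) (auto simp: gcoeff_gmonom[OF assms] split: if_splits)

lemma gcoeff_mahler_power:
  assumes "l \<ge> 1"
  shows "gcoeff ((mahler l ^^ i) f) t = gcoeff f (t / of_nat (l ^ i))"
  by (induction i arbitrary: t) (auto simp: gcoeff_mahler[OF assms] field_simps)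

lemma mahler_power_add:
  assumes "l \<ge> 1"
  shows "(mahler l ^^ i) (f + h) = (mahler l ^^ i) f + (mahler l ^^ i) h"
  by (rule gps_eqI) (simp add: gcoeff_mahler_power[OF assms])

lemma gcoeff_mahler_power_nonzeroD:
  assumes "l \<ge> 1" "gcoeff ((mahler l ^^ i) f) t \<noteq> 0"
  obtains s where "gcoeff f s \<noteq> 0" "t = of_nat (l ^ i) * s"
proof
  show "gcoeff f (t / of_nat (l ^ i)) \<noteq> 0" using assms by (simp add: gcoeff_mahler_power)
  show "t = of_nat (l ^ i) * (t / of_nat (l ^ i))" using assms(1) by simp
qed


text \<open>
  A bound for \<open>\<bar>x\<^bsup>t\<^esup>\<bar>\<close> when \<open>\<bar>x\<bar> = exp (- R)\<close> and the argument of \<open>x\<close> is at most \<open>K\<close> in absolute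
  value. It is submultiplicative in \<open>t\<close> but, because of the absolute value, not multiplicative.
\<close>

definition wt :: "real \<Rightarrow> real \<Rightarrow> complex \<Rightarrow> real" where
  "wt R K t = exp (- R * Re t + K * \<bar>Im t\<bar>)"

lemma wt_pos [simp]: "wt R K t > 0" and wt_nonneg [simp]: "wt R K t \<ge> 0"
  by (auto simp: wt_def)

lemma wt_0 [simp]: "wt R K 0 = 1"
  by (simp add: wt_def)

lemma wt_add: "K \<ge> 0 \<Longrightarrow> wt R K (s + t) \<le> wt R K s * wt R K t"
  using mult_left_mono[OF abs_triangle_ineq[of "Im s" "Im t"], of K]
  by (simp add: wt_def algebra_simps flip: exp_add)

lemma wt_change: "wt R K t = exp (- (R - R') * Re t) * wt R' K t"
  by (simp add: wt_def algebra_simps flip: exp_add)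

text \<open>
  The weighted \<open>\<ell>\<^sup>1\<close> norm of the part of \<open>f\<close> with exponents of real part at most \<open>T\<close>. Truncation makes
  this a finite sum for every series, convergent or not; a bound uniform in \<open>T\<close> expresses
  convergence.
\<close>

definition gnorm :: "real \<Rightarrow> real \<Rightarrow> real \<Rightarrow> gps \<Rightarrow> real" where
  "gnorm R K T f = (\<Sum>t | gcoeff f t \<noteq> 0 \<and> Re t \<le> T. norm (gcoeff f t) * wt R K t)"

lemma gnorm_nonneg [simp]: "gnorm R K T f \<ge> 0"
  by (auto simp: gnorm_def intro!: sum_nonneg)

lemma gnorm_eq_sum:
  assumes "finite A" "\<And>t. gcoeff f t \<noteq> 0 \<Longrightarrow> Re t \<le> T \<Longrightarrow> t \<in> A" "\<And>t. t \<in> A \<Longrightarrow> Re t \<le> T"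
  shows "gnorm R K T f = (\<Sum>t\<in>A. norm (gcoeff f t) * wt R K t)"
  unfolding gnorm_def by (rule sum.mono_neutral_left) (use assms in auto)

lemma gnorm_mono: "T \<le> U \<Longrightarrow> gnorm R K T f \<le> gnorm R K U f"
  unfolding gnorm_def by (rule sum_mono2) (auto simp: finite_gcoeff)

lemma gnorm_0 [simp]: "gnorm R K T 0 = 0"
  by (simp add: gnorm_def)

lemma gnorm_1: "gnorm R K T 1 \<le> 1"
proof -
  have "gnorm R K T 1 \<le> (\<Sum>t\<in>{0}. norm (gcoeff 1 t) * wt R K t)"
    unfolding gnorm_def by (rule sum_mono2) (auto simp: gcoeff_1 split: if_splits)
  then show ?thesis by (simp add: gcoeff_1)
qed

lemma gnorm_gscale: "gnorm R K T (gscale c f) = norm c * gnorm R K T f"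
proof (cases "c = 0")
  case False
  then show ?thesis by (simp add: gnorm_def norm_mult sum_distrib_left mult.assoc)
qed (simp add: gnorm_def)

lemma gnorm_add: "gnorm R K T (f + h) \<le> gnorm R K T f + gnorm R K T h"
proof -
  let ?A = "{t. gcoeff f t \<noteq> 0 \<and> Re t \<le> T} \<union> {t. gcoeff h t \<noteq> 0 \<and> Re t \<le> T}"
  have A: "finite ?A" by (simp add: finite_gcoeff)
  have "gnorm R K T (f + h) = (\<Sum>t\<in>?A. norm (gcoeff (f + h) t) * wt R K t)"
    by (rule gnorm_eq_sum[OF A]) auto
  also have "\<dots> \<le> (\<Sum>t\<in>?A. norm (gcoeff f t) * wt R K t + norm (gcoeff h t) * wt R K t)"
    by (intro sum_mono) (auto simp flip: distrib_right intro!: mult_right_mono norm_triangle_ineq)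
  also have "\<dots> = gnorm R K T f + gnorm R K T h"
    unfolding sum.distrib
    by (intro arg_cong2[of _ _ _ _ "(+)"] gnorm_eq_sum[OF A, symmetric]) auto
  finally show ?thesis .
qed

lemma gnorm_sum: "gnorm R K T (\<Sum>i\<in>I. f i) \<le> (\<Sum>i\<in>I. gnorm R K T (f i))"
proof (induction I rule: infinite_finite_induct)
  case (insert i I)
  then show ?case using gnorm_add[of R K T "f i" "sum f I"] by simp
qed auto

text \<open>
  Submultiplicativity. The hypothesis says which truncations of the factors influence the truncation
  of the product; when the factors have positive order, lower truncations than \<open>T\<close> suffice.
\<close>

lemma gnorm_mult:
  assumes K: "K \<ge> 0"
    and "\<And>s t. gcoeff f s \<noteq> 0 \<Longrightarrow> gcoeff h t \<noteq> 0 \<Longrightarrow> Re s + Re t \<le> T \<Longrightarrow> Re s \<le> T1 \<and> Re t \<le> T2"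
  shows "gnorm R K T (f * h) \<le> gnorm R K T1 f * gnorm R K T2 h"
proof -
  let ?S = "{t. gcoeff (f * h) t \<noteq> 0 \<and> Re t \<le> T}"
  let ?P = "{t. gcoeff f t \<noteq> 0 \<and> Re t \<le> T1}" and ?Q = "{t. gcoeff h t \<noteq> 0 \<and> Re t \<le> T2}"
  define I where "I t = {p. gcoeff f p \<noteq> 0 \<and> gcoeff h (t - p) \<noteq> 0}" for t
  define c where "c p q = (norm (gcoeff f p) * wt R K p) * (norm (gcoeff h q) * wt R K q)" for p q
  have I: "I t \<subseteq> {p \<in> ?P. t - p \<in> ?Q}" if "Re t \<le> T" for t
  proof
    fix p assume p: "p \<in> I t"
    then show "p \<in> {p \<in> ?P. t - p \<in> ?Q}"
      using assms(2)[of p "t - p"] that by (auto simp: I_def)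
  qed
  have fin: "finite (I t)" if "Re t \<le> T" for t
    by (rule finite_subset[of _ ?P]) (use I[OF that] in \<open>auto simp: finite_gcoeff\<close>)
  have "gnorm R K T (f * h) \<le> (\<Sum>t\<in>?S. \<Sum>p\<in>I t. c p (t - p))"
    unfolding gnorm_def
  proof (rule sum_mono)
    fix t assume "t \<in> ?S"
    have "norm (gcoeff (f * h) t) * wt R K t \<le> (\<Sum>p\<in>I t. norm (gcoeff f p * gcoeff h (t - p))) * wt R K t"
      unfolding times_gps.rep_eq gconv_def I_def by (intro mult_right_mono sum_norm_le) auto
    also have "\<dots> \<le> (\<Sum>p\<in>I t. c p (t - p))"
      unfolding sum_distrib_right
    proof (rule sum_mono)
      fix p
      have "norm (gcoeff f p * gcoeff h (t - p)) * wt R K t \<le>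
          norm (gcoeff f p * gcoeff h (t - p)) * (wt R K p * wt R K (t - p))"
        using wt_add[OF K, of R p "t - p"] by (intro mult_left_mono) auto
      then show "norm (gcoeff f p * gcoeff h (t - p)) * wt R K t \<le> c p (t - p)"
        by (simp add: c_def norm_mult mult_ac)
    qed
    finally show "norm (gcoeff (f * h) t) * wt R K t \<le> (\<Sum>p\<in>I t. c p (t - p))" .
  qed
  also have "\<dots> = (\<Sum>(t, p)\<in>Sigma ?S I. c p (t - p))"
    by (rule sum.Sigma) (auto simp: finite_gcoeff fin)
  also have "\<dots> = (\<Sum>(p, q)\<in>(\<lambda>(t, p). (p, t - p)) ` Sigma ?S I. c p q)"
    by (subst sum.reindex) (auto simp: inj_on_def case_prod_unfold)
  also have "\<dots> \<le> (\<Sum>(p, q)\<in>?P \<times> ?Q. c p q)"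
  proof (rule sum_mono2)
    show "finite (?P \<times> ?Q)" by (simp add: finite_gcoeff)
    show "(\<lambda>(t, p). (p, t - p)) ` Sigma ?S I \<subseteq> ?P \<times> ?Q" using I by fastforce
  qed (auto simp: c_def)
  also have "\<dots> = gnorm R K T1 f * gnorm R K T2 h"
    by (simp add: gnorm_def c_def sum_product sum.cartesian_product)
  finally show ?thesis .
qed

lemma gnorm_mult': "K \<ge> 0 \<Longrightarrow> gnorm R K T (f * h) \<le> gnorm R K T f * gnorm R K T h"
  by (rule gnorm_mult) (auto dest!: gcoeff_nonzero_Re_nonneg)

lemma gnorm_power: "K \<ge> 0 \<Longrightarrow> gnorm R K T (f ^ n) \<le> gnorm R K T f ^ n"
proof (induction n)
  case (Suc n)
  then have "gnorm R K T f * gnorm R K T (f ^ n) \<le> gnorm R K T f * gnorm R K T f ^ n"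
    by (intro mult_left_mono) auto
  with gnorm_mult'[OF Suc.prems, of R T f "f ^ n"] show ?case by simp
qed (simp add: gnorm_1)

lemma gnorm_prod: "K \<ge> 0 \<Longrightarrow> gnorm R K T (\<Prod>i\<in>I. f i) \<le> (\<Prod>i\<in>I. gnorm R K T (f i))"
proof (induction I rule: infinite_finite_induct)
  case (insert i I)
  then have "gnorm R K T (f i) * gnorm R K T (\<Prod>i\<in>I. f i) \<le> gnorm R K T (f i) * (\<Prod>i\<in>I. gnorm R K T (f i))"
    by (intro mult_left_mono) auto
  with gnorm_mult'[OF insert.prems, of R T "f i" "\<Prod>i\<in>I. f i"] insert.hyps show ?case by simp
qed (simp_all add: gnorm_1)

lemma gnorm_change_radius:
  assumes "R' \<le> R" "\<And>t. gcoeff f t \<noteq> 0 \<Longrightarrow> Re t \<le> T \<Longrightarrow> c \<le> Re t"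
  shows "gnorm R K T f \<le> exp (- (R - R') * c) * gnorm R' K T f"
  unfolding gnorm_def sum_distrib_left
proof (rule sum_mono)
  fix t assume t: "t \<in> {t. gcoeff f t \<noteq> 0 \<and> Re t \<le> T}"
  then have "(R - R') * c \<le> (R - R') * Re t" using assms by (intro mult_left_mono) auto
  then have "wt R K t \<le> exp (- (R - R') * c) * wt R' K t"
    unfolding wt_change[of R K t R'] by (intro mult_right_mono) (auto simp: algebra_simps)
  then show "norm (gcoeff f t) * wt R K t \<le> exp (- (R - R') * c) * (norm (gcoeff f t) * wt R' K t)"
    using mult_left_mono[of _ _ "norm (gcoeff f t)"] by (fastforce simp: mult_ac)
qed

lemma gnorm_shift:
  assumes K: "K \<ge> 0" and eq: "\<And>t. Re t \<le> T \<Longrightarrow> A * gcoeff f t = - gcoeff h (t + \<nu>)"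
  shows "norm A * gnorm R K T f \<le> wt R K (- \<nu>) * gnorm R K (T + Re \<nu>) h"
proof (cases "A = 0")
  case False
  let ?S = "{t. gcoeff f t \<noteq> 0 \<and> Re t \<le> T}"
  have "norm A * gnorm R K T f = (\<Sum>t\<in>?S. norm (gcoeff h (t + \<nu>)) * wt R K t)"
    unfolding gnorm_def sum_distrib_left
  proof (rule sum.cong[OF refl])
    fix t assume "t \<in> ?S"
    then have "norm (A * gcoeff f t) = norm (gcoeff h (t + \<nu>))" using eq by simp
    then show "norm A * (norm (gcoeff f t) * wt R K t) = norm (gcoeff h (t + \<nu>)) * wt R K t"
      by (simp add: norm_mult)
  qed
  also have "\<dots> \<le> (\<Sum>t\<in>?S. wt R K (- \<nu>) * (norm (gcoeff h (t + \<nu>)) * wt R K (t + \<nu>)))"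
  proof (rule sum_mono)
    fix t
    have "wt R K t \<le> wt R K (- \<nu>) * wt R K (t + \<nu>)"
      using wt_add[OF K, of R "- \<nu>" "t + \<nu>"] by simp
    then show "norm (gcoeff h (t + \<nu>)) * wt R K t \<le> wt R K (- \<nu>) * (norm (gcoeff h (t + \<nu>)) * wt R K (t + \<nu>))"
      using mult_left_mono[of _ _ "norm (gcoeff h (t + \<nu>))"] by (fastforce simp: mult_ac)
  qed
  also have "\<dots> = wt R K (- \<nu>) * (\<Sum>t\<in>(\<lambda>t. t + \<nu>) ` ?S. norm (gcoeff h t) * wt R K t)"
    by (subst sum.reindex) (auto simp: inj_on_def sum_distrib_left)
  also have "\<dots> \<le> wt R K (- \<nu>) * gnorm R K (T + Re \<nu>) h"
    unfolding gnorm_def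
  proof (intro mult_left_mono sum_mono2)
    show "(\<lambda>t. t + \<nu>) ` ?S \<subseteq> {t. gcoeff h t \<noteq> 0 \<and> Re t \<le> T + Re \<nu>}"
    proof
      fix u assume "u \<in> (\<lambda>t. t + \<nu>) ` ?S"
      then obtain t where t: "u = t + \<nu>" "t \<in> ?S" by blast
      then have "gcoeff h u \<noteq> 0" using eq[of t] False by auto
      then show "u \<in> {t. gcoeff h t \<noteq> 0 \<and> Re t \<le> T + Re \<nu>}" using t by simp
    qed
  qed (auto simp: finite_gcoeff)
  finally show ?thesis .
qed simp


text \<open>
  The next two notions control supports of polynomials over the ring of series: the constant
  coefficient is supported in \<open>S0\<close>, the linear one in \<open>S1\<close> and all the others in \<open>S2\<close>. The condition
  \<open>graded_sets\<close> makes such polynomials closed under multiplication. With half planes for \<open>S0\<close>, \<open>S1\<close>,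
  \<open>S2\<close> this bounds orders, with cones it bounds the imaginary parts of exponents.
\<close>

definition graded_supp :: "complex set \<Rightarrow> complex set \<Rightarrow> complex set \<Rightarrow> gps poly \<Rightarrow> bool" where
  "graded_supp S0 S1 S2 f \<longleftrightarrow>
     (\<forall>j t. gcoeff (coeff f j) t \<noteq> 0 \<longrightarrow> t \<in> (if j = 0 then S0 else if j = 1 then S1 else S2))"

definition graded_sets :: "complex set \<Rightarrow> complex set \<Rightarrow> complex set \<Rightarrow> bool" where
  "graded_sets S0 S1 S2 \<longleftrightarrow> 0 \<in> S0 \<and> (\<forall>s\<in>S0. \<forall>t\<in>S0. s + t \<in> S0) \<and> (\<forall>s\<in>S0. \<forall>t\<in>S1. s + t \<in> S1) \<and>
     (\<forall>s\<in>S0. \<forall>t\<in>S2. s + t \<in> S2) \<and> (\<forall>s\<in>S1. \<forall>t\<in>S1. s + t \<in> S2) \<and>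
     (\<forall>s\<in>S1. \<forall>t\<in>S2. s + t \<in> S2) \<and> (\<forall>s\<in>S2. \<forall>t\<in>S2. s + t \<in> S2)"

lemma graded_supp_1: "graded_sets S0 S1 S2 \<Longrightarrow> graded_supp S0 S1 S2 1"
  by (auto simp: graded_supp_def graded_sets_def coeff_1 gcoeff_1 split: if_splits)

lemma graded_supp_mult:
  assumes S: "graded_sets S0 S1 S2" and f: "graded_supp S0 S1 S2 f" and h: "graded_supp S0 S1 S2 h"
  shows "graded_supp S0 S1 S2 (f * h)"
  unfolding graded_supp_def
proof (intro allI impI)
  fix j t assume "gcoeff (coeff (f * h) j) t \<noteq> 0"
  then obtain i where i: "i \<le> j" "gcoeff (coeff f i * coeff h (j - i)) t \<noteq> 0"
    unfolding coeff_mult gcoeff_sum by (metis (no_types, lifting) atMost_iff sum.not_neutral_contains_not_neutral)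
  from i(2) obtain p q where pq: "gcoeff (coeff f i) p \<noteq> 0" "gcoeff (coeff h (j - i)) q \<noteq> 0" "t = p + q"
    by (rule gcoeff_mult_nonzeroD)
  define S where "S j = (if j = 0 then S0 else if j = 1 then S1 else S2)" for j :: nat
  have p: "p \<in> S i" and q: "q \<in> S (j - i)"
    using f h pq unfolding graded_supp_def S_def by blast+
  have comm: "q + p = p + q" by simp
  have "p + q \<in> S j"
  proof (cases "i = 0 \<or> j = i")
    case True
    then show ?thesis using p q S comm i(1) unfolding S_def graded_sets_def
      by (auto split: if_splits) (metis comm)+
  next
    case False
    then have "j \<noteq> 0" "j \<noteq> 1" "i \<noteq> 0" "j - i \<noteq> 0" using i(1) by auto
    then show ?thesis using p q S comm unfolding S_def graded_sets_def
      by (auto split: if_splits) (metis comm)+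
  qed
  then show "t \<in> (if j = 0 then S0 else if j = 1 then S1 else S2)"
    using pq(3) by (simp add: S_def)
qed

lemma graded_supp_power:
  "graded_sets S0 S1 S2 \<Longrightarrow> graded_supp S0 S1 S2 f \<Longrightarrow> graded_supp S0 S1 S2 (f ^ n)"
  by (induction n) (auto intro: graded_supp_1 graded_supp_mult)

lemma graded_supp_prod:
  "graded_sets S0 S1 S2 \<Longrightarrow> (\<And>i. i \<in> I \<Longrightarrow> graded_supp S0 S1 S2 (f i)) \<Longrightarrow> graded_supp S0 S1 S2 (\<Prod>i\<in>I. f i)"
  by (induction I rule: infinite_finite_induct) (auto intro: graded_supp_1 graded_supp_mult)


text \<open>
  A norm on polynomials over the ring of series, in which the indeterminate has norm \<open>\<tau>\<close> and which is
  cut off at degree \<open>n\<close>. The linear coefficient is truncated at \<open>T\<close>, every other one at the higher level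
  \<open>T + \<sigma>\<close>: if all coefficients of positive degree have order at least \<open>\<sigma>\<close>, the truncation at \<open>T + \<sigma>\<close>
  of a quadratic term only involves its linear factors up to \<open>T\<close>.
\<close>

definition pnorm :: "real \<Rightarrow> real \<Rightarrow> real \<Rightarrow> real \<Rightarrow> real \<Rightarrow> nat \<Rightarrow> gps poly \<Rightarrow> real" where
  "pnorm R K T \<sigma> \<tau> n f = (\<Sum>j\<le>n. \<tau> ^ j * gnorm R K (if j = 1 then T else T + \<sigma>) (coeff f j))"

lemma pnorm_nonneg: "\<tau> \<ge> 0 \<Longrightarrow> pnorm R K T \<sigma> \<tau> n f \<ge> 0"
  by (auto simp: pnorm_def intro!: sum_nonneg)

lemma sum_convolution_le:
  fixes u v :: "nat \<Rightarrow> real"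
  assumes "\<And>i. u i \<ge> 0" "\<And>i. v i \<ge> 0"
  shows "(\<Sum>j\<le>n. \<Sum>i\<le>j. u i * v (j - i)) \<le> (\<Sum>i\<le>n. u i) * (\<Sum>i\<le>n. v i)"
proof -
  have "(\<Sum>j\<le>n. \<Sum>i\<le>j. u i * v (j - i)) = (\<Sum>(i, j)\<in>{(i, j). i + j \<le> n}. u i * v j)"
    by (rule sum.triangle_reindex_eq[symmetric])
  also have "\<dots> \<le> (\<Sum>(i, j)\<in>{..n} \<times> {..n}. u i * v j)"
    by (rule sum_mono2) (use assms in auto)
  also have "\<dots> = (\<Sum>i\<le>n. u i) * (\<Sum>i\<le>n. v i)"
    by (simp add: sum_product sum.cartesian_product)
  finally show ?thesis .
qed

lemma pnorm_mult:
  assumes K: "K \<ge> 0" and \<tau>: "\<tau> \<ge> 0" and \<sigma>: "\<sigma> \<ge> 0"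
    and f: "graded_supp {t. 0 \<le> Re t} {t. \<sigma> \<le> Re t} {t. \<sigma> \<le> Re t} f"
    and h: "graded_supp {t. 0 \<le> Re t} {t. \<sigma> \<le> Re t} {t. \<sigma> \<le> Re t} h"
  shows "pnorm R K T \<sigma> \<tau> n (f * h) \<le> pnorm R K T \<sigma> \<tau> n f * pnorm R K T \<sigma> \<tau> n h"
proof -
  define U where "U j = (if j = 1 then T else T + \<sigma>)" for j :: nat
  define u where "u j = \<tau> ^ j * gnorm R K (U j) (coeff f j)" for j
  define v where "v j = \<tau> ^ j * gnorm R K (U j) (coeff h j)" for j
  have ord: "\<sigma> \<le> Re t" if "gcoeff (coeff f j) t \<noteq> 0 \<or> gcoeff (coeff h j) t \<noteq> 0" "j \<noteq> 0" for j t
    using f h that unfolding graded_supp_def by (metis (mono_tags, lifting) mem_Collect_eq)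
  have "gnorm R K (U j) (coeff f i * coeff h (j - i)) \<le> gnorm R K (U i) (coeff f i) * gnorm R K (U (j - i)) (coeff h (j - i))"
    if ij: "i \<le> j" for i j
  proof (rule gnorm_mult[OF K])
    fix s t assume s: "gcoeff (coeff f i) s \<noteq> 0" and t: "gcoeff (coeff h (j - i)) t \<noteq> 0" and le: "Re s + Re t \<le> U j"
    have 1: "Re s \<ge> 0" "Re t \<ge> 0" using s t gcoeff_nonzero_Re_nonneg by blast+
    have 2: "i \<noteq> 0 \<Longrightarrow> Re s \<ge> \<sigma>" "j - i \<noteq> 0 \<Longrightarrow> Re t \<ge> \<sigma>" using ord s t by blast+
    show "Re s \<le> U i \<and> Re t \<le> U (j - i)"
      using 1 2 le ij \<sigma> by (cases "i = 0"; cases "j = i") (auto simp: U_def split: if_splits)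
  qed
  then have "\<tau> ^ j * (\<Sum>i\<le>j. gnorm R K (U j) (coeff f i * coeff h (j - i))) \<le> (\<Sum>i\<le>j. u i * v (j - i))" for j
    unfolding sum_distrib_left
  proof (intro sum_mono)
    fix i assume le: "\<And>i j. i \<le> j \<Longrightarrow> gnorm R K (U j) (coeff f i * coeff h (j - i)) \<le> gnorm R K (U i) (coeff f i) * gnorm R K (U (j - i)) (coeff h (j - i))"
      and i: "i \<in> {..j}"
    have "\<tau> ^ j = \<tau> ^ i * \<tau> ^ (j - i)" using i by (simp flip: power_add)
    then show "\<tau> ^ j * gnorm R K (U j) (coeff f i * coeff h (j - i)) \<le> u i * v (j - i)"
      using mult_left_mono[OF le[of i j], of "\<tau> ^ j"] i \<tau> by (simp add: u_def v_def mult_ac)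
  qed
  moreover have "\<tau> ^ j * gnorm R K (U j) (coeff (f * h) j) \<le> \<tau> ^ j * (\<Sum>i\<le>j. gnorm R K (U j) (coeff f i * coeff h (j - i)))" for j
    unfolding coeff_mult using \<tau> by (intro mult_left_mono gnorm_sum) auto
  ultimately have "pnorm R K T \<sigma> \<tau> n (f * h) \<le> (\<Sum>j\<le>n. \<Sum>i\<le>j. u i * v (j - i))"
    unfolding pnorm_def U_def[symmetric] by (intro sum_mono) (meson order_trans)
  also have "\<dots> \<le> (\<Sum>i\<le>n. u i) * (\<Sum>i\<le>n. v i)"
    by (rule sum_convolution_le) (use \<tau> in \<open>auto simp: u_def v_def\<close>)
  finally show ?thesis by (simp add: pnorm_def u_def v_def U_def)
qed

lemma pnorm_1: "pnorm R K T \<sigma> \<tau> n 1 \<le> 1"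
proof -
  have "pnorm R K T \<sigma> \<tau> n 1 = (\<Sum>j\<in>{0}. \<tau> ^ j * gnorm R K (if j = 1 then T else T + \<sigma>) (coeff 1 j))"
    unfolding pnorm_def by (rule sum.mono_neutral_right) (auto simp: coeff_1)
  then show ?thesis using gnorm_1[of R K "T + \<sigma>"] by simp
qed

lemma graded_sets_halfplane:
  "\<sigma> \<ge> 0 \<Longrightarrow> \<sigma> \<le> \<sigma>' \<Longrightarrow> \<sigma>' \<le> 2 * \<sigma> \<Longrightarrow> graded_sets {t. 0 \<le> Re t} {t. \<sigma> \<le> Re t} {t. \<sigma>' \<le> Re t}"
  by (auto simp: graded_sets_def)

lemma pnorm_power:
  assumes "K \<ge> 0" "\<tau> \<ge> 0" "\<sigma> \<ge> 0" and f: "graded_supp {t. 0 \<le> Re t} {t. \<sigma> \<le> Re t} {t. \<sigma> \<le> Re t} f"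
  shows "pnorm R K T \<sigma> \<tau> n (f ^ k) \<le> pnorm R K T \<sigma> \<tau> n f ^ k"
proof (induction k)
  case (Suc k)
  have "pnorm R K T \<sigma> \<tau> n (f * f ^ k) \<le> pnorm R K T \<sigma> \<tau> n f * pnorm R K T \<sigma> \<tau> n (f ^ k)"
    using assms by (intro pnorm_mult graded_supp_power graded_sets_halfplane) auto
  also have "\<dots> \<le> pnorm R K T \<sigma> \<tau> n f * pnorm R K T \<sigma> \<tau> n f ^ k"
    using Suc assms by (intro mult_left_mono pnorm_nonneg) auto
  finally show ?case by simp
qed (simp add: pnorm_1)

lemma pnorm_prod:
  assumes "K \<ge> 0" "\<tau> \<ge> 0" "\<sigma> \<ge> 0"
    and "\<And>i. i \<in> I \<Longrightarrow> graded_supp {t. 0 \<le> Re t} {t. \<sigma> \<le> Re t} {t. \<sigma> \<le> Re t} (f i)"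
  shows "pnorm R K T \<sigma> \<tau> n (\<Prod>i\<in>I. f i) \<le> (\<Prod>i\<in>I. pnorm R K T \<sigma> \<tau> n (f i))"
  using assms(4)
proof (induction I rule: infinite_finite_induct)
  case (insert i I)
  have "pnorm R K T \<sigma> \<tau> n (f i * (\<Prod>i\<in>I. f i)) \<le> pnorm R K T \<sigma> \<tau> n (f i) * pnorm R K T \<sigma> \<tau> n (\<Prod>i\<in>I. f i)"
    using assms insert.prems by (intro pnorm_mult graded_supp_prod graded_sets_halfplane) auto
  also have "\<dots> \<le> pnorm R K T \<sigma> \<tau> n (f i) * (\<Prod>i\<in>I. pnorm R K T \<sigma> \<tau> n (f i))"
    using insert assms by (intro mult_left_mono pnorm_nonneg) auto
  finally show ?case using insert.hyps by simp
qed (simp_all add: pnorm_1)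

text \<open>
  The monomial \<open>p\<^sup>\<gamma>\<close> in \<open>m\<close> series.
\<close>

definition gmon :: "nat \<Rightarrow> (nat \<Rightarrow> gps) \<Rightarrow> (nat \<Rightarrow> nat) \<Rightarrow> gps" where
  "gmon m p \<gamma> = (\<Prod>k<m. p k ^ \<gamma> k)"

text \<open>
  The polynomial \<open>pert p q k\<close> in an indeterminate \<open>\<epsilon>\<close> equals \<open>p k + q k\<close> at \<open>\<epsilon> = 1\<close>. The
  perturbation \<open>q 1\<close> of the unknown \<open>y\<^sub>0\<close> is given degree \<open>1\<close>, while the other perturbations, which
  turn out to be as small as the square of the bound for \<open>q 1\<close>, are given degree \<open>2\<close>.
\<close>

definition pert :: "(nat \<Rightarrow> gps) \<Rightarrow> (nat \<Rightarrow> gps) \<Rightarrow> nat \<Rightarrow> gps poly" where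
  "pert p q k = (if k = 1 then [:p k, q k:] else [:p k, 0, q k:])"

text \<open>
  The \<open>\<gamma>\<close>-monomial in the perturbed series, as a polynomial in \<open>\<epsilon>\<close>.
\<close>

definition pmon :: "nat \<Rightarrow> (nat \<Rightarrow> gps) \<Rightarrow> (nat \<Rightarrow> gps) \<Rightarrow> (nat \<Rightarrow> nat) \<Rightarrow> gps poly" where
  "pmon m p q \<gamma> = (\<Prod>k<m. pert p q k ^ \<gamma> k)"

text \<open>
  The terms of degree at least \<open>2\<close> in \<open>\<epsilon>\<close> of the \<open>\<gamma>\<close>-monomial, evaluated at \<open>\<epsilon> = 1\<close>.
\<close>

definition prest :: "nat \<Rightarrow> (nat \<Rightarrow> gps) \<Rightarrow> (nat \<Rightarrow> gps) \<Rightarrow> (nat \<Rightarrow> nat) \<Rightarrow> gps" where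
  "prest m p q \<gamma> = (\<Sum>j=2..degree (pmon m p q \<gamma>). coeff (pmon m p q \<gamma>) j)"

lemma poly_pmon_1: "poly (pmon m p q \<gamma>) 1 = gmon m (\<lambda>k. p k + q k) \<gamma>"
  unfolding pmon_def gmon_def poly_prod poly_power
  by (intro prod.cong refl arg_cong2[of _ _ _ _ "(^)"]) (simp add: pert_def)

lemma coeff_pmon_0: "coeff (pmon m p q \<gamma>) 0 = gmon m p \<gamma>"
  unfolding pmon_def gmon_def poly_0_coeff_0[symmetric] poly_prod poly_power
  by (intro prod.cong refl arg_cong2[of _ _ _ _ "(^)"]) (simp add: pert_def)

lemma coeff_mult_1: "coeff (f * h) 1 = coeff f 0 * coeff h 1 + coeff f 1 * coeff h 0"
  by (simp add: coeff_mult atMost_Suc add.commute)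

lemma coeff_power_1:
  fixes f :: "'a :: comm_ring_1 poly"
  shows "coeff (f ^ n) 1 = of_nat n * coeff f 0 ^ (n - 1) * coeff f 1"
proof (induction n)
  case (Suc n)
  have "coeff (f ^ n) 0 = coeff f 0 ^ n" by (simp add: poly_0_coeff_0[symmetric])
  then show ?case unfolding power_Suc coeff_mult_1 Suc
    by (cases n) (auto simp: algebra_simps)
qed simp

lemma coeff_prod_1_eq_0:
  assumes "\<And>i. i \<in> I \<Longrightarrow> coeff (f i) 1 = 0"
  shows "coeff (\<Prod>i\<in>I. f i) 1 = 0"
  using assms
proof (induction I rule: infinite_finite_induct)
  case (insert i I)
  then show ?case by (simp add: coeff_mult_1 del: One_nat_def)
qed (auto simp: coeff_1)

lemma coeff_pmon_1:
  assumes "1 < m"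
  shows "coeff (pmon m p q \<gamma>) 1 = of_nat (\<gamma> 1) * gmon m p (\<gamma>(1 := \<gamma> 1 - 1)) * q 1"
proof -
  let ?r = "\<Prod>k\<in>{..<m} - {1}. pert p q k ^ \<gamma> k"
  have "pmon m p q \<gamma> = pert p q 1 ^ \<gamma> 1 * ?r"
    unfolding pmon_def using assms by (subst prod.remove[of _ 1]) auto
  moreover have "coeff ?r 1 = 0"
    by (intro coeff_prod_1_eq_0) (simp add: coeff_power_1 pert_def del: One_nat_def, simp)
  moreover have "coeff ?r 0 = (\<Prod>k\<in>{..<m} - {1}. p k ^ \<gamma> k)"
    unfolding poly_0_coeff_0[symmetric] poly_prod poly_power
    by (intro prod.cong refl arg_cong2[of _ _ _ _ "(^)"]) (simp add: pert_def)
  moreover have "gmon m p (\<gamma>(1 := \<gamma> 1 - 1)) = p 1 ^ (\<gamma> 1 - 1) * (\<Prod>k\<in>{..<m} - {1}. p k ^ \<gamma> k)"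
    unfolding gmon_def using assms by (subst prod.remove[of _ 1]) auto
  ultimately show ?thesis
    by (simp only: coeff_mult_1 coeff_power_1) (simp add: pert_def mult_ac)
qed

text \<open>
  Expansion of a monomial to first order in the coordinate \<open>y\<^sub>0\<close>.
\<close>

lemma gmon_expand:
  assumes "1 < m"
  shows "gmon m (\<lambda>k. p k + q k) \<gamma> =
    gmon m p \<gamma> + of_nat (\<gamma> 1) * gmon m p (\<gamma>(1 := \<gamma> 1 - 1)) * q 1 + prest m p q \<gamma>"
proof -
  let ?f = "pmon m p q \<gamma>"
  have "poly ?f 1 = (\<Sum>j\<le>degree ?f. coeff ?f j)" by (simp add: poly_altdef)
  also have "\<dots> = (\<Sum>j\<in>{0, 1} \<union> {2..degree ?f}. coeff ?f j)"
    by (rule sum.mono_neutral_left) (auto intro: coeff_eq_0)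
  also have "\<dots> = coeff ?f 0 + coeff ?f 1 + prest m p q \<gamma>"
    by (subst sum.union_disjoint) (auto simp: prest_def)
  finally show ?thesis by (simp add: poly_pmon_1 coeff_pmon_0 coeff_pmon_1[OF assms] del: One_nat_def)
qed

lemma graded_supp_pmon:
  assumes S: "graded_sets S0 S1 S2"
    and p: "\<And>k t. k < m \<Longrightarrow> gcoeff (p k) t \<noteq> 0 \<Longrightarrow> t \<in> S0"
    and q: "\<And>k t. k < m \<Longrightarrow> gcoeff (q k) t \<noteq> 0 \<Longrightarrow> t \<in> (if k = 1 then S1 else S2)"
  shows "graded_supp S0 S1 S2 (pmon m p q \<gamma>)"
  unfolding pmon_def
proof (intro graded_supp_prod graded_supp_power S)
  fix k assume k: "k \<in> {..<m}"
  show "graded_supp S0 S1 S2 (pert p q k)"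
    using p[of k] q[of k] k
    by (auto simp: graded_supp_def pert_def coeff_pCons split: nat.splits if_splits)
qed

lemma gcoeff_prest_nonzeroD:
  assumes "graded_supp S0 S1 S2 (pmon m p q \<gamma>)" "gcoeff (prest m p q \<gamma>) t \<noteq> 0"
  shows "t \<in> S2"
proof -
  obtain j where "j \<ge> 2" "gcoeff (coeff (pmon m p q \<gamma>) j) t \<noteq> 0"
    using assms(2) unfolding prest_def gcoeff_sum
    by (metis (no_types, lifting) atLeastAtMost_iff sum.not_neutral_contains_not_neutral)
  then have "t \<in> (if j = 0 then S0 else if j = 1 then S1 else S2)" "j \<ge> 2"
    using assms(1) unfolding graded_supp_def by blast+
  then show ?thesis by auto
qed

lemma pnorm_pert:
  assumes "\<tau> \<ge> 0"
  shows "pnorm R K T \<sigma> \<tau> n (pert p q k) \<le> gnorm R K (T + \<sigma>) (p k) +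
    (if k = 1 then \<tau> * gnorm R K T (q k) else \<tau> ^ 2 * gnorm R K (T + \<sigma>) (q k))"
proof -
  have "pnorm R K T \<sigma> \<tau> n (pert p q k) \<le> pnorm R K T \<sigma> \<tau> (n + 2) (pert p q k)"
    unfolding pnorm_def using assms by (intro sum_mono2) auto
  also have "\<dots> = (\<Sum>j\<in>{0, 1, 2}. \<tau> ^ j * gnorm R K (if j = 1 then T else T + \<sigma>) (coeff (pert p q k) j))"
    unfolding pnorm_def
    by (rule sum.mono_neutral_right) (auto simp: pert_def coeff_pCons split: nat.splits)
  also have "\<dots> \<le> gnorm R K (T + \<sigma>) (p k) +
    (if k = 1 then \<tau> * gnorm R K T (q k) else \<tau> ^ 2 * gnorm R K (T + \<sigma>) (q k))"
    by (simp add: pert_def numeral_2_eq_2)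
  finally show ?thesis .
qed

text \<open>
  For \<open>\<tau> \<ge> 1\<close> terms of degree at least \<open>2\<close> are at most \<open>\<tau>\<^sup>-\<^sup>2\<close> times the norm of the whole polynomial,
  which is bounded by the product of the norms of its factors. This is the quadratic smallness of the
  remainder.
\<close>

lemma gnorm_prest:
  assumes K: "K \<ge> 0" and \<tau>: "\<tau> \<ge> 1" and \<sigma>: "\<sigma> \<ge> 0"
    and q: "\<And>k t. k < m \<Longrightarrow> gcoeff (q k) t \<noteq> 0 \<Longrightarrow> \<sigma> \<le> Re t"
    and X: "\<And>k. k < m \<Longrightarrow> gnorm R K (T + \<sigma>) (p k) +
      (if k = 1 then \<tau> * gnorm R K T (q k) else \<tau> ^ 2 * gnorm R K (T + \<sigma>) (q k)) \<le> X k"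
  shows "gnorm R K (T + \<sigma>) (prest m p q \<gamma>) \<le> (\<Prod>k<m. X k ^ \<gamma> k) / \<tau> ^ 2"
proof -
  let ?f = "pmon m p q \<gamma>"
  define n where "n = degree ?f"
  have gs: "graded_supp {t. 0 \<le> Re t} {t. \<sigma> \<le> Re t} {t. \<sigma> \<le> Re t} (pert p q k)" if "k < m" for k
    using q[OF that] gcoeff_nonzero_Re_nonneg
    by (auto simp: graded_supp_def pert_def coeff_pCons split: nat.splits if_splits)
  have "\<tau> ^ 2 * gnorm R K (T + \<sigma>) (prest m p q \<gamma>) \<le> \<tau> ^ 2 * (\<Sum>j=2..n. gnorm R K (T + \<sigma>) (coeff ?f j))"
    unfolding prest_def n_def by (intro mult_left_mono gnorm_sum) auto
  also have "\<dots> \<le> (\<Sum>j=2..n. \<tau> ^ j * gnorm R K (if j = 1 then T else T + \<sigma>) (coeff ?f j))"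
    unfolding sum_distrib_left using \<tau>
    by (intro sum_mono) (auto intro!: mult_mono power_increasing)
  also have "\<dots> \<le> pnorm R K T \<sigma> \<tau> n ?f"
    unfolding pnorm_def using \<tau> by (intro sum_mono2) auto
  also have "\<dots> \<le> (\<Prod>k<m. pnorm R K T \<sigma> \<tau> n (pert p q k ^ \<gamma> k))"
    unfolding pmon_def using assms(1-3) gs
    by (intro pnorm_prod graded_supp_power graded_sets_halfplane) auto
  also have "\<dots> \<le> (\<Prod>k<m. X k ^ \<gamma> k)"
  proof (rule prod_mono, safe)
    fix k assume k: "k < m"
    show "0 \<le> pnorm R K T \<sigma> \<tau> n (pert p q k ^ \<gamma> k)" using \<tau> by (intro pnorm_nonneg) auto
    have "pnorm R K T \<sigma> \<tau> n (pert p q k ^ \<gamma> k) \<le> pnorm R K T \<sigma> \<tau> n (pert p q k) ^ \<gamma> k"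
      using assms(1-3) gs[OF k] by (intro pnorm_power) auto
    also have "\<dots> \<le> X k ^ \<gamma> k"
      using pnorm_pert[of \<tau> R K T \<sigma> n p q k] X[OF k] \<tau>
      by (intro power_mono pnorm_nonneg) auto
    finally show "pnorm R K T \<sigma> \<tau> n (pert p q k ^ \<gamma> k) \<le> X k ^ \<gamma> k" .
  qed
  finally show ?thesis using \<tau> by (simp add: field_simps)
qed

lemma gnorm_gmon:
  assumes K: "K \<ge> 0" and X: "\<And>k. k < m \<Longrightarrow> gnorm R K T (p k) \<le> X k"
  shows "gnorm R K T (gmon m p \<gamma>) \<le> (\<Prod>k<m. X k ^ \<gamma> k)"
proof -
  have "gnorm R K T (gmon m p \<gamma>) \<le> (\<Prod>k<m. gnorm R K T (p k ^ \<gamma> k))"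
    unfolding gmon_def by (rule gnorm_prod[OF K])
  also have "\<dots> \<le> (\<Prod>k<m. X k ^ \<gamma> k)"
  proof (rule prod_mono, safe)
    fix k assume k: "k < m"
    have "gnorm R K T (p k) ^ \<gamma> k \<le> X k ^ \<gamma> k" using X[OF k] by (intro power_mono) auto
    with gnorm_power[OF K, of R T "p k" "\<gamma> k"]
    show "gnorm R K T (p k ^ \<gamma> k) \<le> X k ^ \<gamma> k" by simp
  qed simp
  finally show ?thesis .
qed

text \<open>
  Multi-indices in \<open>m\<close> variables with all entries at most \<open>N\<close>. For exponents in a fixed half plane the
  Taylor series of \<open>F\<close> may be replaced by its part with multi-indices in a sufficiently large box.
\<close>

definition box :: "nat \<Rightarrow> nat \<Rightarrow> (nat \<Rightarrow> nat) set" where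
  "box m N = {\<gamma>. (\<forall>k<m. \<gamma> k \<le> N) \<and> (\<forall>k\<ge>m. \<gamma> k = 0)}"

lemma finite_box: "finite (box m N)"
proof -
  have "box m N = {\<alpha>. \<forall>k. (k \<in> {..<m} \<longrightarrow> \<alpha> k \<in> {..N}) \<and> (k \<notin> {..<m} \<longrightarrow> \<alpha> k = 0)}"
    by (auto simp: box_def not_less)
  then show ?thesis by (simp only:) (rule finite_set_of_finite_funs, auto)
qed

lemma sum_box:
  fixes x :: "nat \<Rightarrow> real"
  shows "(\<Sum>\<gamma>\<in>box m N. \<Prod>k<m. x k ^ \<gamma> k) = (\<Prod>k<m. \<Sum>j\<le>N. x k ^ j)"
proof -
  have "(\<Prod>k<m. \<Sum>j\<le>N. x k ^ j) = (\<Sum>g\<in>PiE {..<m} (\<lambda>_. {..N}). \<Prod>k<m. x k ^ g k)"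
    by (rule prod_sum_PiE) auto
  also have "\<dots> = (\<Sum>\<gamma>\<in>box m N. \<Prod>k<m. x k ^ \<gamma> k)"
    by (rule sum.reindex_bij_witness[where i = "\<lambda>\<gamma>. restrict \<gamma> {..<m}" and j = "\<lambda>g k. if k < m then g k else 0"])
      (auto simp: box_def PiE_def extensional_def fun_eq_iff Pi_def)
  finally show ?thesis by simp
qed

lemma sum_box_le:
  fixes x :: "nat \<Rightarrow> real"
  assumes "\<And>k. k < m \<Longrightarrow> 0 \<le> x k" "\<And>k. k < m \<Longrightarrow> x k \<le> 1 / 2"
  shows "(\<Sum>\<gamma>\<in>box m N. \<Prod>k<m. x k ^ \<gamma> k) \<le> 2 ^ m"
proof -
  have geo: "(\<Sum>j\<le>N. (1 / 2 :: real) ^ j) \<le> 2"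
    by (subst sum_gp0) (auto simp: field_simps)
  have "(\<Prod>k<m. \<Sum>j\<le>N. x k ^ j) \<le> (\<Prod>k<m. 2)"
  proof (rule prod_mono, safe)
    fix k assume k: "k < m"
    have "(\<Sum>j\<le>N. x k ^ j) \<le> (\<Sum>j\<le>N. (1 / 2) ^ j)"
      using assms k by (intro sum_mono power_mono) auto
    with geo show "(\<Sum>j\<le>N. x k ^ j) \<le> 2" by linarith
  qed (auto intro!: sum_nonneg simp: assms)
  then show ?thesis by (simp add: sum_box)
qed

text \<open>
  Evaluation of a power series with coefficients subject to Cauchy's estimates, on arguments of norm at
  most \<open>\<rho> / 2\<close>. The bound does not depend on the box.
\<close>

lemma gnorm_scaled_sum_le:
  fixes a :: "(nat \<Rightarrow> nat) \<Rightarrow> complex"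
  assumes a: "\<And>\<gamma>. \<gamma> \<in> box m N \<Longrightarrow> norm (a \<gamma>) \<le> M / (\<Prod>k<m. \<rho> ^ \<gamma> k)"
    and f: "\<And>\<gamma>. gnorm R K T (f \<gamma>) \<le> (\<Prod>k<m. (\<rho> / 2) ^ \<gamma> k) * c"
    and "M \<ge> 0" "\<rho> > 0" "c \<ge> 0"
  shows "gnorm R K T (\<Sum>\<gamma>\<in>box m N. gscale (a \<gamma>) (f \<gamma>)) \<le> M * 2 ^ m * c"
proof -
  have "gnorm R K T (\<Sum>\<gamma>\<in>box m N. gscale (a \<gamma>) (f \<gamma>)) \<le> (\<Sum>\<gamma>\<in>box m N. norm (a \<gamma>) * gnorm R K T (f \<gamma>))"
    using gnorm_sum[of R K T "\<lambda>\<gamma>. gscale (a \<gamma>) (f \<gamma>)"] by (simp add: gnorm_gscale)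
  also have "\<dots> \<le> (\<Sum>\<gamma>\<in>box m N. M * c * (\<Prod>k<m. (1 / 2) ^ \<gamma> k))"
  proof (rule sum_mono)
    fix \<gamma> assume "\<gamma> \<in> box m N"
    then have "norm (a \<gamma>) * gnorm R K T (f \<gamma>) \<le> M / (\<Prod>k<m. \<rho> ^ \<gamma> k) * ((\<Prod>k<m. (\<rho> / 2) ^ \<gamma> k) * c)"
      using assms by (intro mult_mono a f divide_nonneg_nonneg prod_nonneg) auto
    also have "\<dots> = M * c * (\<Prod>k<m. (1 / 2) ^ \<gamma> k)"
      using assms(4) by (simp add: power_divide prod_dividef field_simps)
    finally show "norm (a \<gamma>) * gnorm R K T (f \<gamma>) \<le> M * c * (\<Prod>k<m. (1 / 2) ^ \<gamma> k)" .
  qed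
  also have "\<dots> = M * c * (\<Sum>\<gamma>\<in>box m N. \<Prod>k<m. (1 / 2) ^ \<gamma> k)"
    by (simp add: sum_distrib_left)
  also have "\<dots> \<le> M * c * 2 ^ m"
    using assms by (intro mult_left_mono sum_box_le) auto
  finally show ?thesis by (simp add: mult_ac)
qed

section \<open>A priori bound for the tail of a solution\<close>

text \<open>
  The cone condition with shift \<open>\<kappa>\<close> for linear terms and \<open>2 * \<kappa>\<close> for quadratic terms, imposed on
  exponents of real part less than \<open>T\<close> and \<open>T + \<sigma>\<close> respectively.
\<close>

lemma graded_sets_cone:
  fixes C \<kappa> \<sigma> T :: real
  assumes "\<sigma> \<ge> 0" "C * \<kappa> \<ge> 0"
  shows "graded_sets {t. 0 \<le> Re t \<and> \<bar>Im t\<bar> \<le> C * Re t}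
    {t. \<sigma> \<le> Re t \<and> (T \<le> Re t \<or> \<bar>Im t\<bar> \<le> C * (Re t - \<kappa>))}
    {t. 2 * \<sigma> \<le> Re t \<and> (T + \<sigma> \<le> Re t \<or> \<bar>Im t\<bar> \<le> C * (Re t - 2 * \<kappa>))}"
proof -
  define f where "f x t = C * (Re t - x)" for x t
  define g where "g t = \<bar>Im t\<bar>" for t
  have tri: "g (s + t) \<le> g s + g t" for s t by (simp add: g_def)
  have lin: "f (x + y) (s + t) = f x s + f y t" for s t x y
    by (simp add: f_def algebra_simps)
  have f0: "C * Re t = f 0 t" for t by (simp add: f_def)
  have mono: "f (2 * \<kappa>) t \<le> f \<kappa> t" for t
    using assms(2) by (simp add: f_def algebra_simps)
  define S0 where "S0 = {t. 0 \<le> Re t \<and> g t \<le> f 0 t}"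
  define S1 where "S1 = {t. \<sigma> \<le> Re t \<and> (T \<le> Re t \<or> g t \<le> f \<kappa> t)}"
  define S2 where "S2 = {t. 2 * \<sigma> \<le> Re t \<and> (T + \<sigma> \<le> Re t \<or> g t \<le> f (2 * \<kappa>) t)}"
  have 00: "s + t \<in> S0" if "s \<in> S0" "t \<in> S0" for s t
    using that tri[of s t] lin[of 0 0 s t] by (auto simp: S0_def)
  have 01: "s + t \<in> S1" if "s \<in> S0" "t \<in> S1" for s t
    using that tri[of s t] lin[of 0 \<kappa> s t] by (auto simp: S0_def S1_def)
  have 02: "s + t \<in> S2" if "s \<in> S0" "t \<in> S2" for s t
    using that tri[of s t] lin[of 0 "2 * \<kappa>" s t] by (auto simp: S0_def S2_def)
  have 11: "s + t \<in> S2" if "s \<in> S1" "t \<in> S1" for s t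
    using that tri[of s t] lin[of \<kappa> \<kappa> s t] by (auto simp: S1_def S2_def)
  have 21: "t \<in> S1" if "t \<in> S2" for t
    using that mono[of t] assms(1) by (auto simp: S1_def S2_def)
  have "0 \<in> S0" by (simp add: S0_def g_def f_def)
  then have "graded_sets S0 S1 S2"
    unfolding graded_sets_def using 00 01 02 11 21 by blast
  then show ?thesis unfolding S0_def S1_def S2_def g_def f0[symmetric] by (simp only: f_def)
qed

text \<open>
  The equation for the tail \<open>\<psi>\<close> of a formal solution \<open>P + \<psi>\<close>. The Taylor coefficients of \<open>F\<close> are \<open>a\<close>; the
  last two assumptions express the equation and the asymptotics of the partial derivative with respect to
  \<open>y\<^sub>0\<close>, whose Taylor series has the monomials \<open>\<gamma>\<^sub>1 a\<^sub>\<gamma> y\<^bsup>\<gamma> - e\<^sub>1\<^esup>\<close>. The coordinate \<open>1\<close> is \<open>y\<^sub>0\<close>. The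
  multi-indices are cut off at a box, which is harmless in each half plane of exponents.
\<close>

locale mahler_tail =
  fixes l n :: nat and a :: "(nat \<Rightarrow> nat) \<Rightarrow> complex" and P \<psi> h :: gps
    and A\<^sub>0 \<nu> :: complex and \<sigma> \<delta> M \<rho> :: real
  assumes l: "l \<ge> 2" and A0: "A\<^sub>0 \<noteq> 0" and \<nu>: "\<nu> = 0 \<or> Re \<nu> > 0"
    and \<delta>: "0 < \<delta>" "\<delta> \<le> 1" and \<sigma>: "\<sigma> = 2 * Re \<nu> + 2"
    and P_fin: "finite {t. gcoeff P t \<noteq> 0}" and P_pos: "\<And>t. gcoeff P t \<noteq> 0 \<Longrightarrow> Re t > 0"
    and \<psi>_ord: "\<And>t. gcoeff \<psi> t \<noteq> 0 \<Longrightarrow> \<sigma> + \<delta> \<le> Re t"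
    and M: "M \<ge> 0" and \<rho>: "\<rho> > 0"
    and a_le: "\<And>\<gamma>. norm (a \<gamma>) \<le> M / (\<Prod>k<n+2. \<rho> ^ \<gamma> k)"
    and h_ord: "\<And>t. gcoeff h t \<noteq> 0 \<Longrightarrow> Re \<nu> + \<delta> \<le> Re t"
    and eqn: "\<And>T. \<exists>N0. \<forall>N\<ge>N0. \<forall>t. Re t \<le> T \<longrightarrow>
      gcoeff (\<Sum>\<gamma>\<in>box (n+2) N. gscale (a \<gamma>) (gmon (n+2) (mahler_tuple l (P + \<psi>)) \<gamma>)) t = 0"
    and deriv_eqn: "\<And>T. \<exists>N0. \<forall>N\<ge>N0. \<forall>t. Re t \<le> T \<longrightarrow>
      gcoeff (\<Sum>\<gamma>\<in>box (n+2) N. gscale (a \<gamma> * of_nat (\<gamma> 1))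
        (gmon (n+2) (mahler_tuple l (P + \<psi>)) (\<gamma>(1 := \<gamma> 1 - 1)))) t =
      (if t = \<nu> then A\<^sub>0 else 0) + gcoeff h t"
begin

lemma Re_\<nu>: "Re \<nu> \<ge> 0"
  using \<nu> by auto

text \<open>
  The argument of \<open>F\<close> is split accordingly into \<open>p + q\<close>.
\<close>

definition "p k = mahler_tuple l P k"
definition "q k = (case k of 0 \<Rightarrow> 0 | Suc i \<Rightarrow> (mahler l ^^ i) \<psi>)"

text \<open>
  Sums over the box of size \<open>N\<close>: \<open>FN\<close> is the value of \<open>F\<close> at \<open>p\<close>, \<open>EN\<close> that of its partial derivative with
  respect to \<open>y\<^sub>0\<close>, \<open>RN\<close> collects the terms of degree at least \<open>2\<close> in \<open>\<epsilon>\<close>, and \<open>HN\<close> is \<open>EN\<close> without its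
  leading term \<open>A\<^sub>0 x\<^bsup>\<nu>\<^esup>\<close>.
\<close>

definition "FN N = (\<Sum>\<gamma>\<in>box (n+2) N. gscale (a \<gamma>) (gmon (n+2) p \<gamma>))"
definition "EN N = (\<Sum>\<gamma>\<in>box (n+2) N. gscale (a \<gamma> * of_nat (\<gamma> 1)) (gmon (n+2) p (\<gamma>(1 := \<gamma> 1 - 1))))"
definition "RN N = (\<Sum>\<gamma>\<in>box (n+2) N. gscale (a \<gamma>) (prest (n+2) p q \<gamma>))"
definition "HN N = EN N - gscale A\<^sub>0 (gmonom \<nu>)"

text \<open>
  In the box of size \<open>N\<close> both the equation and the asymptotics of the derivative hold exactly for the
  coefficients at exponents of real part at most \<open>T\<close>.
\<close>

definition "nice T N \<longleftrightarrow> (\<forall>t. Re t \<le> T \<longrightarrow>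
      gcoeff (\<Sum>\<gamma>\<in>box (n+2) N. gscale (a \<gamma>) (gmon (n+2) (mahler_tuple l (P + \<psi>)) \<gamma>)) t = 0 \<and>
      gcoeff (\<Sum>\<gamma>\<in>box (n+2) N. gscale (a \<gamma> * of_nat (\<gamma> 1))
        (gmon (n+2) (mahler_tuple l (P + \<psi>)) (\<gamma>(1 := \<gamma> 1 - 1)))) t =
      (if t = \<nu> then A\<^sub>0 else 0) + gcoeff h t)"

lemma nice_exists: "\<exists>N. nice T N"
proof -
  obtain N1 where N1: "\<forall>N\<ge>N1. \<forall>t. Re t \<le> T \<longrightarrow>
      gcoeff (\<Sum>\<gamma>\<in>box (n+2) N. gscale (a \<gamma>) (gmon (n+2) (mahler_tuple l (P + \<psi>)) \<gamma>)) t = 0"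
    using eqn[of T] by blast
  obtain N2 where N2: "\<forall>N\<ge>N2. \<forall>t. Re t \<le> T \<longrightarrow>
      gcoeff (\<Sum>\<gamma>\<in>box (n+2) N. gscale (a \<gamma> * of_nat (\<gamma> 1))
        (gmon (n+2) (mahler_tuple l (P + \<psi>)) (\<gamma>(1 := \<gamma> 1 - 1)))) t =
      (if t = \<nu> then A\<^sub>0 else 0) + gcoeff h t"
    using deriv_eqn[of T] by blast
  show ?thesis
    unfolding nice_def using N1 N2 by (intro exI[of _ "max N1 N2"]) (simp del: One_nat_def)
qed

lemma tuple_split: "mahler_tuple l (P + \<psi>) = (\<lambda>k. p k + q k)"
  using l by (auto simp: fun_eq_iff mahler_tuple_def p_def q_def mahler_power_add split: nat.split)

lemma q_1: "q 1 = \<psi>"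
  by (simp add: q_def)

lemma q_nonzeroD:
  assumes "gcoeff (q k) t \<noteq> 0"
  obtains s L where "gcoeff \<psi> s \<noteq> 0" "t = of_nat L * s" "L \<ge> 1" "k \<noteq> 1 \<longrightarrow> L \<ge> 2"
proof (cases k)
  case (Suc i)
  then have *: "gcoeff ((mahler l ^^ i) \<psi>) t \<noteq> 0" using assms by (simp add: q_def)
  have "l \<ge> 1" using l by simp
  obtain s where s: "gcoeff \<psi> s \<noteq> 0" "t = of_nat (l ^ i) * s"
    by (rule gcoeff_mahler_power_nonzeroD[OF \<open>l \<ge> 1\<close> *])
  moreover have "l ^ i \<ge> 2" if "k \<noteq> 1"
  proof -
    have "i \<ge> 1" using Suc that by simp
    then have "l ^ 1 \<le> l ^ i" using l by (intro power_increasing) auto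
    then show ?thesis using l by simp
  qed
  ultimately show ?thesis using that[of s "l ^ i"] l by simp
qed (use assms in \<open>simp add: q_def\<close>)

lemma q_ord:
  assumes "gcoeff (q k) t \<noteq> 0"
  shows "Re t \<ge> \<sigma> + \<delta>" "k \<noteq> 1 \<Longrightarrow> Re t \<ge> 2 * (\<sigma> + \<delta>)"
proof -
  obtain s L where s: "gcoeff \<psi> s \<noteq> 0" "t = of_nat L * s" "L \<ge> 1" "k \<noteq> 1 \<longrightarrow> L \<ge> 2"
    using q_nonzeroD[OF assms] .
  have c: "\<sigma> + \<delta> \<le> Re s" "\<sigma> + \<delta> \<ge> 0" using \<psi>_ord[OF s(1)] \<sigma> \<delta> Re_\<nu> by auto
  have "1 * (\<sigma> + \<delta>) \<le> real L * Re s" using s c by (intro mult_mono) auto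
  then show "Re t \<ge> \<sigma> + \<delta>" using s by simp
  assume "k \<noteq> 1"
  then have "2 * (\<sigma> + \<delta>) \<le> real L * Re s" using s c by (intro mult_mono) auto
  then show "Re t \<ge> 2 * (\<sigma> + \<delta>)" using s by simp
qed

text \<open>
  Passing from \<open>P + \<psi>\<close> to \<open>P\<close> does not affect coefficients below the order of \<open>\<psi>\<close>.
\<close>

lemma gcoeff_gmon_tuple:
  assumes "Re t < \<sigma> + \<delta>"
  shows "gcoeff (gmon (n+2) (mahler_tuple l (P + \<psi>)) \<gamma>) t = gcoeff (gmon (n+2) p \<gamma>) t"
proof -
  have pos: "\<sigma> + \<delta> \<ge> 0" using \<sigma> \<delta> Re_\<nu> by auto
  have "gcoeff (of_nat (\<gamma> 1) * gmon (n+2) p (\<gamma>(1 := \<gamma> 1 - 1)) * q 1) t = 0"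
  proof (rule ccontr)
    assume "\<not> ?thesis"
    then obtain s u where "gcoeff (of_nat (\<gamma> 1) * gmon (n+2) p (\<gamma>(1 := \<gamma> 1 - 1))) s \<noteq> 0" "gcoeff (q 1) u \<noteq> 0" "t = s + u"
      by (rule gcoeff_mult_nonzeroD)
    then show False using gcoeff_nonzero_Re_nonneg[of _ s] q_ord(1)[of 1 u] assms by fastforce
  qed
  moreover have "gcoeff (prest (n+2) p q \<gamma>) t = 0"
  proof (rule ccontr)
    assume nz: "\<not> ?thesis"
    have "graded_supp {t. 0 \<le> Re t} {t. \<sigma> + \<delta> \<le> Re t} {t. \<sigma> + \<delta> \<le> Re t} (pmon (n+2) p q \<gamma>)"
      by (rule graded_supp_pmon[OF graded_sets_halfplane])
        (use pos q_ord(1) gcoeff_nonzero_Re_nonneg in auto)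
    from gcoeff_prest_nonzeroD[OF this nz] assms show False by simp
  qed
  ultimately show ?thesis
    unfolding tuple_split by (subst gmon_expand) (simp_all del: One_nat_def)
qed

lemma decomposition:
  "(\<Sum>\<gamma>\<in>box (n+2) N. gscale (a \<gamma>) (gmon (n+2) (mahler_tuple l (P + \<psi>)) \<gamma>)) = FN N + EN N * \<psi> + RN N"
proof -
  have "gscale (a \<gamma>) (gmon (n+2) (mahler_tuple l (P + \<psi>)) \<gamma>) = gscale (a \<gamma>) (gmon (n+2) p \<gamma>) +
      gscale (a \<gamma> * of_nat (\<gamma> 1)) (gmon (n+2) p (\<gamma>(1 := \<gamma> 1 - 1))) * \<psi> + gscale (a \<gamma>) (prest (n+2) p q \<gamma>)" for \<gamma>
    unfolding tuple_split
    by (subst gmon_expand) (simp_all add: gscale_add gscale_mult of_nat_mult_gps gscale_gscale q_1 del: One_nat_def)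
  then show ?thesis by (simp add: sum.distrib FN_def EN_def RN_def sum_distrib_right del: One_nat_def)
qed

lemma HN_ord:
  assumes "nice T N" "T \<ge> \<sigma>" "gcoeff (HN N) t \<noteq> 0"
  shows "Re \<nu> + \<delta> \<le> Re t"
proof (rule ccontr)
  assume c: "\<not> ?thesis"
  have t: "Re t < \<sigma> + \<delta>" "Re t \<le> T" using c assms(2) \<sigma> \<delta> Re_\<nu> by linarith+
  have "gcoeff (EN N) t = gcoeff (\<Sum>\<gamma>\<in>box (n+2) N. gscale (a \<gamma> * of_nat (\<gamma> 1))
        (gmon (n+2) (mahler_tuple l (P + \<psi>)) (\<gamma>(1 := \<gamma> 1 - 1)))) t"
    unfolding EN_def gcoeff_sum gcoeff_gscale gcoeff_gmon_tuple[OF t(1)] ..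
  also have "\<dots> = (if t = \<nu> then A\<^sub>0 else 0) + gcoeff h t"
    using assms(1) t(2) unfolding nice_def by blast
  finally have "gcoeff (HN N) t = gcoeff h t"
    by (simp add: HN_def gcoeff_gmonom[OF \<nu>])
  then show False using assms(3) h_ord c by auto
qed

lemma RN_ord:
  assumes "gcoeff (RN N) t \<noteq> 0"
  shows "2 * (\<sigma> + \<delta>) \<le> Re t"
proof -
  obtain \<gamma> where nz: "gcoeff (prest (n+2) p q \<gamma>) t \<noteq> 0"
    using assms unfolding RN_def gcoeff_sum gcoeff_gscale
    by (metis (no_types, lifting) mult_zero_right sum.not_neutral_contains_not_neutral)
  have pos: "\<sigma> + \<delta> \<ge> 0" using \<sigma> \<delta> Re_\<nu> by auto
  have "graded_supp {t. 0 \<le> Re t} {t. \<sigma> + \<delta> \<le> Re t} {t. 2 * (\<sigma> + \<delta>) \<le> Re t} (pmon (n+2) p q \<gamma>)"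
    by (rule graded_supp_pmon[OF graded_sets_halfplane])
      (use pos q_ord gcoeff_nonzero_Re_nonneg in auto)
  from gcoeff_prest_nonzeroD[OF this nz] show ?thesis by simp
qed

lemma EN_split: "EN N = gscale A\<^sub>0 (gmonom \<nu>) + HN N"
  by (simp add: HN_def)

text \<open>
  The equation solved for the coefficients of \<open>\<psi>\<close>.
\<close>

lemma main_equation:
  assumes "nice T N" "Re (t + \<nu>) \<le> T"
  shows "A\<^sub>0 * gcoeff \<psi> t = - gcoeff (FN N + HN N * \<psi> + RN N) (t + \<nu>)"
proof -
  have "gcoeff (FN N + EN N * \<psi> + RN N) (t + \<nu>) = 0"
    using assms unfolding decomposition[symmetric] nice_def by blast
  moreover have "gcoeff (EN N * \<psi>) (t + \<nu>) = A\<^sub>0 * gcoeff \<psi> t + gcoeff (HN N * \<psi>) (t + \<nu>)"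
    by (simp add: EN_split distrib_right gscale_mult gcoeff_gmonom_mult[OF \<nu>])
  ultimately show ?thesis by (simp add: eq_neg_iff_add_eq_0 algebra_simps)
qed

text \<open>
  The value of \<open>F\<close> at the truncation is of higher order, because the equation expresses it through terms
  containing \<open>\<psi>\<close>.
\<close>

lemma FN_ord:
  assumes "nice T N" "T \<ge> \<sigma>" "Re t \<le> T" "gcoeff (FN N) t \<noteq> 0"
  shows "\<sigma> + Re \<nu> + \<delta> \<le> Re t"
proof -
  have "gcoeff (FN N + EN N * \<psi> + RN N) t = 0"
    using assms unfolding decomposition[symmetric] nice_def by blast
  then have "gcoeff (EN N * \<psi>) t \<noteq> 0 \<or> gcoeff (RN N) t \<noteq> 0" using assms(4) by auto
  then show ?thesis
  proof
    assume "gcoeff (EN N * \<psi>) t \<noteq> 0"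
    then obtain s u where su: "gcoeff (EN N) s \<noteq> 0" "gcoeff \<psi> u \<noteq> 0" "t = s + u"
      by (rule gcoeff_mult_nonzeroD)
    have "Re \<nu> \<le> Re s"
      using su(1) HN_ord[OF assms(1,2), of s] \<delta> by (cases "s = \<nu>") (auto simp: EN_split gcoeff_gmonom[OF \<nu>])
    then show ?thesis using \<psi>_ord[OF su(2)] su(3) by simp
  qed (use RN_ord[of N t] \<sigma> \<delta> Re_\<nu> in auto)
qed

lemma p_nonzeroD:
  assumes "gcoeff (p k) t \<noteq> 0"
  shows "t = 1 \<or> (\<exists>s L. gcoeff P s \<noteq> 0 \<and> t = of_nat L * s \<and> L \<ge> 1)"
proof (cases k)
  case 0
  then show ?thesis using assms by (auto simp: p_def mahler_tuple_def gps_X.rep_eq split: if_splits)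
next
  case (Suc i)
  then have *: "gcoeff ((mahler l ^^ i) P) t \<noteq> 0" using assms by (simp add: p_def mahler_tuple_def)
  have "l \<ge> 1" using l by simp
  obtain s where "gcoeff P s \<noteq> 0" "t = of_nat (l ^ i) * s"
    by (rule gcoeff_mahler_power_nonzeroD[OF \<open>l \<ge> 1\<close> *])
  then show ?thesis using l by (intro disjI2 exI[of _ s] exI[of _ "l ^ i"]) auto
qed

lemma p_pos: "gcoeff (p k) t \<noteq> 0 \<Longrightarrow> Re t > 0"
proof -
  assume "gcoeff (p k) t \<noteq> 0"
  then consider "t = 1" | s L where "gcoeff P s \<noteq> 0" "t = of_nat L * s" "L \<ge> 1" using p_nonzeroD by blast
  then show ?thesis
  proof cases
    case (2 s L)
    then show ?thesis using P_pos[of s] by simp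
  qed simp
qed

lemma p_fin: "finite {t. gcoeff (p k) t \<noteq> 0}"
proof (cases k)
  case 0
  then have "{t. gcoeff (p k) t \<noteq> 0} \<subseteq> {1}"
    by (simp add: p_def mahler_tuple_def gps_X.rep_eq subset_iff)
  then show ?thesis by (rule finite_subset) simp
next
  case (Suc i)
  have "{t. gcoeff (p k) t \<noteq> 0} \<subseteq> (\<lambda>s. of_nat (l ^ i) * s) ` {t. gcoeff P t \<noteq> 0}"
  proof
    fix t assume "t \<in> {t. gcoeff (p k) t \<noteq> 0}"
    then have *: "gcoeff ((mahler l ^^ i) P) t \<noteq> 0" using Suc by (simp add: p_def mahler_tuple_def)
    have "l \<ge> 1" using l by simp
    obtain s where "gcoeff P s \<noteq> 0" "t = of_nat (l ^ i) * s"
      by (rule gcoeff_mahler_power_nonzeroD[OF \<open>l \<ge> 1\<close> *])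
    then show "t \<in> (\<lambda>s. of_nat (l ^ i) * s) ` {t. gcoeff P t \<noteq> 0}" by blast
  qed
  then show ?thesis by (rule finite_subset) (simp add: P_fin)
qed

lemma p_cone: "\<exists>C\<ge>0. \<forall>k t. gcoeff (p k) t \<noteq> 0 \<longrightarrow> \<bar>Im t\<bar> \<le> C * Re t"
proof (intro exI conjI allI impI)
  define C where "C = (\<Sum>t | gcoeff P t \<noteq> 0. \<bar>Im t\<bar> / Re t)"
  have nn: "\<bar>Im t\<bar> / Re t \<ge> 0" if "gcoeff P t \<noteq> 0" for t using P_pos[OF that] by auto
  show C: "C \<ge> 0" unfolding C_def by (intro sum_nonneg) (use nn in auto)
  fix k t assume "gcoeff (p k) t \<noteq> 0"
  then consider "t = 1" | s L where "gcoeff P s \<noteq> 0" "t = of_nat L * s" using p_nonzeroD by blast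
  then show "\<bar>Im t\<bar> \<le> C * Re t"
  proof cases
    case (2 s L)
    have "\<bar>Im s\<bar> / Re s \<le> C" unfolding C_def
      by (rule member_le_sum) (use 2 nn P_fin in auto)
    then have "\<bar>Im s\<bar> \<le> C * Re s" using P_pos[OF 2(1)] by (simp add: field_simps)
    then have "real L * \<bar>Im s\<bar> \<le> real L * (C * Re s)" by (intro mult_left_mono) auto
    then show ?thesis using 2 by (simp add: abs_mult mult_ac)
  qed (use C in auto)
qed

lemma gmon_p_cone:
  assumes C0: "\<And>k t. gcoeff (p k) t \<noteq> 0 \<Longrightarrow> \<bar>Im t\<bar> \<le> C0 * Re t"
    and nz: "gcoeff (gmon m p \<gamma>) t \<noteq> 0"
  shows "\<bar>Im t\<bar> \<le> C0 * Re t"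
proof -
  have "graded_sets {t. \<bar>Im t\<bar> \<le> C0 * Re t} UNIV UNIV"
    by (auto simp: graded_sets_def algebra_simps)
  from graded_supp_pmon[OF this, of m p "\<lambda>_. 0" \<gamma>] C0
  have "graded_supp {t. \<bar>Im t\<bar> \<le> C0 * Re t} UNIV UNIV (pmon m p (\<lambda>_. 0) \<gamma>)" by auto
  then have "gcoeff (coeff (pmon m p (\<lambda>_. 0) \<gamma>) 0) t \<noteq> 0 \<longrightarrow> t \<in> {t. \<bar>Im t\<bar> \<le> C0 * Re t}"
    unfolding graded_supp_def by presburger
  then show ?thesis using nz by (simp add: coeff_pmon_0)
qed

text \<open>
  The exponents of \<open>\<psi>\<close> lie in a cone with apex \<open>Re \<nu> + 1\<close>.
\<close>

lemma cone:
  "\<exists>C\<ge>0. \<forall>t. gcoeff \<psi> t \<noteq> 0 \<longrightarrow> \<bar>Im t\<bar> \<le> C * (Re t - (Re \<nu> + 1))"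
proof -
  obtain C0 where C0: "C0 \<ge> 0" "\<And>k t. gcoeff (p k) t \<noteq> 0 \<Longrightarrow> \<bar>Im t\<bar> \<le> C0 * Re t"
    using p_cone by blast
  define d where "d = Re \<nu>"
  define \<kappa> where "\<kappa> = d + 1"
  have d: "d \<ge> 0" using Re_\<nu> by (simp add: d_def)
  have \<sigma>': "\<sigma> = 2 * \<kappa>" using \<sigma> by (simp add: \<kappa>_def d_def)
  \<comment> \<open>The three cases below need \<open>C \<ge> 4 * C0 + \<bar>Im \<nu>\<bar>\<close>, the last summand, and \<open>C \<ge> \<bar>Im \<nu>\<bar>\<close>.\<close>
  define C where "C = 4 * C0 + \<bar>Im \<nu>\<bar> + (C0 * d + 2 * \<bar>Im \<nu>\<bar>) / \<delta>"
  have X: "(C0 * d + 2 * \<bar>Im \<nu>\<bar>) / \<delta> \<ge> 0" using C0 d \<delta> by auto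
  have C: "C \<ge> 0" "C \<ge> C0" "C \<ge> \<bar>Im \<nu>\<bar>" "C \<ge> 4 * C0 + \<bar>Im \<nu>\<bar>" using X C0(1) by (auto simp: C_def)
  have "\<bar>Im t\<bar> \<le> C * (Re t - \<kappa>)" if "gcoeff \<psi> t \<noteq> 0" for t
  proof (rule ccontr)
    assume bad: "\<not> ?thesis"
    define B where "B = {s. gcoeff \<psi> s \<noteq> 0 \<and> \<not> \<bar>Im s\<bar> \<le> C * (Re s - \<kappa>)}"
    define B' where "B' = {s \<in> B. Re s \<le> Re t}"
    have B': "finite B'" "t \<in> B'"
      using bad that by (auto simp: B'_def B_def intro: finite_subset[OF _ finite_gcoeff[of \<psi> "Re t"]])
    define \<mu> where "\<mu> = arg_min_on Re B'"
    have \<mu>: "\<mu> \<in> B'" "\<And>s. s \<in> B' \<Longrightarrow> Re \<mu> \<le> Re s"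
      using B' arg_min_if_finite(1)[of B' Re] arg_min_least[of B' _ Re] unfolding \<mu>_def by blast+
    have small: "\<bar>Im s\<bar> \<le> C * (Re s - \<kappa>)" if "gcoeff \<psi> s \<noteq> 0" "Re s < Re \<mu>" for s
      using \<mu> that by (force simp: B'_def B_def)
    have \<mu>': "gcoeff \<psi> \<mu> \<noteq> 0" "\<bar>Im \<mu>\<bar> > C * (Re \<mu> - \<kappa>)" using \<mu>(1) by (auto simp: B'_def B_def)
    have R\<mu>: "Re \<mu> \<ge> \<sigma> + \<delta>" using \<psi>_ord[OF \<mu>'(1)] .
    obtain N where N: "nice (max \<sigma> (Re (\<mu> + \<nu>))) N" using nice_exists by blast
    \<comment> \<open>\<open>\<mu>\<close> is a counterexample of minimal real part. One of the three terms below is nonzero.\<close>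
    have "A\<^sub>0 * gcoeff \<psi> \<mu> = - gcoeff (FN N + HN N * \<psi> + RN N) (\<mu> + \<nu>)"
      by (rule main_equation[OF N]) simp
    then have "gcoeff (FN N + HN N * \<psi> + RN N) (\<mu> + \<nu>) \<noteq> 0"
      using A0 \<mu>'(1) by (metis mult_eq_0_iff neg_equal_0_iff_equal)
    then consider "gcoeff (FN N) (\<mu> + \<nu>) \<noteq> 0" | "gcoeff (HN N * \<psi>) (\<mu> + \<nu>) \<noteq> 0" | "gcoeff (RN N) (\<mu> + \<nu>) \<noteq> 0"
      by fastforce
    then have "\<bar>Im \<mu>\<bar> \<le> C * (Re \<mu> - \<kappa>)"
    proof cases
      case 1
      then obtain \<gamma> where "gcoeff (gmon (n+2) p \<gamma>) (\<mu> + \<nu>) \<noteq> 0"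
        unfolding FN_def gcoeff_sum gcoeff_gscale
        by (metis (no_types, lifting) mult_zero_right sum.not_neutral_contains_not_neutral)
      then have "\<bar>Im (\<mu> + \<nu>)\<bar> \<le> C0 * Re (\<mu> + \<nu>)" by (rule gmon_p_cone[rotated]) (rule C0(2))
      then have "\<bar>Im \<mu> + Im \<nu>\<bar> \<le> C0 * (Re \<mu> + d)" by (simp add: d_def)
      moreover have "C0 * (Re \<mu> + d) \<le> C0 * (4 * (Re \<mu> - \<kappa>))"
        using R\<mu> \<sigma>' d \<delta> C0(1) by (intro mult_left_mono) (auto simp: \<kappa>_def)
      moreover have "\<bar>Im \<nu>\<bar> * 1 \<le> \<bar>Im \<nu>\<bar> * (Re \<mu> - \<kappa>)"
        using R\<mu> \<sigma>' d \<delta> by (intro mult_left_mono) (auto simp: \<kappa>_def)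
      moreover have "(4 * C0 + \<bar>Im \<nu>\<bar>) * (Re \<mu> - \<kappa>) \<le> C * (Re \<mu> - \<kappa>)"
        using R\<mu> \<sigma>' d \<delta> C(4) by (intro mult_right_mono) (auto simp: \<kappa>_def)
      ultimately show ?thesis by (simp add: algebra_simps)
    next
      case 2
      then obtain s u where su: "gcoeff (HN N) s \<noteq> 0" "gcoeff \<psi> u \<noteq> 0" "\<mu> + \<nu> = s + u"
        by (rule gcoeff_mult_nonzeroD)
      have Res: "Re s \<ge> d + \<delta>" using HN_ord[OF N _ su(1)] by (simp add: d_def)
      \<comment> \<open>Since \<open>Re s > d\<close>, the exponent \<open>u\<close> has smaller real part than \<open>\<mu>\<close>.\<close>
      have Reu: "Re u = Re \<mu> + d - Re s" and Im\<mu>: "Im \<mu> = Im s + Im u - Im \<nu>"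
        using su(3) by (auto simp: complex_eq_iff d_def)
      have u: "\<bar>Im u\<bar> \<le> C * (Re u - \<kappa>)" using small[OF su(2)] Reu Res \<delta> by simp
      have s: "\<bar>Im s\<bar> \<le> C0 * Re s + \<bar>Im \<nu>\<bar>"
      proof (cases "s = \<nu>")
        case True
        then show ?thesis using C0(1) Res d \<delta> by auto
      next
        case False
        then have "gcoeff (EN N) s \<noteq> 0" using su(1) by (simp add: EN_split gcoeff_gmonom[OF \<nu>])
        then obtain \<gamma> where "gcoeff (gmon (n+2) p (\<gamma>(1 := \<gamma> 1 - 1))) s \<noteq> 0"
          unfolding EN_def gcoeff_sum gcoeff_gscale
          by (metis (no_types, lifting) mult_zero_right sum.not_neutral_contains_not_neutral)
        then have "\<bar>Im s\<bar> \<le> C0 * Re s" by (rule gmon_p_cone[rotated]) (rule C0(2))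
        then show ?thesis by simp
      qed
      have "(C0 * d + 2 * \<bar>Im \<nu>\<bar>) * \<delta> \<le> (C0 * d + 2 * \<bar>Im \<nu>\<bar>) * (Re s - d)"
        using Res C0(1) d by (intro mult_left_mono) auto
      then have "C0 * d + 2 * \<bar>Im \<nu>\<bar> \<le> (C0 * d + 2 * \<bar>Im \<nu>\<bar>) / \<delta> * (Re s - d)"
        using \<delta> by (simp add: field_simps)
      moreover have "(C0 + (C0 * d + 2 * \<bar>Im \<nu>\<bar>) / \<delta>) * (Re s - d) \<le> C * (Re s - d)"
        using Res \<delta> C0(1) by (intro mult_right_mono) (auto simp: C_def)
      ultimately have "C0 * Re s + 2 * \<bar>Im \<nu>\<bar> \<le> C * (Re s - d)"
        by (simp add: algebra_simps)
      moreover have "C * (Re \<mu> - \<kappa>) = C * (Re u - \<kappa>) + C * (Re s - d)" by (simp add: Reu algebra_simps)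
      moreover have "\<bar>Im \<mu>\<bar> \<le> \<bar>Im s\<bar> + \<bar>Im u\<bar> + \<bar>Im \<nu>\<bar>" unfolding Im\<mu> by linarith
      ultimately show ?thesis using u s by linarith
    next
      case 3
      then obtain \<gamma> where nz: "gcoeff (prest (n+2) p q \<gamma>) (\<mu> + \<nu>) \<noteq> 0"
        unfolding RN_def gcoeff_sum gcoeff_gscale
        by (metis (no_types, lifting) mult_zero_right sum.not_neutral_contains_not_neutral)
      \<comment> \<open>Only exponents of \<open>\<psi>\<close> below \<open>\<mu>\<close> can contribute, and subtracting \<open>\<nu>\<close> costs less than the gained shift \<open>\<kappa>\<close>.\<close>
      define S0 where "S0 = {t. 0 \<le> Re t \<and> \<bar>Im t\<bar> \<le> C * Re t}"
      define S1 where "S1 = {t. \<sigma> \<le> Re t \<and> (Re \<mu> \<le> Re t \<or> \<bar>Im t\<bar> \<le> C * (Re t - \<kappa>))}"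
      define S2 where "S2 = {t. 2 * \<sigma> \<le> Re t \<and> (Re \<mu> + \<sigma> \<le> Re t \<or> \<bar>Im t\<bar> \<le> C * (Re t - 2 * \<kappa>))}"
      have "\<sigma> \<ge> 0" "\<kappa> \<ge> 0" "C * \<kappa> \<ge> 0" using \<sigma>' d C(1) by (auto simp: \<kappa>_def)
      then have S: "graded_sets S0 S1 S2"
        unfolding S0_def S1_def S2_def using R\<mu> \<delta> by (intro graded_sets_cone) auto
      have "graded_supp S0 S1 S2 (pmon (n+2) p q \<gamma>)"
      proof (rule graded_supp_pmon[OF S])
        fix k t assume pt: "gcoeff (p k) t \<noteq> 0"
        have "C0 * Re t \<le> C * Re t" by (rule mult_right_mono[OF C(2) less_imp_le[OF p_pos[OF pt]]])
        then have "\<bar>Im t\<bar> \<le> C * Re t" using C0(2)[OF pt] by linarith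
        then show "t \<in> S0" using p_pos[OF pt] by (simp add: S0_def)
      next
        fix k t assume qt: "gcoeff (q k) t \<noteq> 0"
        show "t \<in> (if k = 1 then S1 else S2)"
        proof (cases "k = 1")
          case True
          then have "gcoeff \<psi> t \<noteq> 0" using qt q_1 by simp
          then show ?thesis using small[of t] \<psi>_ord[of t] \<delta> True by (force simp: S1_def)
        next
          case False
          obtain s L where s: "gcoeff \<psi> s \<noteq> 0" "t = of_nat L * s" "L \<ge> 2"
            using q_nonzeroD[OF qt] False by metis
          have Re_s: "Re s \<ge> \<sigma>" using \<psi>_ord[OF s(1)] \<delta> by simp
          have L: "2 * Re s \<le> real L * Re s" using s(3) Re_s \<open>\<sigma> \<ge> 0\<close> by (intro mult_right_mono) auto
          have "Re \<mu> + \<sigma> \<le> Re t \<or> \<bar>Im t\<bar> \<le> C * (Re t - 2 * \<kappa>)"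
          proof (cases "Re \<mu> \<le> Re s")
            case True
            then show ?thesis using L R\<mu> \<delta> s(2) by auto
          next
            case False
            have "real L * \<bar>Im s\<bar> \<le> real L * (C * (Re s - \<kappa>))"
              using small[OF s(1)] False by (intro mult_left_mono) auto
            moreover have "2 * (C * \<kappa>) \<le> real L * (C * \<kappa>)"
              using s(3) \<open>C * \<kappa> \<ge> 0\<close> by (intro mult_right_mono) auto
            ultimately show ?thesis using s(2) by (simp add: abs_mult algebra_simps)
          qed
          then show ?thesis using False L Re_s s(2) by (simp add: S2_def)
        qed
      qed
      from gcoeff_prest_nonzeroD[OF this nz] have "\<mu> + \<nu> \<in> S2" .
      moreover have "Re \<nu> < \<sigma>" using \<sigma> Re_\<nu> by simp
      ultimately have "\<bar>Im \<mu> + Im \<nu>\<bar> \<le> C * (Re \<mu> + d - 2 * \<kappa>)" by (auto simp: S2_def d_def)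
      moreover have "C * (Re \<mu> + d - 2 * \<kappa>) = C * (Re \<mu> - \<kappa>) - C" by (simp add: \<kappa>_def algebra_simps)
      ultimately show ?thesis using C(3) by linarith
    qed
    then show False using \<mu>'(2) by simp
  qed
  then show ?thesis using C(1) by (auto simp: \<kappa>_def d_def)
qed


lemma gnorm_p_eventually:
  assumes "\<epsilon> > 0"
  shows "\<forall>\<^sub>F R in at_top. \<forall>k<m. \<forall>T. gnorm R K T (p k) \<le> \<epsilon>"
proof -
  have "\<forall>\<^sub>F R in at_top. \<forall>T. gnorm R K T (p k) \<le> \<epsilon>" for k
  proof -
    have "((\<lambda>R. wt R K t) \<longlongrightarrow> 0) at_top" if "gcoeff (p k) t \<noteq> 0" for t
    proof -
      have "Re t > 0" using p_pos[OF that] .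
      then have "filterlim (\<lambda>R. - R * Re t + K * \<bar>Im t\<bar>) at_bot at_top" by real_asymp
      then show ?thesis unfolding wt_def by (rule filterlim_compose[OF exp_at_bot])
    qed
    then have "((\<lambda>R. \<Sum>t | gcoeff (p k) t \<noteq> 0. norm (gcoeff (p k) t) * wt R K t) \<longlongrightarrow>
        (\<Sum>t | gcoeff (p k) t \<noteq> 0. norm (gcoeff (p k) t) * 0)) at_top"
      by (intro tendsto_sum tendsto_mult tendsto_const) auto
    then have "\<forall>\<^sub>F R in at_top. (\<Sum>t | gcoeff (p k) t \<noteq> 0. norm (gcoeff (p k) t) * wt R K t) < \<epsilon>"
      using assms by (intro order_tendstoD(2)) auto
    then show ?thesis
    proof eventually_elim
      case (elim R)
      have "gnorm R K T (p k) \<le> (\<Sum>t | gcoeff (p k) t \<noteq> 0. norm (gcoeff (p k) t) * wt R K t)" for T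
        unfolding gnorm_def by (rule sum_mono2) (auto simp: p_fin)
      with elim show ?case by (meson less_imp_le order_trans)
    qed
  qed
  then have "\<forall>\<^sub>F R in at_top. \<forall>k\<in>{..<m}. \<forall>T. gnorm R K T (p k) \<le> \<epsilon>"
    by (intro eventually_ball_finite) auto
  then show ?thesis by eventually_elim auto
qed

text \<open>
  In the cone, weights of large exponents are small, so \<open>\<mu>\<^sup>i\<psi>\<close> with \<open>i \<ge> 1\<close> is small relative to \<open>\<psi>\<close>. As
  \<open>T \<ge> \<sigma>\<close>, its truncation at \<open>T + \<sigma>\<close> involves \<open>\<psi>\<close> only up to \<open>T\<close>.
\<close>

lemma gnorm_q_le:
  assumes C: "C \<ge> 0" "\<And>t. gcoeff \<psi> t \<noteq> 0 \<Longrightarrow> \<bar>Im t\<bar> \<le> C * Re t"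
    and K: "K \<ge> 0" and R: "R \<ge> K * C" and T: "T \<ge> \<sigma>" and k: "k \<noteq> 1"
  shows "gnorm R K (T + \<sigma>) (q k) \<le> exp (- (R - K * C) * \<sigma>) * gnorm R K T \<psi>"
proof (cases k)
  case (Suc i)
  define L where "L = l ^ i"
  have "i \<ge> 1" using Suc k by simp
  then have "l ^ 1 \<le> l ^ i" using l by (intro power_increasing) auto
  then have L: "L \<ge> 2" using l by (simp add: L_def)
  have \<sigma>0: "\<sigma> \<ge> 0" using \<sigma> Re_\<nu> by simp
  have l1: "l \<ge> 1" using l by simp
  let ?S = "{t. gcoeff \<psi> t \<noteq> 0 \<and> Re t \<le> T}"
  have qk: "q k = (mahler l ^^ i) \<psi>" using Suc by (simp add: q_def)
  have coeff: "gcoeff (q k) (of_nat L * t) = gcoeff \<psi> t" for t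
    unfolding qk gcoeff_mahler_power[OF l1] using L by (simp add: L_def[symmetric])
  have sub: "{t. gcoeff (q k) t \<noteq> 0 \<and> Re t \<le> T + \<sigma>} \<subseteq> (\<lambda>t. of_nat L * t) ` ?S"
  proof
    fix t assume t: "t \<in> {t. gcoeff (q k) t \<noteq> 0 \<and> Re t \<le> T + \<sigma>}"
    then have "gcoeff ((mahler l ^^ i) \<psi>) t \<noteq> 0" by (simp add: qk)
    then obtain s where s: "gcoeff \<psi> s \<noteq> 0" "t = of_nat L * s"
      unfolding L_def by (rule gcoeff_mahler_power_nonzeroD[OF l1])
    have "Re s \<ge> 0" using \<psi>_ord[OF s(1)] \<sigma>0 \<delta> by simp
    then have "2 * Re s \<le> real L * Re s" using L by (intro mult_right_mono) auto
    then show "t \<in> (\<lambda>t. of_nat L * t) ` ?S" using t s T by auto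
  qed
  have "gnorm R K (T + \<sigma>) (q k) \<le> (\<Sum>t\<in>(\<lambda>t. of_nat L * t) ` ?S. norm (gcoeff (q k) t) * wt R K t)"
    unfolding gnorm_def by (rule sum_mono2[OF _ sub]) (auto simp: finite_gcoeff)
  also have "\<dots> = (\<Sum>t\<in>?S. norm (gcoeff \<psi> t) * wt R K (of_nat L * t))"
    using L by (subst sum.reindex) (auto simp: inj_on_def coeff)
  also have "\<dots> \<le> (\<Sum>t\<in>?S. exp (- (R - K * C) * \<sigma>) * (norm (gcoeff \<psi> t) * wt R K t))"
  proof (rule sum_mono)
    fix t assume "t \<in> ?S"
    then have t: "\<bar>Im t\<bar> \<le> C * Re t" "\<sigma> \<le> Re t" using C(2) \<psi>_ord[of t] \<delta> by auto
    define e where "e = - R * Re t + K * \<bar>Im t\<bar>"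
    have "K * \<bar>Im t\<bar> \<le> K * (C * Re t)" using t K by (intro mult_left_mono) auto
    then have "e \<le> - (R - K * C) * Re t" by (simp add: e_def algebra_simps)
    also have "\<dots> \<le> - (R - K * C) * \<sigma>" using t R by (intro mult_left_mono_neg) auto
    finally have e: "e \<le> - (R - K * C) * \<sigma>" .
    moreover have "(R - K * C) * \<sigma> \<ge> 0" using R \<sigma>0 by simp
    ultimately have "e \<le> 0" by (simp add: algebra_simps)
    then have "(real L - 1) * e \<le> 1 * e" using L by (intro mult_right_mono_neg) auto
    then have "real L * e \<le> - (R - K * C) * \<sigma> + e" using e by (simp add: algebra_simps)
    then have "wt R K (of_nat L * t) \<le> exp (- (R - K * C) * \<sigma>) * wt R K t"
      by (simp add: wt_def e_def abs_mult algebra_simps flip: exp_add)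
    then show "norm (gcoeff \<psi> t) * wt R K (of_nat L * t) \<le> exp (- (R - K * C) * \<sigma>) * (norm (gcoeff \<psi> t) * wt R K t)"
      using mult_left_mono[of _ _ "norm (gcoeff \<psi> t)"] by (fastforce simp: mult_ac)
  qed
  also have "\<dots> = exp (- (R - K * C) * \<sigma>) * gnorm R K T \<psi>"
    by (simp add: gnorm_def sum_distrib_left)
  finally show ?thesis .
qed (simp add: q_def)

text \<open>
  The a priori estimate: the bound \<open>1\<close> improves itself to \<open>1 / 2\<close>, from a value of \<open>R\<close> on that does not
  depend on the truncation \<open>T\<close>.
\<close>

lemma bootstrap:
  assumes K: "K \<ge> 0"
  shows "\<exists>R1. \<forall>R\<ge>R1. \<forall>T\<ge>\<sigma>. exp (R * \<sigma>) * gnorm R K T \<psi> \<le> 1 \<longrightarrow> exp (R * \<sigma>) * gnorm R K T \<psi> \<le> 1 / 2"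
proof -
  define m where "m = n + 2"
  define d where "d = Re \<nu>"
  have d: "d \<ge> 0" "\<sigma> \<ge> d + 1" using Re_\<nu> \<sigma> by (auto simp: d_def)
  obtain C' where C': "C' \<ge> 0" "\<And>t. gcoeff \<psi> t \<noteq> 0 \<Longrightarrow> \<bar>Im t\<bar> \<le> C' * (Re t - (Re \<nu> + 1))"
    using cone by blast
  have C: "\<bar>Im t\<bar> \<le> C' * Re t" if "gcoeff \<psi> t \<noteq> 0" for t
  proof -
    have "C' * (Re t - (Re \<nu> + 1)) \<le> C' * Re t" using C'(1) Re_\<nu> by (intro mult_left_mono) auto
    then show ?thesis using C'(2)[OF that] by simp
  qed
  have "\<forall>\<^sub>F R in at_top. \<forall>k<m. \<forall>T. gnorm R K T (p k) \<le> \<rho> / 4"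
    using \<rho> by (intro gnorm_p_eventually) auto
  then obtain R0 where R0: "\<And>R k T. R \<ge> R0 \<Longrightarrow> k < m \<Longrightarrow> gnorm R K T (p k) \<le> \<rho> / 4"
    unfolding eventually_at_top_linorder by blast
  \<comment> \<open>With \<open>\<tau> = c * exp (R * \<sigma>)\<close> the perturbed arguments have norm at most \<open>\<rho> / 2\<close>.\<close>
  define c where "c = min 1 (\<rho> / 4 * exp (- K * C' * \<sigma>))"
  have KC: "K * C' * \<sigma> \<ge> 0" using K C'(1) d by simp
  have c: "c > 0" "c \<le> 1" "c \<le> \<rho> / 4" "c ^ 2 * exp (K * C' * \<sigma>) \<le> \<rho> / 4"
  proof -
    show "c > 0" "c \<le> 1" using \<rho> by (auto simp: c_def)
    have c1: "c \<le> \<rho> / 4 * exp (- K * C' * \<sigma>)" by (simp add: c_def)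
    also have "\<dots> \<le> \<rho> / 4 * 1" using \<rho> KC by (intro mult_left_mono) auto
    finally show "c \<le> \<rho> / 4" by simp
    have "c ^ 2 * exp (K * C' * \<sigma>) \<le> (1 * c) * exp (K * C' * \<sigma>)"
      unfolding power2_eq_square using \<open>c > 0\<close> \<open>c \<le> 1\<close> by (intro mult_right_mono) auto
    also have "\<dots> \<le> \<rho> / 4 * exp (- K * C' * \<sigma>) * exp (K * C' * \<sigma>)"
      using c1 by (intro mult_right_mono) auto
    also have "\<dots> = \<rho> / 4" by (simp add: mult.assoc flip: exp_add)
    finally show "c ^ 2 * exp (K * C' * \<sigma>) \<le> \<rho> / 4" .
  qed
  \<comment> \<open>\<open>C2\<close> bounds the norm of \<open>HN N\<close> at \<open>R0\<close>, and \<open>X * exp (- R * \<delta>)\<close> will bound \<open>\<bar>A\<^sub>0\<bar> * b\<close>.\<close>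
  define C2 where "C2 = M * 2 ^ m * (4 / \<rho>) + norm A\<^sub>0 * wt R0 K \<nu>"
  define X where "X = exp (K * \<bar>Im \<nu>\<bar>) * (M * 2 ^ m * exp (R0 * (\<sigma> + d + \<delta>)) + C2 * exp (R0 * (d + \<delta>)) + M * 2 ^ m / c ^ 2)"
  have "((\<lambda>R. exp (- R * \<delta>)) \<longlongrightarrow> 0) at_top" using \<delta> by real_asymp
  then have "((\<lambda>R. X * exp (- R * \<delta>)) \<longlongrightarrow> 0) at_top" by (rule tendsto_mult_right_zero)
  then have "\<forall>\<^sub>F R in at_top. X * exp (- R * \<delta>) < norm A\<^sub>0 / 2" using A0 by (intro order_tendstoD) auto
  moreover have "filterlim (\<lambda>R. c * exp (R * \<sigma>)) at_top at_top" using c d by real_asymp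
  then have "\<forall>\<^sub>F R in at_top. 1 \<le> c * exp (R * \<sigma>)" by (simp add: filterlim_at_top)
  ultimately have "\<forall>\<^sub>F R in at_top. X * exp (- R * \<delta>) < norm A\<^sub>0 / 2 \<and> 1 \<le> c * exp (R * \<sigma>) \<and>
      R \<ge> max 0 (max R0 (K * C'))"
    using eventually_ge_at_top[of "max 0 (max R0 (K * C'))"] by eventually_elim auto
  then obtain R1 where R1: "\<And>R. R \<ge> R1 \<Longrightarrow> X * exp (- R * \<delta>) < norm A\<^sub>0 / 2 \<and> 1 \<le> c * exp (R * \<sigma>) \<and>
      R \<ge> max 0 (max R0 (K * C'))"
    unfolding eventually_at_top_linorder by blast
  show ?thesis
  proof (intro exI allI impI)
    fix R T assume "R \<ge> R1" and T: "T \<ge> \<sigma>" and le: "exp (R * \<sigma>) * gnorm R K T \<psi> \<le> 1"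
    then have R: "X * exp (- R * \<delta>) < norm A\<^sub>0 / 2" "1 \<le> c * exp (R * \<sigma>)" "R \<ge> 0" "R \<ge> R0" "R \<ge> K * C'"
      using R1[of R] by auto
    define s where "s = gnorm R K T \<psi>"
    define \<tau> where "\<tau> = c * exp (R * \<sigma>)"
    define b where "b = exp (R * \<sigma>) * s"
    have s: "s \<ge> 0" and b: "b \<ge> 0" "b \<le> 1" using le by (auto simp: s_def b_def)
    have sb: "s = exp (- R * \<sigma>) * b" by (simp add: b_def flip: exp_add mult.assoc)
    obtain N where N: "nice (T + \<sigma>) N" using nice_exists by blast
    have T\<sigma>: "T + \<sigma> \<ge> \<sigma>" using T d by simp
    have cM: "M * 2 ^ m \<ge> 0" using M by simp

    have FN0: "gnorm R0 K T' (FN N) \<le> M * 2 ^ m" for T'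
    proof -
      have "gnorm R0 K T' (FN N) \<le> M * 2 ^ m * 1"
        unfolding FN_def m_def
      proof (rule gnorm_scaled_sum_le)
        fix \<gamma>
        have "gnorm R0 K T' (gmon (n + 2) p \<gamma>) \<le> (\<Prod>k<n+2. (\<rho> / 4) ^ \<gamma> k)"
          by (rule gnorm_gmon[OF K]) (use R0[of R0] in \<open>auto simp: m_def\<close>)
        also have "\<dots> \<le> (\<Prod>k<n+2. (\<rho> / 2) ^ \<gamma> k)" using \<rho> by (intro prod_mono) (auto intro!: power_mono)
        finally show "gnorm R0 K T' (gmon (n + 2) p \<gamma>) \<le> (\<Prod>k<n+2. (\<rho> / 2) ^ \<gamma> k) * 1" by simp
      qed (use a_le M \<rho> in auto)
      then show ?thesis by simp
    qed
    have EN0: "gnorm R0 K T' (EN N) \<le> M * 2 ^ m * (4 / \<rho>)" for T'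
    proof -
      have EN_eq: "EN N = (\<Sum>\<gamma>\<in>box (n+2) N. gscale (a \<gamma>) (gscale (of_nat (\<gamma> 1)) (gmon (n+2) p (\<gamma>(1 := \<gamma> 1 - 1)))))"
        by (simp add: EN_def gscale_gscale del: One_nat_def)
      show ?thesis
        unfolding EN_eq m_def
      proof (rule gnorm_scaled_sum_le)
        fix \<gamma> :: "nat \<Rightarrow> nat"
        let ?f = "gmon (n+2) p (\<gamma>(1 := \<gamma> 1 - 1))"
        show "gnorm R0 K T' (gscale (of_nat (\<gamma> 1)) ?f) \<le> (\<Prod>k<n+2. (\<rho> / 2) ^ \<gamma> k) * (4 / \<rho>)"
        proof (cases "\<gamma> 1 = 0")
          case True
          then show ?thesis using \<rho> by (simp add: gnorm_gscale prod_nonneg del: One_nat_def)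
        next
          case False
          have "gnorm R0 K T' ?f \<le> (\<Prod>k<n+2. (\<rho> / 4) ^ (\<gamma>(1 := \<gamma> 1 - 1)) k)"
            by (rule gnorm_gmon[OF K]) (use R0[of R0] in \<open>auto simp: m_def\<close>)
          also have "\<dots> = (\<rho> / 4) ^ (\<gamma> 1 - 1) * (\<Prod>k\<in>{..<n+2} - {1}. (\<rho> / 4) ^ \<gamma> k)"
            by (subst prod.remove[of _ 1]) auto
          also have "(\<rho> / 4) ^ (\<gamma> 1 - 1) = (4 / \<rho>) * (\<rho> / 4) ^ \<gamma> 1"
            using False \<rho> by (cases "\<gamma> 1") (auto simp: field_simps)
          also have "\<dots> * (\<Prod>k\<in>{..<n+2} - {1}. (\<rho> / 4) ^ \<gamma> k) = (4 / \<rho>) * (\<Prod>k<n+2. (\<rho> / 4) ^ \<gamma> k)"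
            by (subst (2) prod.remove[of _ 1]) auto
          finally have 1: "gnorm R0 K T' ?f \<le> (4 / \<rho>) * (\<Prod>k<n+2. (\<rho> / 4) ^ \<gamma> k)" .
          \<comment> \<open>The factor \<open>\<gamma> 1\<close> is absorbed by passing from \<open>\<rho> / 4\<close> to \<open>\<rho> / 2\<close>.\<close>
          have "real (\<gamma> 1) \<le> 2 ^ \<gamma> 1" by (simp add: less_imp_le of_nat_less_two_power)
          also have "(2 :: real) ^ \<gamma> 1 = (\<Prod>k\<in>{1}. 2 ^ \<gamma> k)" by simp
          also have "\<dots> \<le> (\<Prod>k<n+2. 2 ^ \<gamma> k)"
            by (rule prod_mono2) auto
          finally have "real (\<gamma> 1) * gnorm R0 K T' ?f \<le> (\<Prod>k<n+2. 2 ^ \<gamma> k) * ((4 / \<rho>) * (\<Prod>k<n+2. (\<rho> / 4) ^ \<gamma> k))"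
            using 1 by (intro mult_mono) (auto intro!: prod_nonneg)
          also have "\<dots> = (\<Prod>k<n+2. 2 ^ \<gamma> k * (\<rho> / 4) ^ \<gamma> k) * (4 / \<rho>)"
            by (simp only: prod.distrib mult_ac)
          also have "(\<Prod>k<n+2. 2 ^ \<gamma> k * (\<rho> / 4) ^ \<gamma> k) = (\<Prod>k<n+2. (\<rho> / 2) ^ \<gamma> k)"
            by (simp add: power_mult_distrib[symmetric] del: power_divide)
          finally show ?thesis unfolding gnorm_gscale norm_of_nat .
        qed
      qed (use a_le M \<rho> in auto)
    qed
    have HN0: "gnorm R0 K T' (HN N) \<le> C2" for T'
    proof -
      have "gnorm R0 K T' (gmonom \<nu>) \<le> (\<Sum>t\<in>{\<nu>}. norm (gcoeff (gmonom \<nu>) t) * wt R0 K t)"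
        unfolding gnorm_def by (rule sum_mono2) (auto simp: gcoeff_gmonom[OF \<nu>] split: if_splits)
      then have "gnorm R0 K T' (gmonom \<nu>) \<le> wt R0 K \<nu>" by (simp add: gcoeff_gmonom[OF \<nu>])
      then have "norm A\<^sub>0 * gnorm R0 K T' (gmonom \<nu>) \<le> norm A\<^sub>0 * wt R0 K \<nu>" by (intro mult_left_mono) auto
      moreover have "HN N = EN N + gscale (- A\<^sub>0) (gmonom \<nu>)"
        by (rule gps_eqI) (simp add: HN_def)
      ultimately show ?thesis
        using gnorm_add[of R0 K T' "EN N" "gscale (- A\<^sub>0) (gmonom \<nu>)"] EN0[of T'] by (simp add: gnorm_gscale C2_def)
    qed

    have B1: "gnorm R K (T + d) (FN N) \<le> exp (- (R - R0) * (\<sigma> + d + \<delta>)) * (M * 2 ^ m)"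
    proof -
      have "gnorm R K (T + d) (FN N) \<le> exp (- (R - R0) * (\<sigma> + d + \<delta>)) * gnorm R0 K (T + d) (FN N)"
      proof (rule gnorm_change_radius[OF R(4)])
        fix t assume "gcoeff (FN N) t \<noteq> 0" "Re t \<le> T + d"
        then show "\<sigma> + d + \<delta> \<le> Re t" using FN_ord[OF N T\<sigma>, of t] d by (simp add: d_def)
      qed
      also have "\<dots> \<le> exp (- (R - R0) * (\<sigma> + d + \<delta>)) * (M * 2 ^ m)" by (intro mult_left_mono FN0) auto
      finally show ?thesis .
    qed
    have B2: "gnorm R K (T + d) (HN N * \<psi>) \<le> exp (- (R - R0) * (d + \<delta>)) * C2 * s"
    proof -
      have "gnorm R K (T + d) (HN N * \<psi>) \<le> gnorm R K (T + d) (HN N) * gnorm R K T \<psi>"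
      proof (rule gnorm_mult[OF K])
        fix u t assume "gcoeff (HN N) u \<noteq> 0" "gcoeff \<psi> t \<noteq> 0" "Re u + Re t \<le> T + d"
        then show "Re u \<le> T + d \<and> Re t \<le> T"
          using HN_ord[OF N T\<sigma>, of u] \<psi>_ord[of t] \<delta> d by (simp add: d_def)
      qed
      also have "\<dots> \<le> (exp (- (R - R0) * (d + \<delta>)) * C2) * s"
        unfolding s_def
      proof (intro mult_right_mono)
        have "gnorm R K (T + d) (HN N) \<le> exp (- (R - R0) * (d + \<delta>)) * gnorm R0 K (T + d) (HN N)"
          by (rule gnorm_change_radius[OF R(4)]) (use HN_ord[OF N T\<sigma>] in \<open>auto simp: d_def\<close>)
        also have "\<dots> \<le> exp (- (R - R0) * (d + \<delta>)) * C2" by (intro mult_left_mono HN0) auto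
        finally show "gnorm R K (T + d) (HN N) \<le> exp (- (R - R0) * (d + \<delta>)) * C2" .
      qed simp
      finally show ?thesis .
    qed
    have B3: "gnorm R K (T + d) (RN N) \<le> M * 2 ^ m * (1 / \<tau> ^ 2)"
    proof -
      have "gnorm R K (T + d) (RN N) \<le> gnorm R K (T + \<sigma>) (RN N)" using d by (intro gnorm_mono) auto
      also have "\<dots> \<le> M * 2 ^ m * (1 / \<tau> ^ 2)"
        unfolding RN_def m_def
      proof (rule gnorm_scaled_sum_le)
        fix \<gamma>
        have "gnorm R K (T + \<sigma>) (prest (n + 2) p q \<gamma>) \<le> (\<Prod>k<n+2. (\<rho> / 2) ^ \<gamma> k) / \<tau> ^ 2"
        proof (rule gnorm_prest[OF K])
          show "1 \<le> \<tau>" "0 \<le> \<sigma>" using R(2) d by (auto simp: \<tau>_def)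
          show "\<sigma> \<le> Re t" if "gcoeff (q k) t \<noteq> 0" for k t using q_ord(1)[OF that] \<delta> by simp
          fix k assume k: "k < n + 2"
          have "gnorm R K (T + \<sigma>) (p k) \<le> \<rho> / 4" using R0[OF R(4), of k] k by (simp add: m_def)
          moreover have "\<tau> * gnorm R K T (q 1) \<le> \<rho> / 4"
          proof -
            have "\<tau> * gnorm R K T (q 1) = c * b" by (simp add: \<tau>_def b_def s_def q_1 del: One_nat_def)
            also have "\<dots> \<le> c * 1" using b c by (intro mult_left_mono) auto
            finally show ?thesis using c by simp
          qed
          moreover have "\<tau> ^ 2 * gnorm R K (T + \<sigma>) (q k) \<le> \<rho> / 4" if "k \<noteq> 1"
          proof -
            have "\<tau> ^ 2 * gnorm R K (T + \<sigma>) (q k) \<le> \<tau> ^ 2 * (exp (- (R - K * C') * \<sigma>) * s)"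
              unfolding s_def by (intro mult_left_mono gnorm_q_le C C' K R T that) auto
            also have "\<dots> = c ^ 2 * exp (K * C' * \<sigma>) * b"
              unfolding sb \<tau>_def by (simp add: power_mult_distrib algebra_simps flip: exp_add exp_of_nat_mult)
            also have "\<dots> \<le> c ^ 2 * exp (K * C' * \<sigma>) * 1" using b by (intro mult_left_mono) auto
            finally show ?thesis using c by simp
          qed
          ultimately show "gnorm R K (T + \<sigma>) (p k) + (if k = 1 then \<tau> * gnorm R K T (q k)
              else \<tau> ^ 2 * gnorm R K (T + \<sigma>) (q k)) \<le> \<rho> / 2" by auto
        qed
        then show "gnorm R K (T + \<sigma>) (prest (n + 2) p q \<gamma>) \<le> (\<Prod>k<n+2. (\<rho> / 2) ^ \<gamma> k) * (1 / \<tau> ^ 2)" by simp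
      qed (use a_le M \<rho> in auto)
      finally show ?thesis .
    qed
    let ?Z = "FN N + HN N * \<psi> + RN N"
    have "norm A\<^sub>0 * s \<le> wt R K (- \<nu>) * gnorm R K (T + d) ?Z"
      unfolding s_def d_def
    proof (rule gnorm_shift[OF K])
      fix t assume "Re t \<le> T"
      then show "A\<^sub>0 * gcoeff \<psi> t = - gcoeff ?Z (t + \<nu>)"
        using d by (intro main_equation[OF N]) (auto simp: d_def)
    qed
    also have "gnorm R K (T + d) ?Z \<le> gnorm R K (T + d) (FN N) + gnorm R K (T + d) (HN N * \<psi>) + gnorm R K (T + d) (RN N)"
      using gnorm_add[of R K "T + d" "FN N + HN N * \<psi>" "RN N"] gnorm_add[of R K "T + d" "FN N" "HN N * \<psi>"] by simp
    also have "\<dots> \<le> exp (- (R - R0) * (\<sigma> + d + \<delta>)) * (M * 2 ^ m) + exp (- (R - R0) * (d + \<delta>)) * C2 * s + M * 2 ^ m * (1 / \<tau> ^ 2)"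
      by (intro add_mono B1 B2 B3)
    finally have "norm A\<^sub>0 * s \<le> wt R K (- \<nu>) * (exp (- (R - R0) * (\<sigma> + d + \<delta>)) * (M * 2 ^ m) +
        exp (- (R - R0) * (d + \<delta>)) * C2 * s + M * 2 ^ m * (1 / \<tau> ^ 2))" by simp
    then have "exp (R * \<sigma>) * (norm A\<^sub>0 * s) \<le> exp (R * \<sigma>) * (wt R K (- \<nu>) * (exp (- (R - R0) * (\<sigma> + d + \<delta>)) * (M * 2 ^ m) +
        exp (- (R - R0) * (d + \<delta>)) * C2 * s + M * 2 ^ m * (1 / \<tau> ^ 2)))"
      by (intro mult_left_mono) auto
    also have "exp (R * \<sigma>) * (wt R K (- \<nu>) * (exp (- (R - R0) * (\<sigma> + d + \<delta>)) * (M * 2 ^ m) +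
        exp (- (R - R0) * (d + \<delta>)) * C2 * s + M * 2 ^ m * (1 / \<tau> ^ 2))) =
      exp (K * \<bar>Im \<nu>\<bar>) * (M * 2 ^ m * exp (R0 * (\<sigma> + d + \<delta>)) * exp (- R * \<delta>) +
        C2 * exp (R0 * (d + \<delta>)) * exp (- R * \<delta>) * b + M * 2 ^ m / c ^ 2 * exp (- R * (\<sigma> - d)))"
    proof -
      have 1: "exp (R * \<sigma>) * wt R K (- \<nu>) * exp (- (R - R0) * (\<sigma> + d + \<delta>)) =
          exp (K * \<bar>Im \<nu>\<bar>) * exp (R0 * (\<sigma> + d + \<delta>)) * exp (- R * \<delta>)"
        unfolding wt_def d_def exp_add[symmetric] by (simp add: algebra_simps)
      have 2: "wt R K (- \<nu>) * exp (- (R - R0) * (d + \<delta>)) = exp (K * \<bar>Im \<nu>\<bar>) * exp (R0 * (d + \<delta>)) * exp (- R * \<delta>)"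
        unfolding wt_def d_def exp_add[symmetric] by (simp add: algebra_simps)
      have "1 / \<tau> ^ 2 = exp (- 2 * R * \<sigma>) / c ^ 2"
        by (simp add: \<tau>_def power_mult_distrib exp_minus field_simps flip: exp_of_nat_mult)
      then have 3: "exp (R * \<sigma>) * wt R K (- \<nu>) * (1 / \<tau> ^ 2) = exp (K * \<bar>Im \<nu>\<bar>) * exp (- R * (\<sigma> - d)) / c ^ 2"
        unfolding wt_def d_def by (simp add: algebra_simps flip: exp_add)
      have "exp (R * \<sigma>) * (wt R K (- \<nu>) * (exp (- (R - R0) * (\<sigma> + d + \<delta>)) * (M * 2 ^ m) +
        exp (- (R - R0) * (d + \<delta>)) * C2 * s + M * 2 ^ m * (1 / \<tau> ^ 2))) =
        (exp (R * \<sigma>) * wt R K (- \<nu>) * exp (- (R - R0) * (\<sigma> + d + \<delta>))) * (M * 2 ^ m) +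
        (wt R K (- \<nu>) * exp (- (R - R0) * (d + \<delta>))) * C2 * (exp (R * \<sigma>) * s) +
        (exp (R * \<sigma>) * wt R K (- \<nu>) * (1 / \<tau> ^ 2)) * (M * 2 ^ m)"
        by (simp only: distrib_left mult_ac)
      then show ?thesis unfolding 1 2 3 b_def[symmetric] by (simp add: algebra_simps)
    qed
    also have "\<dots> \<le> exp (K * \<bar>Im \<nu>\<bar>) * (M * 2 ^ m * exp (R0 * (\<sigma> + d + \<delta>)) * exp (- R * \<delta>) +
        C2 * exp (R0 * (d + \<delta>)) * exp (- R * \<delta>) * 1 + M * 2 ^ m / c ^ 2 * exp (- R * \<delta>))"
    proof (intro mult_left_mono add_mono order.refl)
      show "exp (- R * (\<sigma> - d)) \<le> exp (- R * \<delta>)"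
        using R(3) d \<delta> by (simp add: mult_left_mono)
    next
      have "C2 \<ge> 0" using cM \<rho> by (simp add: C2_def)
      then show "0 \<le> C2 * exp (R0 * (d + \<delta>)) * exp (- R * \<delta>)" by simp
    qed (use b cM in auto)
    also have "\<dots> = X * exp (- R * \<delta>)" by (simp add: X_def algebra_simps)
    also have "\<dots> < norm A\<^sub>0 / 2" by (rule R(1))
    finally have "norm A\<^sub>0 * b < norm A\<^sub>0 * (1 / 2)" by (simp add: b_def mult_ac)
    then have "b < 1 / 2" using A0 by (simp add: mult_less_cancel_left)
    then show "exp (R * \<sigma>) * gnorm R K T \<psi> \<le> 1 / 2" by (simp add: b_def s_def)
  qed
qed

text \<open>
  By continuity in \<open>R\<close> the bound \<open>1\<close> cannot be violated at \<open>R1\<close>: the scaled norm is below \<open>1\<close> for large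
  \<open>R\<close> and would have to take the value \<open>1\<close> somewhere, contrary to \<open>bootstrap\<close>.
\<close>

lemma gnorm_bound:
  assumes K: "K \<ge> 0"
  shows "\<exists>R. \<forall>T. gnorm R K T \<psi> \<le> exp (- R * \<sigma>)"
proof -
  obtain R1 where R1: "\<And>R T. R \<ge> R1 \<Longrightarrow> T \<ge> \<sigma> \<Longrightarrow> exp (R * \<sigma>) * gnorm R K T \<psi> \<le> 1 \<Longrightarrow> exp (R * \<sigma>) * gnorm R K T \<psi> \<le> 1 / 2"
    using bootstrap[OF K] by blast
  have *: "exp (R1 * \<sigma>) * gnorm R1 K T \<psi> \<le> 1" if T: "T \<ge> \<sigma>" for T
  proof (rule ccontr)
    assume big: "\<not> ?thesis"
    define b where "b R = exp (R * \<sigma>) * gnorm R K T \<psi>" for R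
    have b_eq: "b R = (\<Sum>t | gcoeff \<psi> t \<noteq> 0 \<and> Re t \<le> T. norm (gcoeff \<psi> t) * exp (- R * (Re t - \<sigma>) + K * \<bar>Im t\<bar>))" for R
      unfolding b_def gnorm_def wt_def sum_distrib_left
      by (intro sum.cong refl) (simp add: algebra_simps flip: exp_add)
    have cont: "continuous_on A b" for A
      unfolding b_eq[abs_def] by (intro continuous_intros)
    have "((\<lambda>R. exp (- R * (Re t - \<sigma>) + K * \<bar>Im t\<bar>)) \<longlongrightarrow> 0) at_top" if "gcoeff \<psi> t \<noteq> 0" for t
    proof -
      have "Re t - \<sigma> > 0" using \<psi>_ord[OF that] \<delta> by simp
      then show ?thesis by real_asymp
    qed
    then have "(b \<longlongrightarrow> (\<Sum>t | gcoeff \<psi> t \<noteq> 0 \<and> Re t \<le> T. norm (gcoeff \<psi> t) * 0)) at_top"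
      unfolding b_eq[abs_def] by (intro tendsto_sum tendsto_mult tendsto_const) auto
    then have "\<forall>\<^sub>F R in at_top. b R < 1" by (intro order_tendstoD(2)) auto
    then have "\<forall>\<^sub>F R in at_top. b R < 1 \<and> R \<ge> R1" using eventually_ge_at_top[of R1] by eventually_elim auto
    then obtain R2 where R2: "b R2 < 1" "R2 \<ge> R1" unfolding eventually_at_top_linorder by blast
    obtain R where R: "R1 \<le> R" "R \<le> R2" "b R = 1"
      using IVT2'[of b R2 1 R1] R2 big cont by (auto simp: b_def)
    then show False using R1[OF R(1) T] by (simp add: b_def)
  qed
  have "gnorm R1 K T \<psi> \<le> exp (- R1 * \<sigma>)" for T
  proof -
    have "exp (R1 * \<sigma>) * gnorm R1 K T \<psi> \<le> exp (R1 * \<sigma>) * gnorm R1 K (max T \<sigma>) \<psi>"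
      by (intro mult_left_mono gnorm_mono) auto
    also have "\<dots> \<le> 1" by (rule *) simp
    finally show ?thesis by (simp add: exp_minus field_simps)
  qed
  then show ?thesis by blast
qed

end

section \<open>Convergence of formal solutions\<close>

text \<open>
  The coefficient of a composition may be computed over any finite set of multi-indices that contains
  the contributing ones.
\<close>

lemma gcoeff_gps_subst_sum:
  assumes "\<And>k. k < m \<Longrightarrow> gcoeff (g k) 0 = 0"
    and "finite J" "contributing m g t \<subseteq> J" "\<And>\<gamma> k. \<gamma> \<in> J \<Longrightarrow> k \<ge> m \<Longrightarrow> \<gamma> k = 0"
  shows "gcoeff (gps_subst m F g) t = (\<Sum>\<gamma>\<in>J. taylor_coeff m F \<gamma> * gcoeff (gmon m g \<gamma>) t)"
proof -
  have "gcoeff (gps_subst m F g) t =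
      (\<Sum>\<gamma>\<in>contributing m g t. taylor_coeff m F \<gamma> * gcoeff (gmon m g \<gamma>) t)"
    unfolding gmon_def by (rule gcoeff_gps_subst) (rule assms(1))
  also have "\<dots> = (\<Sum>\<gamma>\<in>J. taylor_coeff m F \<gamma> * gcoeff (gmon m g \<gamma>) t)"
    by (rule sum.mono_neutral_left) (use assms in \<open>auto simp: contributing_def gmon_def\<close>)
  finally show ?thesis .
qed

lemma contributing_subset_box:
  assumes "\<And>k. k < m \<Longrightarrow> gcoeff (g k) 0 = 0"
  shows "\<exists>N0. \<forall>t. Re t \<le> T \<longrightarrow> contributing m g t \<subseteq> box m N0"
proof -
  let ?U = "\<Union>t\<in>{t. Re t \<le> T}. contributing m g t"
  have fin: "finite ?U" by (rule finite_contributing_halfplane[OF assms])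
  define N0 where "N0 = (\<Sum>\<gamma>\<in>?U. \<Sum>k<m. \<gamma> k)"
  have "\<gamma> \<in> box m N0" if "Re t \<le> T" "\<gamma> \<in> contributing m g t" for t \<gamma>
  proof -
    have \<gamma>: "\<gamma> \<in> ?U" using that by blast
    have "\<gamma> k \<le> N0" if "k < m" for k
    proof -
      have "\<gamma> k \<le> (\<Sum>k<m. \<gamma> k)" using that by (intro member_le_sum) auto
      also have "\<dots> \<le> N0" unfolding N0_def by (rule member_le_sum[OF \<gamma>]) (use fin in auto)
      finally show ?thesis .
    qed
    then show ?thesis using that(2) by (auto simp: box_def contributing_def)
  qed
  then show ?thesis by blast
qed

lemma box_mono: "N \<le> N' \<Longrightarrow> box m N \<subseteq> box m N'"
  by (auto simp: box_def intro: order_trans)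

text \<open>
  By discreteness of the real parts, a strict bound on the order has room to spare.
\<close>

lemma order_gap:
  assumes "\<And>t. gcoeff f t \<noteq> 0 \<Longrightarrow> x < Re t"
  shows "\<exists>\<delta>>0. \<forall>t. gcoeff f t \<noteq> 0 \<longrightarrow> x + \<delta> \<le> Re t"
proof -
  define S where "S = insert 1 ((\<lambda>t. Re t - x) ` {t. gcoeff f t \<noteq> 0 \<and> Re t \<le> x + 1})"
  have S: "finite S" "S \<noteq> {}" by (auto simp: S_def finite_gcoeff)
  show ?thesis
  proof (intro exI[of _ "Min S"] conjI allI impI)
    show "Min S > 0" using S assms by (subst Min_gr_iff) (auto simp: S_def)
    fix t assume t: "gcoeff f t \<noteq> 0"
    show "x + Min S \<le> Re t"
    proof (cases "Re t \<le> x + 1")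
      case True
      then have "Min S \<le> Re t - x" using S t by (intro Min_le) (auto simp: S_def)
      then show ?thesis by simp
    next
      case False
      have "Min S \<le> 1" using S(1) by (simp add: S_def)
      then show ?thesis using False by simp
    qed
  qed
qed

text \<open>
  The part of a series with exponents of real part at most \<open>T\<close>.
\<close>

definition gtrunc :: "real \<Rightarrow> gps \<Rightarrow> gps" where
  "gtrunc T f = Abs_gps (\<lambda>t. if Re t \<le> T then gcoeff f t else 0)"

lemma gcoeff_gtrunc: "gcoeff (gtrunc T f) t = (if Re t \<le> T then gcoeff f t else 0)"
proof -
  have "finite {t. (if Re t \<le> T then gcoeff f t else 0) \<noteq> 0 \<and> Re t \<le> R}" for R
    by (rule finite_subset[OF _ finite_gcoeff[of f R]]) auto
  then show ?thesis
    unfolding gtrunc_def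
    by (subst gcoeff_Abs_gps) (auto dest: gcoeff_nonzeroD split: if_splits)
qed

lemma mahler_solution_gnorm_bounded:
  fixes \<phi> :: gps
  assumes l: "l \<ge> 2" and F: "holomorphic_near_0 (n + 2) F"
    and \<phi>0: "gcoeff \<phi> 0 = 0"
    and sol: "formally_satisfies_mahler l n F \<phi>"
    and A0: "A\<^sub>0 \<noteq> 0" and h: "gps_small_o \<nu> h"
    and deriv: "\<And>t. gcoeff (gps_subst (n + 2) (partial_deriv 1 F) (mahler_tuple l \<phi>)) t =
        (if t = \<nu> then A\<^sub>0 else 0) + gcoeff h t"
    and K: "K \<ge> 0"
  shows "\<exists>R B. \<forall>T. gnorm R K T \<phi> \<le> B"
proof -
  define m where "m = n + 2"
  define g where "g = mahler_tuple l \<phi>"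
  define a where "a = taylor_coeff m F"
  obtain r where r: "r > 0" "sep_hol m r F"
    using holomorphic_near_0_imp_sep_hol[OF F] unfolding m_def by blast
  obtain M \<rho> where M: "M \<ge> 0" "\<rho> > 0" "\<And>\<gamma>. norm (a \<gamma>) \<le> M / (\<Prod>k<m. \<rho> ^ \<gamma> k)"
    using taylor_coeff_bound[OF r(2,1)] unfolding a_def by blast
  have a': "taylor_coeff m (partial_deriv 1 F) \<alpha> = of_nat (Suc (\<alpha> 1)) * a (\<alpha>(1 := Suc (\<alpha> 1)))" for \<alpha>
    unfolding a_def by (rule taylor_coeff_partial_deriv[OF r(2) _ r(1)]) (simp add: m_def)
  have g0: "gcoeff (g k) 0 = 0" for k
    unfolding g_def by (rule mahler_tuple_const_term) (use l \<phi>0 in auto)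
  have h_ord: "Re \<nu> < Re t" if "gcoeff h t \<noteq> 0" for t using h that by (auto simp: gps_small_o_def)
  have "gcoeff h \<nu> = 0" using h_ord[of \<nu>] by auto
  then have "gcoeff (gps_subst (n + 2) (partial_deriv 1 F) (mahler_tuple l \<phi>)) \<nu> \<noteq> 0"
    using deriv[of \<nu>] A0 by simp
  then have \<nu>: "\<nu> = 0 \<or> Re \<nu> > 0" by (rule gcoeff_nonzeroD)
  \<comment> \<open>Large enough for quadratic terms in the tail to remain of higher order after division by \<open>x\<^bsup>\<nu>\<^esup>\<close>.\<close>
  define \<sigma> where "\<sigma> = 2 * Re \<nu> + 2"
  define P where "P = gtrunc \<sigma> \<phi>"
  define \<psi> where "\<psi> = \<phi> - P"
  have \<phi>: "P + \<psi> = \<phi>" by (simp add: \<psi>_def)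
  have P_fin: "finite {t. gcoeff P t \<noteq> 0}"
    by (rule finite_subset[OF _ finite_gcoeff[of \<phi> \<sigma>]]) (auto simp: P_def gcoeff_gtrunc)
  have P_pos: "Re t > 0" if "gcoeff P t \<noteq> 0" for t
  proof -
    have "gcoeff \<phi> t \<noteq> 0" using that by (auto simp: P_def gcoeff_gtrunc split: if_splits)
    then show ?thesis using gcoeff_nonzeroD[of \<phi> t] \<phi>0 by auto
  qed
  have "\<sigma> < Re t" if "gcoeff \<psi> t \<noteq> 0" for t
    using that by (auto simp: \<psi>_def P_def gcoeff_gtrunc split: if_splits)
  then obtain \<delta>1 where \<delta>1: "\<delta>1 > 0" "\<And>t. gcoeff \<psi> t \<noteq> 0 \<Longrightarrow> \<sigma> + \<delta>1 \<le> Re t"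
    using order_gap[of \<psi> \<sigma>] by blast
  obtain \<delta>2 where \<delta>2: "\<delta>2 > 0" "\<And>t. gcoeff h t \<noteq> 0 \<Longrightarrow> Re \<nu> + \<delta>2 \<le> Re t"
    using order_gap[of h "Re \<nu>"] h_ord by blast
  define \<delta> where "\<delta> = min 1 (min \<delta>1 \<delta>2)"

  have eqn: "\<exists>N0. \<forall>N\<ge>N0. \<forall>t. Re t \<le> T \<longrightarrow>
      gcoeff (\<Sum>\<gamma>\<in>box m N. gscale (a \<gamma>) (gmon m g \<gamma>)) t = 0" for T
  proof -
    obtain N0 where N0: "\<And>t. Re t \<le> T \<Longrightarrow> contributing m g t \<subseteq> box m N0"
      using contributing_subset_box[of m g T] g0 by blast
    show ?thesis
    proof (intro exI[of _ N0] allI impI)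
      fix N t assume N: "N0 \<le> N" and t: "Re t \<le> T"
      have "gcoeff (gps_subst m F g) t = (\<Sum>\<gamma>\<in>box m N. a \<gamma> * gcoeff (gmon m g \<gamma>) t)"
        unfolding a_def
      proof (rule gcoeff_gps_subst_sum[OF g0 finite_box])
        show "contributing m g t \<subseteq> box m N" using N0[OF t] box_mono[OF N] by blast
      qed (auto simp: box_def)
      moreover have "gcoeff (gps_subst m F g) t = 0"
        using sol by (simp add: formally_satisfies_mahler_def m_def g_def)
      ultimately show "gcoeff (\<Sum>\<gamma>\<in>box m N. gscale (a \<gamma>) (gmon m g \<gamma>)) t = 0"
        by (simp add: gcoeff_sum)
    qed
  qed
  have deriv_eqn: "\<exists>N0. \<forall>N\<ge>N0. \<forall>t. Re t \<le> T \<longrightarrow>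
      gcoeff (\<Sum>\<gamma>\<in>box m N. gscale (a \<gamma> * of_nat (\<gamma> 1)) (gmon m g (\<gamma>(1 := \<gamma> 1 - 1)))) t =
      (if t = \<nu> then A\<^sub>0 else 0) + gcoeff h t" for T
  proof -
    obtain N0 where N0: "\<And>t. Re t \<le> T \<Longrightarrow> contributing m g t \<subseteq> box m N0"
      using contributing_subset_box[of m g T] g0 by blast
    show ?thesis
    proof (intro exI[of _ "Suc N0"] allI impI)
      fix N t assume N: "Suc N0 \<le> N" and t: "Re t \<le> T"
      \<comment> \<open>Only multi-indices with \<open>\<gamma> 1 \<noteq> 0\<close> survive differentiation, and lowering \<open>\<gamma> 1\<close> maps them onto a set containing the box of size \<open>N0\<close>.\<close>
      define I where "I = {\<gamma> \<in> box m N. \<gamma> 1 \<noteq> 0}"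
      define J where "J = (\<lambda>\<gamma>. \<gamma>(1 := \<gamma> 1 - 1)) ` I"
      have inj: "inj_on (\<lambda>\<gamma>. \<gamma>(1 := \<gamma> 1 - 1)) I"
      proof (rule inj_onI)
        fix \<gamma> \<gamma>' :: "nat \<Rightarrow> nat"
        assume A: "\<gamma> \<in> I" "\<gamma>' \<in> I" "\<gamma>(1 := \<gamma> 1 - 1) = \<gamma>'(1 := \<gamma>' 1 - 1)"
        have "\<gamma> k = \<gamma>' k" for k
          using fun_cong[OF A(3), of k] A(1,2) by (cases "k = 1") (auto simp: I_def)
        then show "\<gamma> = \<gamma>'" by blast
      qed
      have J: "contributing m g t \<subseteq> J"
      proof
        fix \<alpha> assume "\<alpha> \<in> contributing m g t"
        then have "\<alpha> \<in> box m N0" using N0[OF t] by blast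
        then have "\<alpha>(1 := Suc (\<alpha> 1)) \<in> I" using N by (auto simp: I_def box_def m_def)
        moreover have "\<alpha> = (\<alpha>(1 := Suc (\<alpha> 1)))(1 := (\<alpha>(1 := Suc (\<alpha> 1))) 1 - 1)" by simp
        ultimately show "\<alpha> \<in> J" unfolding J_def by blast
      qed
      have "gcoeff (gps_subst m (partial_deriv 1 F) g) t =
          (\<Sum>\<alpha>\<in>J. taylor_coeff m (partial_deriv 1 F) \<alpha> * gcoeff (gmon m g \<alpha>) t)"
      proof (rule gcoeff_gps_subst_sum[OF g0 _ J])
        show "finite J" by (simp add: J_def I_def finite_box)
        show "\<alpha> k = 0" if "\<alpha> \<in> J" "k \<ge> m" for \<alpha> k
          using that by (auto simp: J_def I_def box_def)
      qed
      also have "\<dots> = (\<Sum>\<gamma>\<in>I. taylor_coeff m (partial_deriv 1 F) (\<gamma>(1 := \<gamma> 1 - 1)) * gcoeff (gmon m g (\<gamma>(1 := \<gamma> 1 - 1))) t)"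
        unfolding J_def by (subst sum.reindex[OF inj]) (simp add: o_def)
      also have "\<dots> = (\<Sum>\<gamma>\<in>I. a \<gamma> * of_nat (\<gamma> 1) * gcoeff (gmon m g (\<gamma>(1 := \<gamma> 1 - 1))) t)"
      proof (rule sum.cong[OF refl])
        fix \<gamma> assume "\<gamma> \<in> I"
        then have "Suc (\<gamma> 1 - 1) = \<gamma> 1" by (simp add: I_def)
        then show "taylor_coeff m (partial_deriv 1 F) (\<gamma>(1 := \<gamma> 1 - 1)) * gcoeff (gmon m g (\<gamma>(1 := \<gamma> 1 - 1))) t =
            a \<gamma> * of_nat (\<gamma> 1) * gcoeff (gmon m g (\<gamma>(1 := \<gamma> 1 - 1))) t"
          unfolding a' by (simp del: of_nat_Suc One_nat_def)
      qed
      also have "\<dots> = (\<Sum>\<gamma>\<in>box m N. a \<gamma> * of_nat (\<gamma> 1) * gcoeff (gmon m g (\<gamma>(1 := \<gamma> 1 - 1))) t)"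
        by (rule sum.mono_neutral_left) (auto simp: I_def finite_box)
      finally show "gcoeff (\<Sum>\<gamma>\<in>box m N. gscale (a \<gamma> * of_nat (\<gamma> 1)) (gmon m g (\<gamma>(1 := \<gamma> 1 - 1)))) t =
          (if t = \<nu> then A\<^sub>0 else 0) + gcoeff h t"
        using deriv[of t] by (simp add: gcoeff_sum m_def g_def del: One_nat_def)
    qed
  qed
  interpret mahler_tail l n a P \<psi> h A\<^sub>0 \<nu> \<sigma> \<delta> M \<rho>
  proof
    show "\<exists>N0. \<forall>N\<ge>N0. \<forall>t. Re t \<le> T \<longrightarrow>
      gcoeff (\<Sum>\<gamma>\<in>box (n+2) N. gscale (a \<gamma>) (gmon (n+2) (mahler_tuple l (P + \<psi>)) \<gamma>)) t = 0" for T
      using eqn[of T] unfolding \<phi> m_def g_def .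
    show "\<exists>N0. \<forall>N\<ge>N0. \<forall>t. Re t \<le> T \<longrightarrow>
      gcoeff (\<Sum>\<gamma>\<in>box (n+2) N. gscale (a \<gamma> * of_nat (\<gamma> 1))
        (gmon (n+2) (mahler_tuple l (P + \<psi>)) (\<gamma>(1 := \<gamma> 1 - 1)))) t =
      (if t = \<nu> then A\<^sub>0 else 0) + gcoeff h t" for T
      using deriv_eqn[of T] unfolding \<phi> m_def g_def .
    show "\<sigma> + \<delta> \<le> Re t" if "gcoeff \<psi> t \<noteq> 0" for t using \<delta>1(2)[OF that] by (simp add: \<delta>_def)
    show "Re \<nu> + \<delta> \<le> Re t" if "gcoeff h t \<noteq> 0" for t using \<delta>2(2)[OF that] by (simp add: \<delta>_def)
    show "norm (a \<gamma>) \<le> M / (\<Prod>k<n+2. \<rho> ^ \<gamma> k)" for \<gamma> using M(3)[of \<gamma>] unfolding m_def .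
    show "0 < \<delta>" "\<delta> \<le> 1" using \<delta>1(1) \<delta>2(1) by (auto simp: \<delta>_def)
  qed (fact l A0 \<nu> \<sigma>_def P_fin P_pos M(1) M(2))+
  obtain R where R: "\<And>T. gnorm R K T \<psi> \<le> exp (- R * \<sigma>)" using gnorm_bound[OF K] by blast
  define B where "B = (\<Sum>t | gcoeff P t \<noteq> 0. norm (gcoeff P t) * wt R K t)"
  have "gnorm R K T \<phi> \<le> B + exp (- R * \<sigma>)" for T
  proof -
    have "gnorm R K T P \<le> B" unfolding gnorm_def B_def by (rule sum_mono2) (use P_fin in auto)
    then show ?thesis using gnorm_add[of R K T P \<psi>] R[of T] \<phi> by simp
  qed
  then show ?thesis by blast
qed

theorem theorem7:
  fixes n l :: nat
    and F :: "(nat \<Rightarrow> complex) \<Rightarrow> complex"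
    and c e :: "nat \<Rightarrow> complex"
    and A\<^sub>0 \<nu> :: complex
  assumes "n \<ge> 1" and "l \<ge> 2"
    and "holomorphic_near_0 (n + 2) F"
    and "inj e" and "\<And>k. Re (e k) > 0" and "mono (\<lambda>k. Re (e k))"
    and "filterlim (\<lambda>k. Re (e k)) at_top sequentially"
    and "formally_satisfies_mahler l n F (gps_of_seq c e)"
    and "A\<^sub>0 \<noteq> 0"
    and "\<exists>h. gps_small_o \<nu> h \<and>
      (\<forall>t. gcoeff (gps_subst (n + 2) (partial_deriv 1 F) (mahler_tuple l (gps_of_seq c e))) t =
        (if t = \<nu> then A\<^sub>0 else 0) + gcoeff h t)"
  shows "\<forall>a b L. a < b \<and> b - a < 2 * pi \<and> log_branch (sector a b) L \<longrightarrow>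
    (\<exists>R>0. \<exists>f. f holomorphic_on (sector a b \<inter> ball 0 R) \<and>
      uniform_limit (sector a b \<inter> ball 0 R) (\<lambda>N x. \<Sum>k<N. c k * exp (e k * L x)) f sequentially)"
proof (intro allI impI)
  fix a b L assume L: "a < b \<and> b - a < 2 * pi \<and> log_branch (sector a b) L"
  define \<phi> where "\<phi> = gps_of_seq c e"
  have coeff: "gcoeff \<phi> (e k) = c k" for k
    unfolding \<phi>_def by (rule gcoeff_gps_of_seq_exponent[OF assms(4,5,7)])
  have "{k. e k = 0} = {}" using assms(5) by (metis (mono_tags) empty_Collect_eq less_irrefl zero_complex.sel(1))
  then have \<phi>0: "gcoeff \<phi> 0 = 0"
    unfolding \<phi>_def gcoeff_gps_of_seq[OF assms(4,5,7)] by simp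
  obtain K where K: "K \<ge> 0" "\<And>x. x \<in> sector a b \<Longrightarrow> \<bar>Im (L x)\<bar> \<le> K"
    using Im_log_branch_bounded[of a b L] L by blast
  obtain h where h: "gps_small_o \<nu> h" "\<And>t. gcoeff (gps_subst (n + 2) (partial_deriv 1 F) (mahler_tuple l \<phi>)) t =
        (if t = \<nu> then A\<^sub>0 else 0) + gcoeff h t"
    using assms(10) unfolding \<phi>_def by blast
  obtain R B where B: "\<And>T. gnorm R K T \<phi> \<le> B"
    using mahler_solution_gnorm_bounded[OF assms(2,3) \<phi>0 assms(8)[folded \<phi>_def] assms(9) h K(1)] by blast
  have "(\<Sum>k<N. norm (c k) * exp (- R * Re (e k) + K * \<bar>Im (e k)\<bar>)) \<le> B" for N
  proof -
    define T where "T = Re (e N)"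
    have "(\<Sum>k<N. norm (c k) * exp (- R * Re (e k) + K * \<bar>Im (e k)\<bar>)) =
        (\<Sum>t\<in>e ` {..<N}. norm (gcoeff \<phi> t) * wt R K t)"
      using assms(4) by (subst sum.reindex) (auto simp: coeff wt_def inj_on_def dest: injD)
    also have "\<dots> = (\<Sum>t\<in>{t \<in> e ` {..<N}. gcoeff \<phi> t \<noteq> 0}. norm (gcoeff \<phi> t) * wt R K t)"
      by (rule sum.mono_neutral_right) auto
    also have "\<dots> \<le> gnorm R K T \<phi>"
      unfolding gnorm_def
    proof (rule sum_mono2)
      show "{t \<in> e ` {..<N}. gcoeff \<phi> t \<noteq> 0} \<subseteq> {t. gcoeff \<phi> t \<noteq> 0 \<and> Re t \<le> T}"
        using assms(6) by (auto simp: T_def mono_def)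
    qed (auto simp: finite_gcoeff)
    also have "\<dots> \<le> B" by (rule B)
    finally show ?thesis .
  qed
  then show "\<exists>R>0. \<exists>f. f holomorphic_on (sector a b \<inter> ball 0 R) \<and>
      uniform_limit (sector a b \<inter> ball 0 R) (\<lambda>N x. \<Sum>k<N. c k * exp (e k * L x)) f sequentially"
    using L K(2) less_imp_le[OF assms(5)] by (intro generalized_series_converges_in_sector) auto
qed

end
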